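(* Let $d>3$ and let $\{w_{x,y}\}$ be random conductances on $\mathbb{Z}^d$ satisfying Assumption (H1) (stated in the context). For every $\lambda>0$ and $\gamma>0$ there is an almost surely finite random variable $k_0=k_0(\omega)\ge 1$ (depending on $\gamma$ and $\lambda$ but not on $f$) such that for every $f\in\mathscr{S}_0^\lambda$ there is a constant $C_0>0$ (non-random, depending on $f$, $\gamma$ and $\lambda$) such that, for every $\omega$ with $k_0(\omega)<\infty$ and all integers $k\ge 2$ with $k\ge k_0(\omega)$, $$\big\|R_\lambda^{(k),\omega}f-\bar R_\lambda f\big\|_{L^2(\mathbb{R}^d;dx)}\le C_0\,(\log k)^{-\frac12+\frac{1+\gamma}{2(d-2)}}.$$
   Context: $|\cdot|$ is the Euclidean norm. Assumption (H1): on a probability space $(\Omega,\mathcal{F},\mathbb{P})$ with expectation $\mathbb{E}$, $\{w_{x,y}\}$ is a family of independent random variables indexed by the unordered pairs of distinct points $x\neq y$ of $\mathbb{Z}^d$ (not necessarily identically distributed), such that (i) $w_{x,y}=w_{y,x}$ for all $x\ne y$; (ii) $\mathbb{E}[w_{x,y}]=1$ for all $x\neq y$; (iii) there are constants $0<C_1\le C_2<\infty$ with $C_1\le w_{x,y}(\omega)\le C_2$ for all $x\neq y$ and all $\omega\in\Omega$. For an integer $k\ge 2$, $\mu^{(k)}$ is the measure on $k^{-1}\mathbb{Z}^d$ giving mass $k^{-d}$ to each point. The scaled operator is, for $g\in L^2(k^{-1}\mathbb{Z}^d;\mu^{(k)})$ and $x\in k^{-1}\mathbb{Z}^d$, $$\mathcal{L}^{(k),\omega}g(x)=(\log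 k)^{-1}k^{-d}\sum_{y\in k^{-1}\mathbb{Z}^d:\,y\neq x}\big(g(y)-g(x)\big)\frac{w_{kx,ky}(\omega)}{|x-y|^{d+2}}.$$ The limit operator is $\bar{\mathcal{L}}g=a_0\Delta g$, where $\Delta$ is the standard Laplacian on $\mathbb{R}^d$ and $$a_0=\lim_{k\to\infty}\frac{1}{2d\log k}\sum_{z\in\mathbb{Z}^d:\,0<|z|\le k}|z|^{-d}.$$ For $\lambda>0$, $\bar R_\lambda=(\lambda-\bar{\mathcal{L}})^{-1}$ is the $\lambda$-resolvent of $\bar{\mathcal{L}}$, and $$\mathscr{S}_0^\lambda=\{f:\ f=(\lambda-\bar{\mathcal{L}})g\text{ for some }g\in C_c^\infty(\mathbb{R}^d)\}=\{f:\ \bar R_\lambda f\in C_c^\infty(\mathbb{R}^d)\}.$$ For $f\in\mathscr{S}_0^\lambda$, $R_\lambda^{(k),\omega}f=u_k^\omega\in L^2(k^{-1}\mathbb{Z}^d;\mu^{(k)})$ denotes the unique solution of $(\lambda-\mathcal{L}^{(k),\omega})u_k^\omega(x)=f(x)$, $x\in k^{-1}\mathbb{Z}^d$. It is extended to a function on $\mathbb{R}^d$ by setting $u_k^\omega(x)=u_k^\omega(z)$ if $x\in\prod_{1\le i\le d}(z_i,z_i+k^{-1}]$ for the unique such $z=(z_1,\dots,z_d)\in k^{-1}\mathbb{Z}^d$; this extension is used in the $L^2(\mathbb{R}^d;dx)$ norm. *)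

theory Defs
  imports "HOL-Probability.Probability"
begin

definition int_lattice :: "(real ^ 'd) set" where
  "int_lattice = {x. \<forall>i. x $ i \<in> \<int>}"

definition scaled_lattice :: "nat \<Rightarrow> (real ^ 'd) set" where
  "scaled_lattice k = {x. real k *\<^sub>R x \<in> int_lattice}"

text \<open>A family indexed by unordered pairs is written as a symmetric function of two lattice
  points, regarded as vectors with integer entries; its values at equal arguments or outside the
  lattice play no role. Independence concerns the family indexed by the two-point sets
  \<open>{x, y}\<close>, so each unordered pair occurs once; by symmetry the description below determines a
  unique random variable.\<close>

definition pair_weight ::
  "(real ^ 'd \<Rightarrow> real ^ 'd \<Rightarrow> 'w \<Rightarrow> real) \<Rightarrow> (real ^ 'd) set \<Rightarrow> 'w \<Rightarrow> real" where
  "pair_weight w e \<omega> = (THE v. \<exists>x y. e = {x, y} \<and> v = w x y \<omega>)"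

definition assumption_H1 ::
  "'w measure \<Rightarrow> (real ^ 'd \<Rightarrow> real ^ 'd \<Rightarrow> 'w \<Rightarrow> real) \<Rightarrow> bool" where
  "assumption_H1 M w \<longleftrightarrow>
     prob_space M \<and>
     (\<forall>x\<in>int_lattice. \<forall>y\<in>int_lattice. x \<noteq> y \<longrightarrow>
        (\<forall>\<omega>\<in>space M. w x y \<omega> = w y x \<omega>)) \<and>
     prob_space.indep_vars M (\<lambda>_. borel) (pair_weight w)
       {{x, y} | x y. x \<in> int_lattice \<and> y \<in> int_lattice \<and> x \<noteq> y} \<and>
     (\<forall>x\<in>int_lattice. \<forall>y\<in>int_lattice. x \<noteq> y \<longrightarrow> integral\<^sup>L M (w x y) = 1) \<and>
     (\<exists>C1 C2. 0 < C1 \<and> C1 \<le> C2 \<and>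
        (\<forall>x\<in>int_lattice. \<forall>y\<in>int_lattice. x \<noteq> y \<longrightarrow>
           (\<forall>\<omega>\<in>space M. C1 \<le> w x y \<omega> \<and> w x y \<omega> \<le> C2)))"

definition square_integrable_fun :: "'a measure \<Rightarrow> ('a \<Rightarrow> real) \<Rightarrow> bool" where
  "square_integrable_fun M g \<longleftrightarrow> g \<in> borel_measurable M \<and> integrable M (\<lambda>x. (g x)\<^sup>2)"

text \<open>The norm is infinite outside \<open>L\<^sup>2\<close>, since the Bochner integral of a
  non-integrable function is 0.\<close>

definition L2_norm :: "'a measure \<Rightarrow> ('a \<Rightarrow> real) \<Rightarrow> ennreal" where
  "L2_norm M g =
     (if square_integrable_fun M g then ennreal (sqrt (LINT x|M. (g x)\<^sup>2)) else \<infinity>)"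

definition lattice_measure :: "nat \<Rightarrow> (real ^ 'd) measure" where
  "lattice_measure k = point_measure (scaled_lattice k) (\<lambda>_. ennreal (1 / real k ^ CARD('d)))"

definition scaled_generator ::
  "(real ^ 'd \<Rightarrow> real ^ 'd \<Rightarrow> 'w \<Rightarrow> real) \<Rightarrow> nat \<Rightarrow> 'w
     \<Rightarrow> (real ^ 'd \<Rightarrow> real) \<Rightarrow> real ^ 'd \<Rightarrow> real" where
  "scaled_generator w k \<omega> g x =
     1 / (ln (real k) * real k ^ CARD('d)) *
     (\<Sum>\<^sub>\<infinity>y\<in>scaled_lattice k - {x}.
        (g y - g x) * (w (real k *\<^sub>R x) (real k *\<^sub>R y) \<omega> / norm (x - y) ^ (CARD('d) + 2)))"

text \<open>Functions on the scaled lattice are extensional functions on the whole space, so that the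
  solution of the resolvent equation is unique as a function.\<close>

definition scaled_resolvent ::
  "(real ^ 'd \<Rightarrow> real ^ 'd \<Rightarrow> 'w \<Rightarrow> real) \<Rightarrow> real \<Rightarrow> nat \<Rightarrow> 'w
     \<Rightarrow> (real ^ 'd \<Rightarrow> real) \<Rightarrow> real ^ 'd \<Rightarrow> real" where
  "scaled_resolvent w l k \<omega> f =
     (THE u. u \<in> extensional (scaled_lattice k) \<and>
        square_integrable_fun (lattice_measure k) u \<and>
        (\<forall>x\<in>scaled_lattice k. l * u x - scaled_generator w k \<omega> u x = f x))"

definition cell_point :: "nat \<Rightarrow> real ^ 'd \<Rightarrow> real ^ 'd" where
  "cell_point k x =
     (THE z. z \<in> scaled_lattice k \<and> (\<forall>i. x $ i \<in> {z $ i <.. z $ i + 1 / real k}))"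

definition lattice_extension :: "nat \<Rightarrow> (real ^ 'd \<Rightarrow> real) \<Rightarrow> real ^ 'd \<Rightarrow> real" where
  "lattice_extension k u x = u (cell_point k x)"

definition partial_deriv :: "'d \<Rightarrow> (real ^ 'd \<Rightarrow> real) \<Rightarrow> real ^ 'd \<Rightarrow> real" where
  "partial_deriv i g x = frechet_derivative g (at x) (axis i 1)"

text \<open>Differentiability of all iterated partial derivatives, the function itself included
  (the empty list), makes them all continuous, hence the function smooth.\<close>

definition smooth_compact_support :: "(real ^ 'd \<Rightarrow> real) \<Rightarrow> bool" where
  "smooth_compact_support g \<longleftrightarrow>
     (\<forall>js x. foldr partial_deriv js g differentiable (at x)) \<and>
     compact (closure {x. g x \<noteq> 0})"

definition laplacian :: "(real ^ 'd \<Rightarrow> real) \<Rightarrow> real ^ 'd \<Rightarrow> real" where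
  "laplacian g x = (\<Sum>i\<in>UNIV. partial_deriv i (partial_deriv i g) x)"

definition a0 :: "'d::finite itself \<Rightarrow> real" where
  "a0 _ = lim (\<lambda>k. 1 / (2 * real CARD('d) * ln (real k)) *
     (\<Sum>z | z \<in> (int_lattice :: (real ^ 'd) set) \<and> 0 < norm z \<and> norm z \<le> real k.
        1 / norm z ^ CARD('d)))"

definition limit_generator :: "(real ^ 'd \<Rightarrow> real) \<Rightarrow> real ^ 'd \<Rightarrow> real" where
  "limit_generator g x = a0 TYPE('d) * laplacian g x"

text \<open>The limit operator as an operator on \<open>L\<^sup>2\<close>: the closure of its restriction to smooth
  compactly supported functions, a core for the Laplacian with domain \<open>W\<^bsup>2,2\<^esup>\<close>.
  It is given by its graph.\<close>

definition limit_generator_graph :: "((real ^ 'd \<Rightarrow> real) \<times> (real ^ 'd \<Rightarrow> real)) set" where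
  "limit_generator_graph =
     {(u, v). square_integrable_fun lborel u \<and> square_integrable_fun lborel v \<and>
        (\<exists>g. (\<forall>n::nat. smooth_compact_support (g n)) \<and>
           (\<lambda>n. L2_norm lborel (\<lambda>x. g n x - u x)) \<longlonglongrightarrow> 0 \<and>
           (\<lambda>n. L2_norm lborel (\<lambda>x. limit_generator (g n) x - v x)) \<longlonglongrightarrow> 0)}"

text \<open>The inverse of \<open>l\<close> minus the limit operator. The value is determined up to a null set,
  whence the choice operator.\<close>

definition limit_resolvent :: "real \<Rightarrow> (real ^ 'd \<Rightarrow> real) \<Rightarrow> real ^ 'd \<Rightarrow> real" where
  "limit_resolvent l f =
     (SOME u. \<exists>v. (u, v) \<in> limit_generator_graph \<and> (AE x in lborel. l * u x - v x = f x))"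

definition test_class :: "real \<Rightarrow> (real ^ 'd \<Rightarrow> real) set" where
  "test_class l =
     {f. \<exists>g. smooth_compact_support g \<and> f = (\<lambda>x. l * g x - limit_generator g x)}"

end

theory Submission
  imports Defs
begin

text \<open>
  Write \<open>u\<close> for the discrete resolvent, \<open>g\<close> for the limit resolvent of \<open>f\<close> and \<open>v = u - g\<close> on the lattice.
  The energy identity for \<open>v\<close> reduces the theorem to bounding the consistency error
  \<open>\<langle>(L\<^sub>k - L) g, v\<rangle>\<close> by a small multiple of the Dirichlet energy of \<open>v\<close> plus \<open>O(ln R / ln k)\<close>.
  Unscaled jumps longer than \<open>k\<close> or shorter than a truncation \<open>R\<close>, and Taylor remainders, are handled by the
  Cauchy-Schwarz inequality alone, since every dyadic scale of jumps contributes the same amount to the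
  logarithmic normalisation. The mean of the remaining part is a lattice sum with
  logarithmic growth. In the fluctuation of the remaining part each increment \<open>v y - v x\<close> is split
  at an intermediate lattice point \<open>z\<close>, averaged over a lens around \<open>x\<close> and \<open>y\<close>:
  the coefficient of \<open>v y - v z\<close> then is a sum of many independent
  centred variables, small by Hoeffding's inequality and a union bound. With \<open>R = 1 + ln k\<close> the
  squared error is \<open>O(ln ln k / ln k)\<close>, which is better than required.
\<close>

section \<open>Lattice point counting and lattice sums\<close>

text \<open>Why Cauchy-Schwarz alone fails: a jump of unscaled length r changes \<open>g\<close> by
  about r/k. Summing (r/k)^2 against the kernel r^-(d+2) over all r up to k gives ln k / k^2, and
  the prefactor k^2 / ln k turns this into order one. Smallness must come from the centred weights,
  yet each pair carries only one. Splitting at u, with about r^d choices in the lens, collects many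
  weights \<open>w x y\<close> with u and y fixed in one coefficient; with m = max(R, |u - y| / 2)
  its variance is O(m^-(3d+1)). Young's inequality against the Dirichlet energy asks for a square of
  order |u - y|^-(2d+3), the kernel times something summable. The surplus m^-(d-2) <= R^-(d-2) pays
  for the factor ln k of the union bound as soon as R^(d-2) >= ln k. Since R enters the final error
  only through ln R, a power of ln k is affordable. Linearising \<open>g\<close> at u keeps
  \<open>g\<close> out of the random coefficients, so one exceptional set serves every f.\<close>

lemma int_lattice_0 [simp]: "0 \<in> int_lattice"
  by (simp add: int_lattice_def)

lemma int_lattice_add: "x \<in> int_lattice \<Longrightarrow> y \<in> int_lattice \<Longrightarrow> x + y \<in> int_lattice"
  by (simp add: int_lattice_def)

lemma int_lattice_diff: "x \<in> int_lattice \<Longrightarrow> y \<in> int_lattice \<Longrightarrow> x - y \<in> int_lattice"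
  by (simp add: int_lattice_def)

lemma int_lattice_uminus: "x \<in> int_lattice \<Longrightarrow> - x \<in> int_lattice"
  by (simp add: int_lattice_def)

lemma int_lattice_norm_ge_1:
  assumes "z \<in> int_lattice" "z \<noteq> 0"
  shows "norm z \<ge> 1"
proof -
  obtain i where i: "z $ i \<noteq> 0" using assms(2) by (auto simp: vec_eq_iff)
  have "z $ i \<in> \<int>" using assms(1) by (auto simp: int_lattice_def)
  then have "1 \<le> \<bar>z $ i\<bar>" using i by (auto elim!: Ints_cases)
  also have "\<dots> \<le> norm z" by (rule component_le_norm_cart)
  finally show ?thesis .
qed

definition lattice_ball :: "real \<Rightarrow> (real ^ 'd) set" where
  "lattice_ball r = {z \<in> int_lattice. norm z \<le> r}"

lemma finite_lattice_ball [simp]: "finite (lattice_ball r :: (real ^ 'd) set)"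
proof -
  define S where "S = {m :: int. \<bar>real_of_int m\<bar> \<le> r}"
  have "S \<subseteq> {- \<lceil>r\<rceil>..\<lceil>r\<rceil>}" by (auto simp: S_def) linarith+
  then have finS: "finite S" by (rule finite_subset) simp
  have "lattice_ball r \<subseteq> (\<lambda>f. \<chi> i. real_of_int (f i)) ` (PiE (UNIV :: 'd set) (\<lambda>_. S))"
  proof
    fix z :: "real ^ 'd" assume z: "z \<in> lattice_ball r"
    define f where "f i = \<lfloor>z $ i\<rfloor>" for i
    have f: "real_of_int (f i) = z $ i" for i
      using z by (auto simp: lattice_ball_def int_lattice_def f_def)
    have "\<bar>z $ i\<bar> \<le> r" for i
      using z component_le_norm_cart[of z i] by (auto simp: lattice_ball_def)
    then have "f \<in> PiE UNIV (\<lambda>_. S)" by (auto simp: S_def f)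
    moreover have "z = (\<chi> i. real_of_int (f i))" by (simp add: f vec_eq_iff)
    ultimately show "z \<in> (\<lambda>f. \<chi> i. real_of_int (f i)) ` (PiE (UNIV :: 'd set) (\<lambda>_. S))" by blast
  qed
  then show ?thesis
    by (rule finite_subset) (intro finite_imageI finite_PiE finS, simp)
qed

lemma countable_int_lattice [simp]: "countable (int_lattice :: (real ^ 'd) set)"
proof -
  have "(int_lattice :: (real ^ 'd) set) = (\<Union>n::nat. lattice_ball (real n))"
    by (auto simp: lattice_ball_def intro: real_arch_simple)
  also have "countable \<dots>" by (intro countable_UN countableI_type countable_finite) simp
  finally show ?thesis .
qed

text \<open>The half-open convention is that of \<open>cell_point\<close>, so the cells that count
  lattice points also carry the piecewise constant extension later. Being half-open, they partition
  the space exactly.\<close>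

definition lattice_cell :: "real ^ 'd \<Rightarrow> (real ^ 'd) set" where
  "lattice_cell z = {x. \<forall>i. z $ i < x $ i \<and> x $ i \<le> z $ i + 1}"

lemma lattice_cell_sets [measurable]: "lattice_cell z \<in> sets borel"
  unfolding lattice_cell_def by measurable

lemma emeasure_lattice_cell: "emeasure lborel (lattice_cell z :: (real ^ 'd) set) = 1"
proof (rule antisym)
  have Basis_one: "(1 :: real ^ 'd) \<bullet> b = 1" if "b \<in> Basis" for b
    using that by (auto simp: Basis_vec_def inner_axis)
  have "emeasure lborel (lattice_cell z) \<le> emeasure lborel (cbox z (z + 1))"
    by (rule emeasure_mono) (auto simp: lattice_cell_def mem_box_cart less_imp_le)
  also have "\<dots> = 1"
    by (subst emeasure_lborel_cbox) (auto simp: inner_add_left Basis_one)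
  finally show "emeasure lborel (lattice_cell z) \<le> 1" .
  have "1 = emeasure lborel (box z (z + 1))"
    by (subst emeasure_lborel_box) (auto simp: inner_add_left Basis_one)
  also have "\<dots> \<le> emeasure lborel (lattice_cell z)"
    by (rule emeasure_mono) (auto simp: lattice_cell_def mem_box_cart intro: less_imp_le)
  finally show "1 \<le> emeasure lborel (lattice_cell z)" .
qed

lemma lattice_cell_unique:
  assumes "x \<in> lattice_cell z" "x \<in> lattice_cell z'" "z \<in> int_lattice" "z' \<in> int_lattice"
  shows "z = z'"
proof -
  have "z $ i = z' $ i" for i
  proof -
    obtain m n :: int where "z $ i = of_int m" "z' $ i = of_int n"
      using assms(3,4) by (auto simp: int_lattice_def elim!: Ints_cases) (metis Ints_cases)
    moreover have "z $ i < z' $ i + 1" "z' $ i < z $ i + 1"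
      using assms(1,2) unfolding lattice_cell_def by (auto intro: less_le_trans)
    ultimately show ?thesis by simp
  qed
  then show ?thesis by (simp add: vec_eq_iff)
qed

text \<open>Cells are open on the left and closed on the right, hence the base point is the ceiling
  minus one and not the floor.\<close>

lemma lattice_cell_exists:
  fixes x :: "real ^ 'd"
  shows "(\<chi> i. of_int (\<lceil>x $ i\<rceil> - 1)) \<in> int_lattice"
        "x \<in> lattice_cell (\<chi> i. of_int (\<lceil>x $ i\<rceil> - 1))"
  by (auto simp: int_lattice_def lattice_cell_def) linarith

lemma lattice_cell_norm_diff:
  fixes x z :: "real ^ 'd"
  assumes "x \<in> lattice_cell z"
  shows "norm (x - z) \<le> real CARD('d)"
proof -
  have "norm (x - z) \<le> (\<Sum>i\<in>UNIV. \<bar>(x - z) $ i\<bar>)" by (rule norm_le_l1_cart)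
  also have "\<dots> \<le> (\<Sum>i\<in>(UNIV :: 'd set). 1)"
  proof (rule sum_mono)
    fix i
    have "z $ i < x $ i" "x $ i \<le> z $ i + 1" using assms by (auto simp: lattice_cell_def)
    then show "\<bar>(x - z) $ i\<bar> \<le> 1" by simp
  qed
  finally show ?thesis by simp
qed

text \<open>Each cell has volume one, so a count of lattice points is the volume of a set squeezed
  between the balls of radius \<open>r - CARD('d)\<close> and \<open>r + CARD('d)\<close>. The next
  two lemmas are these two inclusions.\<close>

lemma emeasure_lattice_ball_cells:
  "emeasure lborel (\<Union>z\<in>lattice_ball r. lattice_cell z :: (real ^ 'd) set)
     = of_nat (card (lattice_ball r :: (real ^ 'd) set))"
proof -
  have "disjoint_family_on lattice_cell (lattice_ball r :: (real ^ 'd) set)"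
    unfolding disjoint_family_on_def
    using lattice_cell_unique by (auto simp: lattice_ball_def)
  then have "emeasure lborel (\<Union>z\<in>lattice_ball r. lattice_cell z :: (real ^ 'd) set)
     = (\<Sum>z\<in>(lattice_ball r :: (real ^ 'd) set). emeasure lborel (lattice_cell z))"
    by (intro sum_emeasure[symmetric]) auto
  then show ?thesis by (simp add: emeasure_lattice_cell)
qed

lemma card_lattice_ball_upper:
  assumes "r \<ge> 0"
  shows "real (card (lattice_ball r :: (real ^ 'd) set))
    \<le> unit_ball_vol (real CARD('d)) * (r + real CARD('d)) ^ CARD('d)"
proof -
  have "(\<Union>z\<in>lattice_ball r. lattice_cell z :: (real ^ 'd) set) \<subseteq> cball 0 (r + real CARD('d))"
  proof
    fix x :: "real ^ 'd" assume "x \<in> (\<Union>z\<in>lattice_ball r. lattice_cell z)"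
    then obtain z where z: "norm z \<le> r" "x \<in> lattice_cell z" by (auto simp: lattice_ball_def)
    have "norm x \<le> norm z + norm (x - z)" by (metis norm_triangle_sub)
    then show "x \<in> cball 0 (r + real CARD('d))"
      using z(1) lattice_cell_norm_diff[OF z(2)] by simp
  qed
  then have "emeasure lborel (\<Union>z\<in>lattice_ball r. lattice_cell z :: (real ^ 'd) set)
      \<le> emeasure lborel (cball (0 :: real ^ 'd) (r + real CARD('d)))"
    by (intro emeasure_mono) auto
  also have "\<dots> = ennreal (unit_ball_vol (real CARD('d)) * (r + real CARD('d)) ^ CARD('d))"
    using assms by (subst emeasure_cball) auto
  finally show ?thesis
    using assms by (simp add: emeasure_lattice_ball_cells ennreal_of_nat_eq_real_of_nat)
qed

lemma card_lattice_ball_lower: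
  assumes "r \<ge> real CARD('d)"
  shows "real (card (lattice_ball r :: (real ^ 'd) set))
    \<ge> unit_ball_vol (real CARD('d)) * (r - real CARD('d)) ^ CARD('d)"
proof -
  have "cball 0 (r - real CARD('d)) \<subseteq> (\<Union>z\<in>lattice_ball r. lattice_cell z :: (real ^ 'd) set)"
  proof
    fix x :: "real ^ 'd" assume x: "x \<in> cball 0 (r - real CARD('d))"
    define z :: "real ^ 'd" where "z = (\<chi> i. of_int (\<lceil>x $ i\<rceil> - 1))"
    have z: "z \<in> int_lattice" "x \<in> lattice_cell z"
      unfolding z_def by (rule lattice_cell_exists)+
    have "norm z \<le> norm x + norm (x - z)" by (metis norm_minus_commute norm_triangle_sub)
    then have "z \<in> lattice_ball r"
      using x lattice_cell_norm_diff[OF z(2)] z(1) by (simp add: lattice_ball_def)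
    with z(2) show "x \<in> (\<Union>z\<in>lattice_ball r. lattice_cell z)" by blast
  qed
  then have "emeasure lborel (cball (0 :: real ^ 'd) (r - real CARD('d)))
      \<le> emeasure lborel (\<Union>z\<in>lattice_ball r. lattice_cell z :: (real ^ 'd) set)"
    by (intro emeasure_mono) (auto intro!: sets.finite_UN)
  moreover have "emeasure lborel (cball (0 :: real ^ 'd) (r - real CARD('d)))
      = ennreal (unit_ball_vol (real CARD('d)) * (r - real CARD('d)) ^ CARD('d))"
    using assms by (subst emeasure_cball) auto
  ultimately show ?thesis
    by (simp add: emeasure_lattice_ball_cells ennreal_of_nat_eq_real_of_nat)
qed

lemma power_diff_le_real:
  fixes a b :: real
  assumes "0 \<le> a" "a \<le> b"
  shows "b ^ n - a ^ n \<le> real n * (b - a) * b ^ (n - 1)"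
proof (induction n)
  case (Suc n)
  have "b ^ Suc n - a ^ Suc n = b * (b ^ n - a ^ n) + (b - a) * a ^ n"
    by (simp add: algebra_simps)
  also have "\<dots> \<le> b * (real n * (b - a) * b ^ (n - 1)) + (b - a) * b ^ n"
    using assms Suc by (intro add_mono mult_left_mono power_mono) auto
  also have "b * (real n * (b - a) * b ^ (n - 1)) = real n * (b - a) * b ^ n"
    by (cases n) auto
  finally show ?case by (simp add: algebra_simps)
qed simp

text \<open>The shell between the two comparison balls has volume of order r^(d-1). Against the
  increments of r^-d this boundary error is summable, which later determines the logarithmic sum up
  to a bounded term.\<close>

lemma card_lattice_ball_asymp:
  obtains A where "A > 0"
    "\<And>r. r \<ge> 1 \<Longrightarrow> \<bar>real (card (lattice_ball r :: (real ^ 'd) set))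
        - unit_ball_vol (real CARD('d)) * r ^ CARD('d)\<bar> \<le> A * r ^ (CARD('d) - 1)"
proof
  define d where "d = CARD('d)"
  define s where "s = real d"
  define V where "V = unit_ball_vol (real d)"
  have d: "d \<ge> 1" by (simp add: d_def Suc_leI)
  have V: "V > 0" by (simp add: V_def)
  \<comment> \<open>The factor \<open>(1 + s) ^ (d - 1)\<close> absorbs
    \<open>r + s \<le> (1 + s) * r\<close>, valid for \<open>r \<ge> 1\<close>.\<close>
  define A where "A = V * s * s * (1 + s) ^ (d - 1)"
  have s1: "s \<ge> 1" using d by (simp add: s_def)
  show "A > 0" using V s1 by (simp add: A_def)
  fix r :: real assume r: "r \<ge> 1"
  have *: "V * s * s * r ^ (d - 1) \<le> A * r ^ (d - 1)"
    unfolding A_def using V s1 r by (intro mult_right_mono) auto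
  have "real (card (lattice_ball r :: (real ^ 'd) set)) - V * r ^ d \<le> V * ((r + s) ^ d - r ^ d)"
    using card_lattice_ball_upper[where 'd='d, of r] r
    by (simp add: V_def s_def d_def algebra_simps)
  also have "\<dots> \<le> V * (s * s * (r + s) ^ (d - 1))"
    using V power_diff_le_real[of r "r + s" d] r s1
    by (intro mult_left_mono) (auto simp: s_def)
  also have "(r + s) ^ (d - 1) \<le> ((1 + s) * r) ^ (d - 1)"
    using r s1 by (intro power_mono) (auto simp: algebra_simps)
  finally have up: "real (card (lattice_ball r :: (real ^ 'd) set)) - V * r ^ d \<le> A * r ^ (d - 1)"
    using V s1 by (simp add: A_def power_mult_distrib mult_ac)
  have low: "V * r ^ d - real (card (lattice_ball r :: (real ^ 'd) set)) \<le> A * r ^ (d - 1)"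
  proof (cases "r \<ge> s")
    case True
    have "V * r ^ d - real (card (lattice_ball r :: (real ^ 'd) set)) \<le> V * (r ^ d - (r - s) ^ d)"
      using card_lattice_ball_lower[where 'd='d, of r] True
      by (simp add: V_def s_def d_def algebra_simps)
    also have "\<dots> \<le> V * (s * s * r ^ (d - 1))"
      using V power_diff_le_real[of "r - s" r d] True s1
      by (intro mult_left_mono) (auto simp: s_def)
    finally show ?thesis using * by (simp add: mult_ac)
  next
    case False
    \<comment> \<open>For \<open>r < s\<close> the inner comparison ball is empty, but then r^d is
      already at most s^2 r^(d-1).\<close>
    have "V * r ^ d - real (card (lattice_ball r :: (real ^ 'd) set)) \<le> V * r ^ d" by simp
    also have "\<dots> \<le> V * (s * s * r ^ (d - 1))"
    proof (rule mult_left_mono)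
      have "r ^ d = r * r ^ (d - 1)" using d by (cases d) auto
      also have "\<dots> \<le> (s * s) * r ^ (d - 1)"
        using False r s1 by (intro mult_right_mono) (auto intro: order_trans[of _ "s * 1"])
      finally show "r ^ d \<le> s * s * r ^ (d - 1)" .
    qed (use V in simp)
    finally show ?thesis using * by (simp add: mult_ac)
  qed
  show "\<bar>real (card (lattice_ball r :: (real ^ 'd) set))
        - unit_ball_vol (real CARD('d)) * r ^ CARD('d)\<bar> \<le> A * r ^ (CARD('d) - 1)"
    using up low by (simp add: V_def d_def abs_le_iff)
qed


section \<open>Power sums over lattice annuli\<close>

definition lattice_annulus :: "real \<Rightarrow> real \<Rightarrow> (real ^ 'd) set" where
  "lattice_annulus a b = {z \<in> int_lattice. a < norm z \<and> norm z \<le> b}"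

lemma finite_lattice_annulus [simp]: "finite (lattice_annulus a b :: (real ^ 'd) set)"
  by (rule finite_subset[OF _ finite_lattice_ball[of b]])
     (auto simp: lattice_annulus_def lattice_ball_def)

lemma card_lattice_annulus:
  assumes "a \<le> b"
  shows "real (card (lattice_annulus a b :: (real ^ 'd) set))
    = real (card (lattice_ball b :: (real ^ 'd) set)) - real (card (lattice_ball a :: (real ^ 'd) set))"
proof -
  have "(lattice_annulus a b :: (real ^ 'd) set) = lattice_ball b - lattice_ball a"
    by (auto simp: lattice_annulus_def lattice_ball_def)
  moreover have "(lattice_ball a :: (real ^ 'd) set) \<subseteq> lattice_ball b"
    using assms by (auto simp: lattice_ball_def)
  ultimately show ?thesis
    by (simp add: card_Diff_subset card_mono of_nat_diff)
qed

text \<open>The leading terms at the two radii cancel up to \<open>power_diff_le_real\<close>. The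
  case \<open>n = 0\<close> stands apart because the asymptotic count starts at radius one.\<close>

lemma card_lattice_shell:
  obtains A where "A > 0"
    "\<And>n::nat. real (card (lattice_annulus (real n) (real (Suc n)) :: (real ^ 'd) set))
        \<le> A * real (Suc n) ^ (CARD('d) - 1)"
proof -
  define d where "d = CARD('d)"
  define V where "V = unit_ball_vol (real d)"
  have V: "V > 0" by (simp add: V_def)
  obtain A where A: "A > 0"
    "\<And>r. r \<ge> 1 \<Longrightarrow> \<bar>real (card (lattice_ball r :: (real ^ 'd) set)) - V * r ^ d\<bar> \<le> A * r ^ (d - 1)"
    using card_lattice_ball_asymp[where 'd='d] unfolding V_def d_def by metis
  define B where "B = V * (real d + 1) + 2 * A"
  show ?thesis
  proof (rule that[of B])
    show "B > 0" using A(1) V by (simp add: B_def add_pos_pos mult_pos_pos)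
    fix n :: nat
    let ?N = "\<lambda>r. real (card (lattice_ball r :: (real ^ 'd) set))"
    have "?N (real (Suc n)) - ?N (real n) \<le> B * real (Suc n) ^ (d - 1)"
    proof (cases "n = 0")
      case True
      have "?N 1 \<le> V + A" using A(2)[of 1] by (simp add: abs_le_iff)
      also have "\<dots> \<le> B" using V A(1) by (simp add: B_def algebra_simps)
      finally show ?thesis using True by simp
    next
      case False
      have "?N (real (Suc n)) \<le> V * real (Suc n) ^ d + A * real (Suc n) ^ (d - 1)"
        using A(2)[of "real (Suc n)"] by (simp add: abs_le_iff)
      moreover have "?N (real n) \<ge> V * real n ^ d - A * real n ^ (d - 1)"
        using A(2)[of "real n"] False by (simp add: abs_le_iff)
      moreover have "A * real n ^ (d - 1) \<le> A * real (Suc n) ^ (d - 1)"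
        using A(1) by (intro mult_left_mono power_mono) auto
      moreover have "V * (real (Suc n) ^ d - real n ^ d) \<le> V * (real d * real (Suc n) ^ (d - 1))"
        using V power_diff_le_real[of "real n" "real (Suc n)" d] by (intro mult_left_mono) auto
      moreover have "0 \<le> V * real (Suc n) ^ (d - 1)" using V by simp
      ultimately show ?thesis by (simp add: B_def algebra_simps)
    qed
    then show "real (card (lattice_annulus (real n) (real (Suc n)) :: (real ^ 'd) set))
        \<le> B * real (Suc n) ^ (CARD('d) - 1)"
      by (simp add: card_lattice_annulus d_def del: of_nat_Suc)
  qed
qed

lemma sum_lattice_annulus_shells:
  fixes g :: "real ^ 'd \<Rightarrow> real"
  assumes "m \<le> K"
  shows "sum g (lattice_annulus (real m) (real K))
    = (\<Sum>n\<in>{m..<K}. sum g (lattice_annulus (real n) (real (Suc n))))"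
  using assms
proof (induction K rule: dec_induct)
  case base
  have "(lattice_annulus (real m) (real m) :: (real ^ 'd) set) = {}" by (auto simp: lattice_annulus_def)
  then show ?case by simp
next
  case (step K)
  have "(lattice_annulus (real m) (real (Suc K)) :: (real ^ 'd) set)
      = lattice_annulus (real m) (real K) \<union> lattice_annulus (real K) (real (Suc K))"
    using step.hyps by (auto simp: lattice_annulus_def)
  moreover have "lattice_annulus (real m) (real K) \<inter> lattice_annulus (real K) (real (Suc K)) = ({} :: (real ^ 'd) set)"
    by (auto simp: lattice_annulus_def)
  ultimately have "sum g (lattice_annulus (real m) (real (Suc K)))
      = sum g (lattice_annulus (real m) (real K)) + sum g (lattice_annulus (real K) (real (Suc K)))"
    by (simp add: sum.union_disjoint del: of_nat_Suc)
  then show ?case using step by (simp add: sum.atLeastLessThan_Suc del: of_nat_Suc)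
qed

text \<open>All points of a shell have norm comparable to its outer radius. In the innermost shell
  this rests on the absence of lattice points with norm strictly between 0 and 1.\<close>

lemma lattice_shell_norm_ge:
  assumes "z \<in> lattice_annulus (real n) (real (Suc n))"
  shows "norm z \<ge> real (Suc n) / 2"
proof (cases n)
  case 0
  then have "norm z \<ge> 1" using assms by (auto simp: lattice_annulus_def intro: int_lattice_norm_ge_1)
  then show ?thesis using 0 by simp
next
  case (Suc m)
  then show ?thesis using assms by (simp add: lattice_annulus_def)
qed

text \<open>Discrete polar coordinates: power sums over the lattice become one-dimensional sums with
  weight n^(d-1). The five lattice estimates below are the cases s = d+1, d+2, d-1, d-2 and
  d.\<close>

lemma sum_lattice_annulus_powers:
  obtains A where "A > 0"
    "\<And>m K. m \<le> K \<Longrightarrow> (\<Sum>z\<in>(lattice_annulus (real m) (real K) :: (real ^ 'd) set). 1 / norm z ^ s)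
      \<le> A * (\<Sum>n\<in>{m..<K}. real (Suc n) ^ (CARD('d) - 1) / real (Suc n) ^ s)"
proof -
  obtain A where A: "A > 0"
    "\<And>n::nat. real (card (lattice_annulus (real n) (real (Suc n)) :: (real ^ 'd) set))
        \<le> A * real (Suc n) ^ (CARD('d) - 1)"
    using card_lattice_shell by blast
  show ?thesis
  proof (rule that[of "A * 2 ^ s"])
    show "A * 2 ^ s > 0" using A(1) by simp
    fix m K :: nat assume mK: "m \<le> K"
    have "(\<Sum>z\<in>(lattice_annulus (real m) (real K) :: (real ^ 'd) set). 1 / norm z ^ s)
      = (\<Sum>n\<in>{m..<K}. \<Sum>z\<in>(lattice_annulus (real n) (real (Suc n)) :: (real ^ 'd) set). 1 / norm z ^ s)"
      by (rule sum_lattice_annulus_shells[OF mK])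
    also have "\<dots> \<le> (\<Sum>n\<in>{m..<K}. A * 2 ^ s * (real (Suc n) ^ (CARD('d) - 1) / real (Suc n) ^ s))"
    proof (rule sum_mono)
      fix n
      have "(\<Sum>z\<in>(lattice_annulus (real n) (real (Suc n)) :: (real ^ 'd) set). 1 / norm z ^ s)
          \<le> (\<Sum>z\<in>(lattice_annulus (real n) (real (Suc n)) :: (real ^ 'd) set). 2 ^ s / real (Suc n) ^ s)"
      proof (rule sum_mono)
        fix z :: "real ^ 'd" assume z: "z \<in> lattice_annulus (real n) (real (Suc n))"
        then have "(real (Suc n) / 2) ^ s \<le> norm z ^ s"
          by (intro power_mono lattice_shell_norm_ge) auto
        moreover have "(real (Suc n) / 2) ^ s > 0" by (intro zero_less_power) simp
        ultimately have "1 / norm z ^ s \<le> 1 / (real (Suc n) / 2) ^ s"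
          by (intro divide_left_mono) (auto simp del: of_nat_Suc intro!: mult_pos_pos elim: less_le_trans[rotated])
        then show "1 / norm z ^ s \<le> 2 ^ s / real (Suc n) ^ s"
          by (simp add: power_divide)
      qed
      also have "\<dots> = real (card (lattice_annulus (real n) (real (Suc n)) :: (real ^ 'd) set)) * (2 ^ s / real (Suc n) ^ s)"
        by simp
      also have "\<dots> \<le> A * real (Suc n) ^ (CARD('d) - 1) * (2 ^ s / real (Suc n) ^ s)"
        by (intro mult_right_mono A(2)) auto
      finally show "(\<Sum>z\<in>(lattice_annulus (real n) (real (Suc n)) :: (real ^ 'd) set). 1 / norm z ^ s)
          \<le> A * 2 ^ s * (real (Suc n) ^ (CARD('d) - 1) / real (Suc n) ^ s)"
        by (simp add: mult_ac)
    qed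
    finally show "(\<Sum>z\<in>(lattice_annulus (real m) (real K) :: (real ^ 'd) set). 1 / norm z ^ s)
      \<le> A * 2 ^ s * (\<Sum>n\<in>{m..<K}. real (Suc n) ^ (CARD('d) - 1) / real (Suc n) ^ s)"
      by (simp add: sum_distrib_left)
  qed
qed

lemma sum_inverse_squares_le: "(\<Sum>n\<in>{0..<K}. 1 / real (Suc n) ^ 2) \<le> 2"
proof -
  have *: "(\<Sum>n\<in>{0..<Suc J}. 1 / real (Suc n) ^ 2) \<le> 2 - 1 / real (Suc J)" for J
  proof (induction J)
    case (Suc J)
    have "1 / real (Suc (Suc J)) ^ 2 \<le> 1 / (real (Suc J) * real (Suc (Suc J)))"
      unfolding power2_eq_square by (intro divide_left_mono mult_right_mono) auto
    also have "\<dots> = 1 / real (Suc J) - 1 / real (Suc (Suc J))"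
      by (simp add: field_simps)
    finally have "1 / real (Suc (Suc J)) ^ 2 \<le> 1 / real (Suc J) - 1 / real (Suc (Suc J))" .
    then show ?case using Suc by (simp add: sum.atLeastLessThan_Suc del: of_nat_Suc)
  qed simp
  show ?thesis
  proof (cases K)
    case (Suc J)
    have "2 - 1 / real (Suc J) \<le> 2" by simp
    then show ?thesis using *[of J] unfolding Suc by linarith
  qed simp
qed

lemma sum_inverse_cubes_le:
  assumes "1 \<le> m" "m \<le> K"
  shows "(\<Sum>n\<in>{m..<K}. 1 / real (Suc n) ^ 3) \<le> 1 / real m ^ 2"
proof -
  have "(\<Sum>n\<in>{m..<K}. 1 / real (Suc n) ^ 3) \<le> 1 / real m ^ 2 - 1 / real K ^ 2"
    using assms(2)
  proof (induction K rule: dec_induct)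
    case (step K)
    define k where "k = real K"
    have k: "k \<ge> 1" using step.hyps assms(1) by (simp add: k_def)
    have "1 / (k + 1) ^ 3 \<le> 1 / k ^ 2 - 1 / (k + 1) ^ 2"
    proof -
      have "k ^ 2 * 1 \<le> (k + 1) * (2 * k + 1)" using k by (simp add: power2_eq_square algebra_simps)
      then have "1 / (k + 1) ^ 3 \<le> (2 * k + 1) / (k ^ 2 * (k + 1) ^ 2)"
        using k by (simp add: divide_simps power2_eq_square power3_eq_cube mult.commute)
      also have "\<dots> = 1 / k ^ 2 - 1 / (k + 1) ^ 2"
        using k by (simp add: divide_simps) (simp add: power2_eq_square algebra_simps)
      finally show ?thesis .
    qed
    then have "1 / real (Suc K) ^ 3 \<le> 1 / real K ^ 2 - 1 / real (Suc K) ^ 2"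
      by (simp add: k_def add.commute)
    then show ?case using step by (simp add: sum.atLeastLessThan_Suc del: of_nat_Suc)
  qed simp
  also have "\<dots> \<le> 1 / real m ^ 2" by simp
  finally show ?thesis .
qed

lemma sum_inverses_le:
  assumes "K \<ge> 1"
  shows "(\<Sum>n\<in>{0..<K}. 1 / real (Suc n)) \<le> 1 + ln (real K)"
  using assms
proof (induction K rule: dec_induct)
  case (step K)
  have K: "real K > 0" using step.hyps by simp
  have "ln (real K / real (Suc K)) \<le> real K / real (Suc K) - 1"
    by (rule ln_le_minus_one) (use K in simp)
  also have "\<dots> = - (1 / real (Suc K))" by (simp add: field_simps)
  finally have "1 / real (Suc K) \<le> ln (real (Suc K)) - ln (real K)"
    using K by (simp add: ln_div del: of_nat_Suc)
  then show ?case using step by (simp add: sum.atLeastLessThan_Suc del: of_nat_Suc)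
qed simp

text \<open>One power beyond the critical exponent d leaves the series of 1/n^2. A bound uniform
  over finite sets gives both summability and a bound of the infinite sum.\<close>

lemma lattice_power_sum_bounded:
  obtains A where "A > 0"
    "\<And>F. finite F \<Longrightarrow> F \<subseteq> int_lattice - {0} \<Longrightarrow>
      (\<Sum>z\<in>(F :: (real ^ 'd) set). 1 / norm z ^ (CARD('d) + 1)) \<le> A"
proof -
  define d where "d = CARD('d)"
  have d: "d \<ge> 1" by (simp add: d_def Suc_leI)
  obtain A where A: "A > 0"
    "\<And>m K. m \<le> K \<Longrightarrow> (\<Sum>z\<in>(lattice_annulus (real m) (real K) :: (real ^ 'd) set). 1 / norm z ^ (d + 1))
      \<le> A * (\<Sum>n\<in>{m..<K}. real (Suc n) ^ (d - 1) / real (Suc n) ^ (d + 1))"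
    using sum_lattice_annulus_powers[where 'd='d and s="d + 1"] unfolding d_def by blast
  show ?thesis
  proof (rule that[of "A * 2"])
    show "A * 2 > 0" using A(1) by simp
    fix F :: "(real ^ 'd) set" assume F: "finite F" "F \<subseteq> int_lattice - {0}"
    obtain K :: nat where K: "\<And>z. z \<in> F \<Longrightarrow> norm z \<le> real K"
      using finite_imp_bounded[OF F(1)] unfolding bounded_iff
      by (meson order_trans real_arch_simple)
    have sub: "F \<subseteq> lattice_annulus (real 0) (real K)"
      using F(2) K by (auto simp: lattice_annulus_def)
    have "(\<Sum>z\<in>F. 1 / norm z ^ (d + 1)) \<le> (\<Sum>z\<in>(lattice_annulus (real 0) (real K) :: (real ^ 'd) set). 1 / norm z ^ (d + 1))"
      by (rule sum_mono2[OF finite_lattice_annulus sub]) simp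
    also have "\<dots> \<le> A * (\<Sum>n\<in>{0..<K}. real (Suc n) ^ (d - 1) / real (Suc n) ^ (d + 1))"
      by (rule A(2)) simp
    also have "(\<Sum>n\<in>{0..<K}. real (Suc n) ^ (d - 1) / real (Suc n) ^ (d + 1)) = (\<Sum>n\<in>{0..<K}. 1 / real (Suc n) ^ 2)"
    proof (rule sum.cong[OF refl])
      fix n
      have "real (Suc n) ^ (d + 1) = real (Suc n) ^ (d - 1) * real (Suc n) ^ 2"
        using d by (simp del: of_nat_Suc flip: power_add)
      then show "real (Suc n) ^ (d - 1) / real (Suc n) ^ (d + 1) = 1 / real (Suc n) ^ 2"
        by (simp del: of_nat_Suc)
    qed
    also have "A * \<dots> \<le> A * 2" using A(1) sum_inverse_squares_le by (intro mult_left_mono) auto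
    finally show "(\<Sum>z\<in>F. 1 / norm z ^ (CARD('d) + 1)) \<le> A * 2" by (simp add: d_def)
  qed
qed

text \<open>Controls the jumps longer than \<open>k\<close>: the factor 1/k^2 cancels the k^2 of the
  unscaled generator and leaves 1/ln k.\<close>

lemma lattice_power_sum_tail:
  obtains A where "A > 0"
    "\<And>F k. finite F \<Longrightarrow> k \<ge> 1 \<Longrightarrow> F \<subseteq> {z \<in> int_lattice. norm z > real k} \<Longrightarrow>
      (\<Sum>z\<in>(F :: (real ^ 'd) set). 1 / norm z ^ (CARD('d) + 2)) \<le> A / real k ^ 2"
proof -
  define d where "d = CARD('d)"
  have d: "d \<ge> 1" by (simp add: d_def Suc_leI)
  obtain A where A: "A > 0"
    "\<And>m K. m \<le> K \<Longrightarrow> (\<Sum>z\<in>(lattice_annulus (real m) (real K) :: (real ^ 'd) set). 1 / norm z ^ (d + 2))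
      \<le> A * (\<Sum>n\<in>{m..<K}. real (Suc n) ^ (d - 1) / real (Suc n) ^ (d + 2))"
    using sum_lattice_annulus_powers[where 'd='d and s="d + 2"] unfolding d_def by blast
  show ?thesis
  proof (rule that[of A])
    show "A > 0" using A(1) .
    fix F :: "(real ^ 'd) set" and k :: nat
    assume F: "finite F" "F \<subseteq> {z \<in> int_lattice. norm z > real k}" and k: "k \<ge> 1"
    obtain K0 :: nat where K0: "\<And>z. z \<in> F \<Longrightarrow> norm z \<le> real K0"
      using finite_imp_bounded[OF F(1)] unfolding bounded_iff
      by (meson order_trans real_arch_simple)
    define K where "K = max k K0"
    have K: "\<And>z. z \<in> F \<Longrightarrow> norm z \<le> real K" "k \<le> K" using K0 by (force simp: K_def)+
    have sub: "F \<subseteq> lattice_annulus (real k) (real K)"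
      using F(2) K by (auto simp: lattice_annulus_def)
    have "(\<Sum>z\<in>F. 1 / norm z ^ (d + 2)) \<le> (\<Sum>z\<in>(lattice_annulus (real k) (real K) :: (real ^ 'd) set). 1 / norm z ^ (d + 2))"
      by (rule sum_mono2[OF finite_lattice_annulus sub]) simp
    also have "\<dots> \<le> A * (\<Sum>n\<in>{k..<K}. real (Suc n) ^ (d - 1) / real (Suc n) ^ (d + 2))"
      by (rule A(2)) (rule K(2))
    also have "(\<Sum>n\<in>{k..<K}. real (Suc n) ^ (d - 1) / real (Suc n) ^ (d + 2)) = (\<Sum>n\<in>{k..<K}. 1 / real (Suc n) ^ 3)"
    proof (rule sum.cong[OF refl])
      fix n
      have "d + 2 = (d - 1) + 3" using d by simp
      then have "real (Suc n) ^ (d + 2) = real (Suc n) ^ (d - 1) * real (Suc n) ^ 3"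
        by (metis power_add)
      then show "real (Suc n) ^ (d - 1) / real (Suc n) ^ (d + 2) = 1 / real (Suc n) ^ 3"
        by (simp del: of_nat_Suc)
    qed
    also have "A * \<dots> \<le> A * (1 / real k ^ 2)"
      using A(1) sum_inverse_cubes_le[OF k K(2)] by (intro mult_left_mono) auto
    finally show "(\<Sum>z\<in>F. 1 / norm z ^ (CARD('d) + 2)) \<le> A / real k ^ 2" by (simp add: d_def)
  qed
qed

text \<open>The exponent is that of |z|^3 times the jump kernel, the size of the third-order Taylor
  remainder.\<close>

lemma lattice_power_sum_linear:
  obtains A where "A > 0"
    "\<And>k. (\<Sum>z\<in>(lattice_annulus 0 (real k) :: (real ^ 'd) set). 1 / norm z ^ (CARD('d) - 1)) \<le> A * real k"
proof -
  define d where "d = CARD('d)"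
  obtain A where A: "A > 0"
    "\<And>m K. m \<le> K \<Longrightarrow> (\<Sum>z\<in>(lattice_annulus (real m) (real K) :: (real ^ 'd) set). 1 / norm z ^ (d - 1))
      \<le> A * (\<Sum>n\<in>{m..<K}. real (Suc n) ^ (d - 1) / real (Suc n) ^ (d - 1))"
    using sum_lattice_annulus_powers[where 'd='d and s="d - 1"] unfolding d_def by blast
  show ?thesis
    by (rule that[of A]) (use A(1) A(2)[of 0] in \<open>auto simp: d_def\<close>)
qed

text \<open>The exponent is that of |z|^4 times the jump kernel, the squared Taylor remainder in the
  intermediate range.\<close>

lemma lattice_power_sum_quadratic:
  assumes "CARD('d) \<ge> 2"
  obtains A where "A > 0"
    "\<And>k. (\<Sum>z\<in>(lattice_annulus 0 (real k) :: (real ^ 'd) set). 1 / norm z ^ (CARD('d) - 2)) \<le> A * real k ^ 2"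
proof -
  define d where "d = CARD('d)"
  obtain A where A: "A > 0"
    "\<And>m K. m \<le> K \<Longrightarrow> (\<Sum>z\<in>(lattice_annulus (real m) (real K) :: (real ^ 'd) set). 1 / norm z ^ (d - 2))
      \<le> A * (\<Sum>n\<in>{m..<K}. real (Suc n) ^ (d - 1) / real (Suc n) ^ (d - 2))"
    using sum_lattice_annulus_powers[where 'd='d and s="d - 2"] unfolding d_def by blast
  show ?thesis
  proof (rule that[of A])
    show "A > 0" using A(1) .
    fix k :: nat
    have "(\<Sum>z\<in>(lattice_annulus 0 (real k) :: (real ^ 'd) set). 1 / norm z ^ (d - 2))
        \<le> A * (\<Sum>n\<in>{0..<k}. real (Suc n) ^ (d - 1) / real (Suc n) ^ (d - 2))"
      using A(2)[of 0 k] by simp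
    also have "\<dots> \<le> A * (\<Sum>n\<in>{0..<k}. real k)"
    proof (intro mult_left_mono sum_mono)
      fix n assume n: "n \<in> {0..<k}"
      have "d - 1 = Suc (d - 2)" using assms by (simp add: d_def)
      then have "real (Suc n) ^ (d - 1) / real (Suc n) ^ (d - 2) = real (Suc n)"
        by (simp del: of_nat_Suc)
      also have "\<dots> \<le> real k" using n by (simp del: of_nat_Suc)
      finally show "real (Suc n) ^ (d - 1) / real (Suc n) ^ (d - 2) \<le> real k" .
    qed (use A(1) in simp)
    finally show "(\<Sum>z\<in>(lattice_annulus 0 (real k) :: (real ^ 'd) set). 1 / norm z ^ (CARD('d) - 2)) \<le> A * real k ^ 2"
      by (simp add: d_def power2_eq_square)
  qed
qed

text \<open>The exponent is that of |z|^2 times the jump kernel, the borderline case. Applied with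
  \<open>r = R\<close> it is the only source of \<open>ln R\<close> in the final bound.\<close>

lemma lattice_power_sum_log:
  obtains A where "A > 0"
    "\<And>r. r \<ge> 1 \<Longrightarrow> (\<Sum>z\<in>(lattice_annulus 0 r :: (real ^ 'd) set). 1 / norm z ^ CARD('d)) \<le> A * (1 + ln r)"
proof -
  define d where "d = CARD('d)"
  have d: "d \<ge> 1" by (simp add: d_def Suc_leI)
  obtain A where A: "A > 0"
    "\<And>m K. m \<le> K \<Longrightarrow> (\<Sum>z\<in>(lattice_annulus (real m) (real K) :: (real ^ 'd) set). 1 / norm z ^ d)
      \<le> A * (\<Sum>n\<in>{m..<K}. real (Suc n) ^ (d - 1) / real (Suc n) ^ d)"
    using sum_lattice_annulus_powers[where 'd='d and s="d"] unfolding d_def by blast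
  show ?thesis
  proof (rule that[of "A * 2"])
    show "A * 2 > 0" using A(1) by simp
    fix r :: real assume r: "r \<ge> 1"
    define K where "K = nat \<lceil>r\<rceil>"
    have K: "r \<le> real K" "real K \<le> 2 * r" "K \<ge> 1"
      using r by (auto simp: K_def) linarith+
    have "(\<Sum>z\<in>(lattice_annulus 0 r :: (real ^ 'd) set). 1 / norm z ^ d)
        \<le> (\<Sum>z\<in>(lattice_annulus (real 0) (real K) :: (real ^ 'd) set). 1 / norm z ^ d)"
      using K(1) by (intro sum_mono2 finite_lattice_annulus) (auto simp: lattice_annulus_def)
    also have "\<dots> \<le> A * (\<Sum>n\<in>{0..<K}. real (Suc n) ^ (d - 1) / real (Suc n) ^ d)"
      by (rule A(2)) simp
    also have "(\<Sum>n\<in>{0..<K}. real (Suc n) ^ (d - 1) / real (Suc n) ^ d) = (\<Sum>n\<in>{0..<K}. 1 / real (Suc n))"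
    proof (rule sum.cong[OF refl])
      fix n
      have "real (Suc n) ^ d = real (Suc n) ^ (d - 1) * real (Suc n)"
        using d by (metis Suc_diff_le diff_Suc_1 power_Suc2)
      then show "real (Suc n) ^ (d - 1) / real (Suc n) ^ d = 1 / real (Suc n)"
        by (simp del: of_nat_Suc)
    qed
    also have "A * \<dots> \<le> A * (2 * (1 + ln r))"
    proof (rule mult_left_mono)
      have "ln (real K) \<le> ln (2 * r)" using K r by simp
      also have "\<dots> \<le> 1 + ln r" using r ln_le_minus_one[of 2] by (simp add: ln_mult)
      finally have "1 + ln (real K) \<le> 2 * (1 + ln r)" using ln_ge_zero[OF r] by argo
      then show "(\<Sum>n\<in>{0..<K}. 1 / real (Suc n)) \<le> 2 * (1 + ln r)"
        using sum_inverses_le[OF K(3)] by linarith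
    qed (use A(1) in simp)
    finally show "(\<Sum>z\<in>(lattice_annulus 0 r :: (real ^ 'd) set). 1 / norm z ^ CARD('d)) \<le> A * 2 * (1 + ln r)"
      by (simp add: d_def mult.assoc)
  qed
qed

section \<open>Exact logarithmic growth and the constant \<open>a0\<close>\<close>

lemma one_minus_power_ln_bound:
  fixes t :: real
  assumes "1 / 2 \<le> t" "t \<le> 1"
  shows "\<bar>(1 - t ^ d) + real d * ln t\<bar> \<le> real d ^ 2 * 2 ^ d * (1 - t) ^ 2"
proof -
  define s where "s = t ^ d"
  have s0: "s > 0" and s1: "s \<le> 1" using assms by (auto simp: s_def power_le_one)
  have "ln s = real d * ln t" using assms by (simp add: s_def ln_realpow)
  \<comment> \<open>The inequality ln x <= x - 1, used at \<open>s\<close> and at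
    \<open>1 / s\<close>, traps \<open>- ln s\<close> between \<open>1 - s\<close> and
    \<open>1 / s - 1\<close>. These two differ by (1 - s)^2 / s, which makes the error
    quadratic.\<close>
  moreover have "ln s \<le> s - 1" by (rule ln_le_minus_one[OF s0])
  moreover have "- ln s \<le> 1 / s - 1" using ln_le_minus_one[of "1 / s"] s0 by (simp add: ln_div)
  ultimately have "\<bar>(1 - s) + real d * ln t\<bar> \<le> 1 / s - 1 - (1 - s)"
    by (auto simp: abs_le_iff)
  also have "\<dots> = (1 - s) ^ 2 * (1 / s)" using s0 by (simp add: field_simps power2_eq_square)
  also have "\<dots> \<le> (real d * (1 - t)) ^ 2 * 2 ^ d"
  proof (intro mult_mono power_mono)
    show "1 - s \<le> real d * (1 - t)" using power_diff_le_real[of t 1 d] assms by (simp add: s_def)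
    have "(1 / 2) ^ d \<le> s" unfolding s_def using assms by (intro power_mono) auto
    then have "1 / s \<le> 1 / (1 / 2) ^ d" using s0 by (intro divide_left_mono) auto
    then show "1 / s \<le> 2 ^ d" by (simp add: power_divide)
  qed (use s0 s1 in auto)
  finally show ?thesis by (simp add: s_def power_mult_distrib mult_ac)
qed

text \<open>Summation by parts: once the boundary term \<open>E k / real k ^ d\<close> is removed,
  the defect \<open>P\<close> has increments of order 1/k^2 and therefore stays bounded. The leading
  coefficient \<open>V * real d\<close> is the surface measure of the unit sphere.\<close>

lemma lattice_log_sum_asymp:
  obtains c C where "c > 0" "C > 0"
    "\<And>k. k \<ge> 1 \<Longrightarrow> \<bar>(\<Sum>z\<in>(lattice_annulus 0 (real k) :: (real ^ 'd) set). 1 / norm z ^ CARD('d))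
        - c * ln (real k)\<bar> \<le> C"
proof -
  define d where "d = CARD('d)"
  define V where "V = unit_ball_vol (real d)"
  have d: "d \<ge> 1" by (simp add: d_def Suc_leI)
  have V: "V > 0" by (simp add: V_def)
  obtain A where A: "A > 0"
    "\<And>r. r \<ge> 1 \<Longrightarrow> \<bar>real (card (lattice_ball r :: (real ^ 'd) set)) - V * r ^ d\<bar> \<le> A * r ^ (d - 1)"
    using card_lattice_ball_asymp[where 'd='d] unfolding V_def d_def by metis
  obtain B where B: "B > 0"
    "\<And>n::nat. real (card (lattice_annulus (real n) (real (Suc n)) :: (real ^ 'd) set))
        \<le> B * real (Suc n) ^ (d - 1)"
    using card_lattice_shell unfolding d_def by blast
  define S where "S k = (\<Sum>z\<in>(lattice_annulus 0 (real k) :: (real ^ 'd) set). 1 / norm z ^ d)" for k :: nat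
  define N where "N k = real (card (lattice_ball (real k) :: (real ^ 'd) set))" for k :: nat
  define E where "E k = N k - V * real k ^ d" for k
  define P where "P k = S k - V * real d * ln (real k) - E k / real k ^ d" for k
  have E: "\<bar>E k\<bar> \<le> A * real k ^ (d - 1)" if "k \<ge> 1" for k
    using A(2)[of "real k"] that by (simp add: E_def N_def)
  have kd: "real k ^ d = real k ^ (d - 1) * real k" for k :: nat
    using d by (metis Suc_diff_le diff_Suc_1 power_Suc2)
  have E': "\<bar>E k / real k ^ d\<bar> \<le> A" if "k \<ge> 1" for k
  proof -
    have "\<bar>E k / real k ^ d\<bar> \<le> A * real k ^ (d - 1) / real k ^ d"
      using E[OF that] by (simp add: divide_right_mono)
    also have "\<dots> = A / real k" using that by (simp add: kd)
    also have "\<dots> \<le> A" using that A(1) by (simp add: field_simps)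
    finally show ?thesis .
  qed
  define C1 where "C1 = B * 2 ^ (d - 1) * real d + V * (real d ^ 2 * 2 ^ d) + A * real d"
  have C1: "C1 \<ge> 0" using A(1) B(1) V by (simp add: C1_def)
  have step: "\<bar>P (Suc k) - P k\<bar> \<le> 2 ^ 2 * C1 * (1 / real (Suc k) ^ 2)" if k: "k \<ge> 1" for k
  proof -
    define D where "D = 1 / real k ^ d - 1 / real (Suc k) ^ d"
    have D0: "D \<ge> 0" unfolding D_def using k
      by (simp add: divide_left_mono power_mono zero_less_power del: of_nat_Suc)
    have D1: "D \<le> real d / (real k ^ d * real k)"
    proof -
      have "D = (real (Suc k) ^ d - real k ^ d) / (real k ^ d * real (Suc k) ^ d)"
        using k by (simp add: D_def field_simps)
      also have "\<dots> \<le> (real d * 1 * real (Suc k) ^ (d - 1)) / (real k ^ d * real (Suc k) ^ d)"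
        using power_diff_le_real[of "real k" "real (Suc k)" d] k
        by (intro divide_right_mono) auto
      also have "\<dots> = real d / (real k ^ d * real (Suc k))"
        using kd[of "Suc k"] by (simp del: of_nat_Suc)
      also have "\<dots> \<le> real d / (real k ^ d * real k)"
        using k by (intro divide_left_mono mult_left_mono) auto
      finally show ?thesis .
    qed
    have Sdiff: "S (Suc k) - S k = (\<Sum>z\<in>(lattice_annulus (real k) (real (Suc k)) :: (real ^ 'd) set). 1 / norm z ^ d)"
      using sum_lattice_annulus_shells[of 0 "Suc k" "\<lambda>z :: real ^ 'd. 1 / norm z ^ d"]
        sum_lattice_annulus_shells[of 0 "k" "\<lambda>z :: real ^ 'd. 1 / norm z ^ d"]
      by (simp add: S_def sum.atLeastLessThan_Suc del: of_nat_Suc)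
    have cardN: "real (card (lattice_annulus (real k) (real (Suc k)) :: (real ^ 'd) set)) = N (Suc k) - N k"
      by (simp add: N_def card_lattice_annulus del: of_nat_Suc)
    \<comment> \<open>\<open>X1\<close> is the price of replacing |z| by the outer radius for every
      point of the shell.\<close>
    define X1 where "X1 = S (Suc k) - S k - (N (Suc k) - N k) / real (Suc k) ^ d"
    have "X1 = (\<Sum>z\<in>(lattice_annulus (real k) (real (Suc k)) :: (real ^ 'd) set). 1 / norm z ^ d - 1 / real (Suc k) ^ d)"
      by (simp add: X1_def Sdiff sum_subtractf cardN[symmetric] del: of_nat_Suc)
    then have "\<bar>X1\<bar> \<le> (\<Sum>z\<in>(lattice_annulus (real k) (real (Suc k)) :: (real ^ 'd) set). \<bar>1 / norm z ^ d - 1 / real (Suc k) ^ d\<bar>)"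
      by (simp del: of_nat_Suc)
    also have "\<dots> \<le> (\<Sum>z\<in>(lattice_annulus (real k) (real (Suc k)) :: (real ^ 'd) set). D)"
    proof (rule sum_mono)
      fix z :: "real ^ 'd" assume z: "z \<in> lattice_annulus (real k) (real (Suc k))"
      have zk: "real k < norm z" "norm z \<le> real (Suc k)" using z by (auto simp: lattice_annulus_def)
      have "1 / norm z ^ d \<le> 1 / real k ^ d" using zk k
        by (intro divide_left_mono power_mono mult_pos_pos zero_less_power) auto
      moreover have "1 / real (Suc k) ^ d \<le> 1 / norm z ^ d" using zk k
        by (intro divide_left_mono power_mono mult_pos_pos zero_less_power) auto
      ultimately show "\<bar>1 / norm z ^ d - 1 / real (Suc k) ^ d\<bar> \<le> D" by (simp add: D_def)
    qed
    also have "\<dots> = real (card (lattice_annulus (real k) (real (Suc k)) :: (real ^ 'd) set)) * D" by simp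
    also have "\<dots> \<le> B * real (Suc k) ^ (d - 1) * (real d / (real k ^ d * real k))"
      using B D0 D1 by (intro mult_mono) auto
    also have "\<dots> \<le> B * (2 * real k) ^ (d - 1) * (real d / (real k ^ d * real k))"
      using B(1) k by (intro mult_right_mono mult_left_mono power_mono) auto
    also have "\<dots> = B * 2 ^ (d - 1) * real d * (1 / real k ^ 2)"
      using k by (simp add: kd power_mult_distrib power2_eq_square)
    finally have X1: "\<bar>X1\<bar> \<le> B * 2 ^ (d - 1) * real d * (1 / real k ^ 2)" .
    define t where "t = real k / real (Suc k)"
    have t: "1 / 2 \<le> t" "t \<le> 1" "1 - t = 1 / real (Suc k)"
      using k by (auto simp: t_def field_simps)
    \<comment> \<open>\<open>X2\<close> compares the volume part of the count with the increment of
      the logarithm; it is of second order by \<open>one_minus_power_ln_bound\<close>.\<close>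
    define X2 where "X2 = V * ((1 - t ^ d) + real d * ln t)"
    have "\<bar>X2\<bar> \<le> V * (real d ^ 2 * 2 ^ d * (1 - t) ^ 2)"
      unfolding X2_def abs_mult using V one_minus_power_ln_bound[OF t(1,2), of d]
      by (simp add: mult_left_mono)
    also have "\<dots> \<le> V * (real d ^ 2 * 2 ^ d) * (1 / real k ^ 2)"
    proof -
      have "(1 - t) ^ 2 \<le> (1 / real k) ^ 2"
        unfolding t(3) using k by (intro power_mono divide_left_mono) auto
      then have "V * (real d ^ 2 * 2 ^ d) * (1 - t) ^ 2 \<le> V * (real d ^ 2 * 2 ^ d) * (1 / real k) ^ 2"
        using V by (intro mult_left_mono) auto
      then show ?thesis by (simp add: power_divide mult.assoc)
    qed
    finally have X2: "\<bar>X2\<bar> \<le> V * (real d ^ 2 * 2 ^ d) * (1 / real k ^ 2)" .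
    \<comment> \<open>\<open>X3\<close> is the counting error \<open>E k\<close> times the increment
      of r^-d. It takes this harmless form because \<open>P\<close> subtracts the boundary
      term.\<close>
    define X3 where "X3 = E k * D"
    have "\<bar>X3\<bar> \<le> (A * real k ^ (d - 1)) * (real d / (real k ^ d * real k))"
      unfolding X3_def abs_mult using E[OF k] D0 D1 A(1) by (intro mult_mono) auto
    also have "\<dots> = A * real d * (1 / real k ^ 2)"
      using k by (simp add: kd power2_eq_square)
    finally have X3: "\<bar>X3\<bar> \<le> A * real d * (1 / real k ^ 2)" .
    have lnt: "ln t = ln (real k) - ln (real (Suc k))" using k by (simp add: t_def ln_div)
    have td: "t ^ d = real k ^ d / real (Suc k) ^ d" by (simp add: t_def power_divide)
    have "N (Suc k) / real (Suc k) ^ d = V + E (Suc k) / real (Suc k) ^ d"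
      by (simp add: E_def diff_divide_distrib del: of_nat_Suc)
    moreover have "N k / real (Suc k) ^ d = V * t ^ d + E k / real (Suc k) ^ d"
      by (simp add: E_def td diff_divide_distrib del: of_nat_Suc)
    moreover have "E k * D = E k / real k ^ d - E k / real (Suc k) ^ d"
      by (simp add: D_def right_diff_distrib del: of_nat_Suc)
    ultimately have "P (Suc k) - P k = X1 + X2 + X3"
      unfolding P_def X1_def X2_def X3_def lnt by (simp add: algebra_simps diff_divide_distrib del: of_nat_Suc)
    then have "\<bar>P (Suc k) - P k\<bar> \<le> \<bar>X1\<bar> + \<bar>X2\<bar> + \<bar>X3\<bar>" by linarith
    also have "\<dots> \<le> C1 * (1 / real k ^ 2)" using X1 X2 X3 by (simp only: C1_def distrib_right)
    \<comment> \<open>The series in \<open>sum_inverse_squares_le\<close> runs over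
      \<open>Suc n\<close>; since k + 1 <= 2 k, shifting the index costs a factor 4.\<close>
    also have "\<dots> \<le> C1 * (2 ^ 2 * (1 / real (Suc k) ^ 2))"
    proof (rule mult_left_mono)
      have "(1 / real k) ^ 2 \<le> (2 / real (Suc k)) ^ 2"
        using k by (intro power_mono) (auto simp: field_simps)
      then show "1 / real k ^ 2 \<le> 2 ^ 2 * (1 / real (Suc k) ^ 2)" by (simp add: power_divide)
    qed (rule C1)
    finally show ?thesis by (simp add: mult_ac)
  qed
  have P: "\<bar>P k\<bar> \<le> \<bar>P 1\<bar> + 2 ^ 2 * C1 * 2" if "k \<ge> 1" for k
  proof -
    have "\<bar>P k - P 1\<bar> \<le> 2 ^ 2 * C1 * (\<Sum>n\<in>{0..<k}. 1 / real (Suc n) ^ 2)"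
      using that
    proof (induction k rule: dec_induct)
      case base
      show ?case using C1 by (simp add: sum_nonneg)
    next
      case (step k)
      then show ?case using \<open>k \<ge> 1 \<Longrightarrow> \<bar>P (Suc k) - P k\<bar> \<le> 2 ^ 2 * C1 * (1 / real (Suc k) ^ 2)\<close>
        by (simp add: sum.atLeastLessThan_Suc distrib_left del: of_nat_Suc)
    qed
    also have "\<dots> \<le> 2 ^ 2 * C1 * 2" using C1 sum_inverse_squares_le[of k] by (intro mult_left_mono) auto
    finally show ?thesis by linarith
  qed
  show ?thesis
  proof (rule that[of "V * real d" "\<bar>P 1\<bar> + 2 ^ 2 * C1 * 2 + A"])
    show "0 < V * real d" using V d by simp
    show "0 < \<bar>P 1\<bar> + 2 ^ 2 * C1 * 2 + A" using C1 A(1) by (simp add: add_nonneg_pos)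
    fix k :: nat assume k: "k \<ge> 1"
    have "S k - V * real d * ln (real k) = P k + E k / real k ^ d" by (simp add: P_def)
    then have "\<bar>S k - V * real d * ln (real k)\<bar> \<le> \<bar>P k\<bar> + \<bar>E k / real k ^ d\<bar>" by linarith
    also have "\<dots> \<le> \<bar>P 1\<bar> + 2 ^ 2 * C1 * 2 + A" using P[OF k] E'[OF k] by linarith
    finally show "\<bar>(\<Sum>z\<in>(lattice_annulus 0 (real k) :: (real ^ 'd) set). 1 / norm z ^ CARD('d))
        - V * real d * ln (real k)\<bar> \<le> \<bar>P 1\<bar> + 2 ^ 2 * C1 * 2 + A"
      by (simp add: S_def d_def)
  qed
qed

text \<open>\<open>a0\<close> is a \<open>lim\<close>, which says nothing until convergence is
  proved. The bounded remainder of the logarithmic sum gives convergence together with the rate. The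
  sign is recorded because dissipativity of the limit operator rests on it.\<close>

lemma a0_asymp:
  obtains C where "C > 0" "a0 TYPE('d) \<ge> 0"
    "\<And>k. k \<ge> 2 \<Longrightarrow> \<bar>(\<Sum>z\<in>(lattice_annulus 0 (real k) :: (real ^ 'd::finite) set). 1 / norm z ^ CARD('d))
          / (2 * real CARD('d) * ln (real k)) - a0 TYPE('d)\<bar> \<le> C / ln (real k)"
proof -
  define d where "d = real CARD('d)"
  have d: "d \<ge> 1" by (simp add: d_def Suc_leI)
  define S where "S k = (\<Sum>z\<in>(lattice_annulus 0 (real k) :: (real ^ 'd) set). 1 / norm z ^ CARD('d))" for k :: nat
  obtain c C where c: "c > 0" "C > 0" "\<And>k. k \<ge> 1 \<Longrightarrow> \<bar>S k - c * ln (real k)\<bar> \<le> C"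
    unfolding S_def using lattice_log_sum_asymp by metis
  have bound: "\<bar>S k / (2 * d * ln (real k)) - c / (2 * d)\<bar> \<le> C / ln (real k)" if "k \<ge> 2" for k
  proof -
    have l: "ln (real k) > 0" using that by simp
    have "S k / (2 * d * ln (real k)) - c / (2 * d) = (S k - c * ln (real k)) / (2 * d * ln (real k))"
      using d l by (simp add: field_simps)
    also have "\<bar>\<dots>\<bar> \<le> C / (2 * d * ln (real k))"
      using c(3)[of k] that d l by (simp add: abs_mult divide_right_mono)
    also have "\<dots> \<le> C / (1 * ln (real k))"
      using d l c(2) by (intro divide_left_mono mult_right_mono) auto
    finally show ?thesis by simp
  qed
  have set_eq: "{z :: real ^ 'd. z \<in> int_lattice \<and> 0 < norm z \<and> norm z \<le> real k} = lattice_annulus 0 (real k)" for k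
    by (auto simp: lattice_annulus_def)
  have "(\<lambda>k. C / ln (real k)) \<longlonglongrightarrow> 0"
    by (intro tendsto_divide_0[OF tendsto_const] filterlim_at_top_imp_at_infinity
        filterlim_compose[OF ln_at_top filterlim_real_sequentially])
  then have "(\<lambda>k. S k / (2 * d * ln (real k)) - c / (2 * d)) \<longlonglongrightarrow> 0"
    by (rule Lim_null_comparison[rotated])
       (use bound in \<open>auto intro: eventually_sequentiallyI[of 2]\<close>)
  then have "(\<lambda>k. S k / (2 * d * ln (real k))) \<longlonglongrightarrow> c / (2 * d)" by (rule LIM_zero_cancel)
  then have "a0 TYPE('d) = c / (2 * d)"
    unfolding a0_def set_eq S_def[symmetric] d_def[symmetric]
    by (intro limI) simp
  then show ?thesis
    using that[of C] c bound d by (simp add: S_def d_def)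
qed

section \<open>The discrete resolvent equation\<close>

text \<open>Division by zero gives the value 0 at the origin, so sums over
  \<open>y \<noteq> x\<close> may run over the whole lattice. The energy method is carried out on
  the unscaled lattice with this kernel.\<close>

definition jump_kernel :: "real ^ 'd \<Rightarrow> real" where
  "jump_kernel z = 1 / norm z ^ (CARD('d) + 2)"

lemma jump_kernel_0 [simp]: "jump_kernel 0 = 0"
  by (simp add: jump_kernel_def)

lemma jump_kernel_nonneg [simp]: "jump_kernel z \<ge> 0"
  by (simp add: jump_kernel_def)

lemma jump_kernel_minus [simp]: "jump_kernel (- z) = jump_kernel z"
  by (simp add: jump_kernel_def)

lemma jump_kernel_commute: "jump_kernel (x - y) = jump_kernel (y - x)"
  by (simp add: jump_kernel_def norm_minus_commute)

lemma jump_kernel_le_1: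
  assumes "z \<in> int_lattice" shows "jump_kernel z \<le> 1"
  using int_lattice_norm_ge_1[OF assms] one_le_power[of "norm z" "CARD('a) + 2"]
  by (cases "z = 0") (auto simp: jump_kernel_def simp del: one_le_power)

lemma jump_kernel_summable: "(jump_kernel :: real ^ 'd \<Rightarrow> real) summable_on int_lattice"
proof -
  obtain A where A: "\<And>F. finite F \<Longrightarrow> F \<subseteq> int_lattice - {0} \<Longrightarrow>
      (\<Sum>z\<in>(F :: (real ^ 'd) set). 1 / norm z ^ (CARD('d) + 1)) \<le> A"
    using lattice_power_sum_bounded by blast
  have "sum jump_kernel F \<le> A" if F: "finite F" "F \<subseteq> int_lattice" for F :: "(real ^ 'd) set"
  proof -
    have "sum jump_kernel F = sum jump_kernel (F - {0})"
      using F(1) by (intro sum.mono_neutral_right) auto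
    also have "\<dots> \<le> (\<Sum>z\<in>F - {0}. 1 / norm z ^ (CARD('d) + 1))"
    proof (rule sum_mono)
      fix z assume "z \<in> F - {0}"
      then have "norm z \<ge> 1" using F(2) by (intro int_lattice_norm_ge_1) auto
      then have "norm z ^ (CARD('d) + 1) \<le> norm z ^ (CARD('d) + 2)" by (intro power_increasing) auto
      then show "jump_kernel z \<le> 1 / norm z ^ (CARD('d) + 1)"
        unfolding jump_kernel_def using \<open>norm z \<ge> 1\<close>
        by (intro divide_left_mono mult_pos_pos zero_less_power) linarith+
    qed
    also have "\<dots> \<le> A" using F by (intro A) auto
    finally show ?thesis .
  qed
  then show ?thesis
    by (intro nonneg_bdd_above_summable_on) (auto simp: bdd_above_def)
qed

lemma int_lattice_translate_bij:
  assumes "x \<in> int_lattice"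
  shows "bij_betw (\<lambda>y. x - y) int_lattice int_lattice"
  by (rule bij_betw_byWitness[of _ "\<lambda>y. x - y"]) (auto simp: assms int_lattice_diff)

lemma jump_kernel_row:
  fixes x :: "real ^ 'd"
  assumes "x \<in> int_lattice"
  shows "(\<lambda>y. jump_kernel (x - y)) summable_on int_lattice"
    "(\<Sum>\<^sub>\<infinity>y\<in>int_lattice. jump_kernel (x - y)) = (\<Sum>\<^sub>\<infinity>z\<in>(int_lattice :: (real ^ 'd) set). jump_kernel z)"
  using summable_on_reindex_bij_betw[OF int_lattice_translate_bij[OF assms], of jump_kernel]
    infsum_reindex_bij_betw[OF int_lattice_translate_bij[OF assms], of jump_kernel]
    jump_kernel_summable by auto

lemma summable_on_swap_square:
  fixes F :: "'a \<Rightarrow> 'a \<Rightarrow> real"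
  assumes "(\<lambda>(x, y). F x y) summable_on A \<times> A"
  shows "(\<lambda>(x, y). F y x) summable_on A \<times> A"
    "(\<Sum>\<^sub>\<infinity>(x, y)\<in>A \<times> A. F y x) = (\<Sum>\<^sub>\<infinity>(x, y)\<in>A \<times> A. F x y)"
proof -
  have bij: "bij_betw prod.swap (A \<times> A) (A \<times> A)" by (rule bij_betw_byWitness[of _ prod.swap]) auto
  have eq: "(\<lambda>p. (\<lambda>(x, y). F x y) (prod.swap p)) = (\<lambda>(x, y). F y x)" by (auto simp: fun_eq_iff)
  show "(\<lambda>(x, y). F y x) summable_on A \<times> A"
    using summable_on_reindex_bij_betw[OF bij, of "\<lambda>(x, y). F x y"] assms unfolding eq by simp
  show "(\<Sum>\<^sub>\<infinity>(x, y)\<in>A \<times> A. F y x) = (\<Sum>\<^sub>\<infinity>(x, y)\<in>A \<times> A. F x y)"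
    using infsum_reindex_bij_betw[OF bij, of "\<lambda>(x, y). F x y"] unfolding eq by simp
qed

text \<open>The row sums of a translation invariant kernel are one constant, which reduces the first
  pair sum to the sum of squares; the second is its mirror image.\<close>

lemma kernel_square_summable:
  fixes u :: "real ^ 'd \<Rightarrow> real"
  assumes "(\<lambda>x. (u x)\<^sup>2) summable_on int_lattice"
  shows "(\<lambda>(x, y). jump_kernel (x - y) * (u x)\<^sup>2) summable_on int_lattice \<times> int_lattice"
    "(\<lambda>(x, y). jump_kernel (x - y) * (u y)\<^sup>2) summable_on int_lattice \<times> int_lattice"
proof -
  show 1: "(\<lambda>(x, y). jump_kernel (x - y) * (u x)\<^sup>2) summable_on int_lattice \<times> int_lattice"
  proof (rule summable_on_SigmaI)
    fix x :: "real ^ 'd" assume x: "x \<in> int_lattice"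
    show "((\<lambda>y. case (x, y) of (x, y) \<Rightarrow> jump_kernel (x - y) * (u x)\<^sup>2) has_sum
        (\<Sum>\<^sub>\<infinity>z\<in>(int_lattice :: (real ^ 'd) set). jump_kernel z) * (u x)\<^sup>2) int_lattice"
      using has_sum_cmult_left[OF has_sum_infsum[OF jump_kernel_row(1)[OF x]], of "(u x)\<^sup>2"]
      by (simp add: jump_kernel_row(2)[OF x])
  qed (use assms in \<open>auto intro: summable_on_cmult_right\<close>)
  from summable_on_swap_square(1)[OF 1]
  show "(\<lambda>(x, y). jump_kernel (x - y) * (u y)\<^sup>2) summable_on int_lattice \<times> int_lattice"
    by (simp add: jump_kernel_commute)
qed

lemma summable_on_comparison_real:
  fixes f g :: "'a \<Rightarrow> real"
  assumes "g summable_on A" "\<And>x. x \<in> A \<Longrightarrow> \<bar>f x\<bar> \<le> g x"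
  shows "f summable_on A"
proof -
  have "(\<lambda>x. norm (f x)) summable_on A"
    by (rule summable_on_comparison_test[OF assms(1)]) (use assms(2) in auto)
  then show ?thesis by (rule abs_summable_summable)
qed

lemma abs_mult_le_squares: "\<bar>a * b\<bar> \<le> a\<^sup>2 + (b :: real)\<^sup>2"
proof -
  have "2 * (\<bar>a\<bar> * \<bar>b\<bar>) \<le> a\<^sup>2 + b\<^sup>2" using sum_squares_bound[of "\<bar>a\<bar>" "\<bar>b\<bar>"] by simp
  moreover have "0 \<le> \<bar>a\<bar> * \<bar>b\<bar>" by simp
  ultimately show ?thesis unfolding abs_mult by linarith
qed

text \<open>A common summability test for the double sums of the energy method: a coefficient
  dominated by the kernel times an expression quadratic in the values at the two ends. Exchange of
  sums and symmetrisation rest on it.\<close>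

lemma kernel_product_summable:
  fixes u v :: "real ^ 'd \<Rightarrow> real"
  assumes u: "(\<lambda>x. (u x)\<^sup>2) summable_on int_lattice" and v: "(\<lambda>x. (v x)\<^sup>2) summable_on int_lattice"
    and a: "\<And>x y. x \<in> int_lattice \<Longrightarrow> y \<in> int_lattice \<Longrightarrow> \<bar>a x y\<bar> \<le> C * jump_kernel (x - y)"
    and F: "\<And>x y. \<bar>F x y\<bar> \<le> c * ((u x)\<^sup>2 + (u y)\<^sup>2 + (v x)\<^sup>2 + (v y)\<^sup>2)" and C: "C \<ge> 0"
  shows "(\<lambda>(x, y). a x y * F x y) summable_on int_lattice \<times> int_lattice"
proof (rule summable_on_comparison_real)
  let ?g = "\<lambda>(x, y). C * c * (jump_kernel (x - y) * (u x)\<^sup>2 + jump_kernel (x - y) * (u y)\<^sup>2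
      + jump_kernel (x - y) * (v x)\<^sup>2 + jump_kernel (x - y) * (v y)\<^sup>2)"
  have "(\<lambda>p. C * c * ((\<lambda>(x, y). jump_kernel (x - y) * (u x)\<^sup>2) p + (\<lambda>(x, y). jump_kernel (x - y) * (u y)\<^sup>2) p
      + (\<lambda>(x, y). jump_kernel (x - y) * (v x)\<^sup>2) p + (\<lambda>(x, y). jump_kernel (x - y) * (v y)\<^sup>2) p))
      summable_on int_lattice \<times> int_lattice"
    by (intro summable_on_cmult_right summable_on_add kernel_square_summable u v)
  then show "?g summable_on int_lattice \<times> int_lattice" by (simp add: case_prod_unfold)
  fix p :: "(real ^ 'd) \<times> (real ^ 'd)" assume p: "p \<in> int_lattice \<times> int_lattice"
  obtain x y where xy: "p = (x, y)" "x \<in> int_lattice" "y \<in> int_lattice" using p by auto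
  have "\<bar>a x y * F x y\<bar> \<le> (C * jump_kernel (x - y)) * (c * ((u x)\<^sup>2 + (u y)\<^sup>2 + (v x)\<^sup>2 + (v y)\<^sup>2))"
    unfolding abs_mult using a[OF xy(2,3)] F[of x y] C by (intro mult_mono) auto
  then show "\<bar>case p of (x, y) \<Rightarrow> a x y * F x y\<bar> \<le> ?g p"
    by (simp add: xy(1) algebra_simps)
qed

text \<open>The double sum of \<open>a x y * ((u y - u x) * v x)\<close> equals its copy with the
  two points exchanged. Averaging both copies produces the increment of \<open>v\<close> and the
  factor -1/2.\<close>

lemma summation_by_parts:
  fixes u v :: "real ^ 'd \<Rightarrow> real"
  assumes u: "(\<lambda>x. (u x)\<^sup>2) summable_on int_lattice" and v: "(\<lambda>x. (v x)\<^sup>2) summable_on int_lattice"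
    and a: "\<And>x y. x \<in> int_lattice \<Longrightarrow> y \<in> int_lattice \<Longrightarrow> \<bar>a x y\<bar> \<le> C * jump_kernel (x - y)"
    and sym: "\<And>x y. x \<in> int_lattice \<Longrightarrow> y \<in> int_lattice \<Longrightarrow> a x y = a y x" and C: "C \<ge> 0"
  shows "((\<lambda>x. v x * (\<Sum>\<^sub>\<infinity>y\<in>int_lattice. a x y * (u y - u x))) has_sum
      - (1 / 2) * (\<Sum>\<^sub>\<infinity>(x, y)\<in>int_lattice \<times> int_lattice. a x y * ((u y - u x) * (v y - v x)))) int_lattice"
proof -
  let ?L = "int_lattice :: (real ^ 'd) set"
  have sq: "\<bar>(p - q) * r\<bar> \<le> 2 * (p\<^sup>2 + q\<^sup>2 + r\<^sup>2)" for p q r :: real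
  proof -
    have "\<bar>(p - q) * r\<bar> = \<bar>p * r - q * r\<bar>" by (simp add: algebra_simps)
    also have "\<dots> \<le> \<bar>p * r\<bar> + \<bar>q * r\<bar>" by (rule abs_triangle_ineq4)
    also have "\<dots> \<le> (p\<^sup>2 + r\<^sup>2) + (q\<^sup>2 + r\<^sup>2)" by (intro add_mono abs_mult_le_squares)
    also have "\<dots> \<le> 2 * (p\<^sup>2 + q\<^sup>2 + r\<^sup>2)" by simp
    finally show ?thesis .
  qed
  have F: "(\<lambda>(x, y). a x y * ((u y - u x) * v x)) summable_on ?L \<times> ?L"
    by (rule kernel_product_summable[OF u v a _ C, where c = 2])
       (auto intro: order_trans[OF sq])
  note sw = summable_on_swap_square[OF F]
  have "(\<Sum>\<^sub>\<infinity>(x, y)\<in>?L \<times> ?L. a x y * ((u y - u x) * (v y - v x)))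
      = (\<Sum>\<^sub>\<infinity>p\<in>?L \<times> ?L. - ((\<lambda>(x, y). a x y * ((u y - u x) * v x)) p + (\<lambda>(x, y). a y x * ((u x - u y) * v y)) p))"
    by (rule infsum_cong) (auto simp: sym algebra_simps)
  also have "\<dots> = - 2 * (\<Sum>\<^sub>\<infinity>(x, y)\<in>?L \<times> ?L. a x y * ((u y - u x) * v x))"
    by (subst infsum_uminus, subst infsum_add[OF F sw(1)]) (simp add: sw(2))
  finally have eq: "(\<Sum>\<^sub>\<infinity>(x, y)\<in>?L \<times> ?L. a x y * ((u y - u x) * v x)) =
      - (1 / 2) * (\<Sum>\<^sub>\<infinity>(x, y)\<in>?L \<times> ?L. a x y * ((u y - u x) * (v y - v x)))" by simp
  have row: "v x * (\<Sum>\<^sub>\<infinity>y\<in>?L. a x y * (u y - u x)) = (\<Sum>\<^sub>\<infinity>y\<in>?L. a x y * ((u y - u x) * v x))" for x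
    by (subst infsum_cmult_right'[symmetric]) (simp add: mult_ac)
  have "((\<lambda>x. \<Sum>\<^sub>\<infinity>y\<in>?L. a x y * ((u y - u x) * v x)) has_sum
      (\<Sum>\<^sub>\<infinity>(x, y)\<in>?L \<times> ?L. a x y * ((u y - u x) * v x))) ?L"
    by (subst infsum_Sigma'_banach[OF F, symmetric], rule has_sum_infsum)
       (rule summable_on_Sigma_banach[OF F])
  then show ?thesis unfolding eq row .
qed


section \<open>Energy identity and well-posedness of the discrete equation\<close>

lemma square_summable_diff:
  fixes u v :: "'a \<Rightarrow> real"
  assumes "(\<lambda>x. (u x)\<^sup>2) summable_on A" "(\<lambda>x. (v x)\<^sup>2) summable_on A"
  shows "(\<lambda>x. (u x - v x)\<^sup>2) summable_on A"
proof (rule summable_on_comparison_real)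
  show "(\<lambda>x. 2 * ((u x)\<^sup>2 + (v x)\<^sup>2)) summable_on A"
    by (intro summable_on_cmult_right summable_on_add assms)
  show "\<bar>(u x - v x)\<^sup>2\<bar> \<le> 2 * ((u x)\<^sup>2 + (v x)\<^sup>2)" for x
    using zero_le_power2[of "u x + v x"] unfolding abs_power2 by (simp add: power2_diff power2_sum)
qed

text \<open>Summation by parts with both functions equal to \<open>v\<close>. For non-negative
  \<open>a\<close> and \<open>l\<close> both terms of the value are non-negative; this yields
  uniqueness first and the error bound later.\<close>

lemma energy_identity:
  fixes v :: "real ^ 'd \<Rightarrow> real"
  assumes v: "(\<lambda>x. (v x)\<^sup>2) summable_on int_lattice"
    and a: "\<And>x y. x \<in> int_lattice \<Longrightarrow> y \<in> int_lattice \<Longrightarrow> \<bar>a x y\<bar> \<le> C * jump_kernel (x - y)"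
    and sym: "\<And>x y. x \<in> int_lattice \<Longrightarrow> y \<in> int_lattice \<Longrightarrow> a x y = a y x" and C: "C \<ge> 0"
  shows "((\<lambda>x. v x * (l * v x - (\<Sum>\<^sub>\<infinity>y\<in>int_lattice. a x y * (v y - v x)))) has_sum
      l * (\<Sum>\<^sub>\<infinity>x\<in>int_lattice. (v x)\<^sup>2)
      + 1 / 2 * (\<Sum>\<^sub>\<infinity>(x, y)\<in>int_lattice \<times> int_lattice. a x y * (v y - v x)\<^sup>2)) int_lattice"
proof -
  have 1: "((\<lambda>x. l * (v x)\<^sup>2) has_sum l * (\<Sum>\<^sub>\<infinity>x\<in>int_lattice. (v x)\<^sup>2)) int_lattice"
    by (intro has_sum_cmult_right has_sum_infsum v)
  note 2 = summation_by_parts[OF v v a sym C]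
  have "((\<lambda>x. l * (v x)\<^sup>2 + - (v x * (\<Sum>\<^sub>\<infinity>y\<in>int_lattice. a x y * (v y - v x)))) has_sum
      l * (\<Sum>\<^sub>\<infinity>x\<in>int_lattice. (v x)\<^sup>2)
      + - (- (1 / 2) * (\<Sum>\<^sub>\<infinity>(x, y)\<in>int_lattice \<times> int_lattice. a x y * ((v y - v x) * (v y - v x))))) int_lattice"
    by (intro has_sum_add[OF 1] has_sum_uminusI 2)
  then show ?thesis by (simp add: power2_eq_square algebra_simps)
qed

text \<open>\<open>p\<close> is merely square summable, so increments are estimated by |t| <= 1 +
  t^2. The constants are summed by the kernel row, the squares because the kernel is at most 1 on
  the lattice.\<close>

lemma kernel_row_summable:
  fixes p :: "real ^ 'd \<Rightarrow> real"
  assumes p: "(\<lambda>x. (p x)\<^sup>2) summable_on int_lattice" and x: "x \<in> int_lattice" and C: "C \<ge> 0"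
    and a: "\<And>y. y \<in> int_lattice \<Longrightarrow> \<bar>a x y\<bar> \<le> C * jump_kernel (x - y)"
  shows "(\<lambda>y. a x y * (p y - p x)) summable_on int_lattice"
proof (rule summable_on_comparison_real)
  show "(\<lambda>y. C * ((p y)\<^sup>2 + (1 + (p x)\<^sup>2) * jump_kernel (x - y) + jump_kernel (x - y))) summable_on int_lattice"
    by (intro summable_on_cmult_right summable_on_add p jump_kernel_row(1) x)
  fix y :: "real ^ 'd" assume y: "y \<in> int_lattice"
  define K where "K = jump_kernel (x - y)"
  have K: "0 \<le> K" "K \<le> 1" using jump_kernel_le_1[OF int_lattice_diff[OF x y]] by (auto simp: K_def)
  have "\<bar>t\<bar> \<le> 1 + t\<^sup>2" for t :: real using abs_mult_le_squares[of 1 t] by simp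
  then have b: "\<bar>p y - p x\<bar> \<le> (1 + (p y)\<^sup>2) + (1 + (p x)\<^sup>2)"
    using abs_triangle_ineq4[of "p y" "p x"] by (smt (verit))
  have "\<bar>a x y * (p y - p x)\<bar> \<le> (C * K) * ((1 + (p y)\<^sup>2) + (1 + (p x)\<^sup>2))"
    unfolding abs_mult using a[OF y] b C K by (intro mult_mono) (auto simp: K_def)
  also have "\<dots> = C * (K * (p y)\<^sup>2 + (1 + (p x)\<^sup>2) * K + K)" by (simp add: algebra_simps)
  also have "\<dots> \<le> C * (1 * (p y)\<^sup>2 + (1 + (p x)\<^sup>2) * K + K)"
    using K C by (intro mult_left_mono add_right_mono mult_right_mono) auto
  finally show "\<bar>a x y * (p y - p x)\<bar> \<le> C * ((p y)\<^sup>2 + (1 + (p x)\<^sup>2) * jump_kernel (x - y) + jump_kernel (x - y))"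
    by (simp add: K_def)
qed

text \<open>The difference of two solutions, tested against itself, has zero energy, and
  \<open>l > 0\<close> then forces its square sum to vanish.\<close>

lemma resolvent_unique:
  fixes u v :: "real ^ 'd \<Rightarrow> real"
  assumes u: "(\<lambda>x. (u x)\<^sup>2) summable_on int_lattice" and v: "(\<lambda>x. (v x)\<^sup>2) summable_on int_lattice"
    and a: "\<And>x y. x \<in> int_lattice \<Longrightarrow> y \<in> int_lattice \<Longrightarrow> 0 \<le> a x y \<and> a x y \<le> C * jump_kernel (x - y)"
    and sym: "\<And>x y. x \<in> int_lattice \<Longrightarrow> y \<in> int_lattice \<Longrightarrow> a x y = a y x" and C: "C \<ge> 0" and l: "l > 0"
    and eq: "\<And>x. x \<in> int_lattice \<Longrightarrow> l * u x - (\<Sum>\<^sub>\<infinity>y\<in>int_lattice. a x y * (u y - u x))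
        = l * v x - (\<Sum>\<^sub>\<infinity>y\<in>int_lattice. a x y * (v y - v x))"
    and x: "x \<in> int_lattice"
  shows "u x = v x"
proof -
  have row: "(\<lambda>y. a x y * (p y - p x)) summable_on int_lattice"
    if p: "(\<lambda>x. (p x)\<^sup>2) summable_on int_lattice" and x: "x \<in> int_lattice" for p :: "real ^ 'd \<Rightarrow> real" and x
    by (rule kernel_row_summable[OF p x C]) (use a[OF x] in auto)
  define z where "z x = u x - v x" for x
  have z: "(\<lambda>x. (z x)\<^sup>2) summable_on int_lattice" unfolding z_def by (rule square_summable_diff[OF u v])
  have z0: "l * z x - (\<Sum>\<^sub>\<infinity>y\<in>int_lattice. a x y * (z y - z x)) = 0" if x: "x \<in> int_lattice" for x
  proof -
    have "(\<Sum>\<^sub>\<infinity>y\<in>int_lattice. a x y * (z y - z x))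
        = (\<Sum>\<^sub>\<infinity>y\<in>int_lattice. a x y * (u y - u x) + - (a x y * (v y - v x)))"
      by (rule infsum_cong) (simp add: z_def algebra_simps)
    also have "\<dots> = (\<Sum>\<^sub>\<infinity>y\<in>int_lattice. a x y * (u y - u x)) - (\<Sum>\<^sub>\<infinity>y\<in>int_lattice. a x y * (v y - v x))"
      using infsum_add[OF row[OF u x] summable_on_uminus[THEN iffD2, OF row[OF v x]]]
      by (simp add: infsum_uminus)
    finally show ?thesis using eq[OF x] by (simp add: z_def algebra_simps)
  qed
  have "((\<lambda>x. z x * (l * z x - (\<Sum>\<^sub>\<infinity>y\<in>int_lattice. a x y * (z y - z x)))) has_sum
      l * (\<Sum>\<^sub>\<infinity>x\<in>int_lattice. (z x)\<^sup>2)
      + 1 / 2 * (\<Sum>\<^sub>\<infinity>(x, y)\<in>int_lattice \<times> int_lattice. a x y * (z y - z x)\<^sup>2)) int_lattice"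
    by (rule energy_identity[OF z _ sym C]) (use a in auto)
  moreover have "((\<lambda>x. z x * (l * z x - (\<Sum>\<^sub>\<infinity>y\<in>int_lattice. a x y * (z y - z x)))) has_sum 0) int_lattice"
    by (rule has_sum_0) (simp add: z0)
  ultimately have "l * (\<Sum>\<^sub>\<infinity>x\<in>int_lattice. (z x)\<^sup>2)
      + 1 / 2 * (\<Sum>\<^sub>\<infinity>(x, y)\<in>int_lattice \<times> int_lattice. a x y * (z y - z x)\<^sup>2) = 0"
    by (rule has_sum_unique)
  moreover have "(\<Sum>\<^sub>\<infinity>(x, y)\<in>int_lattice \<times> int_lattice. a x y * (z y - z x)\<^sup>2) \<ge> 0"
    by (rule infsum_nonneg) (use a in auto)
  ultimately have "l * (\<Sum>\<^sub>\<infinity>x\<in>int_lattice. (z x)\<^sup>2) \<le> 0" by linarith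
  then have "(\<Sum>\<^sub>\<infinity>x\<in>int_lattice. (z x)\<^sup>2) \<le> 0" using l by (simp add: mult_le_0_iff)
  then have "(z x)\<^sup>2 = 0" by (rule nonneg_infsum_le_0D[OF _ z _ x]) simp
  then show ?thesis by (simp add: z_def)
qed

text \<open>The equation reads \<open>u = (f + a u) / (l + c)\<close> with the row sums \<open>c\<close> of \<open>a\<close>. Its Neumann
  series converges geometrically in \<open>\<ell>\<^sup>1\<close> with weight \<open>l + c\<close>, and summable functions on the
  lattice are square summable.\<close>
lemma resolvent_exists:
  fixes f :: "real ^ 'd \<Rightarrow> real"
  assumes a: "\<And>x y. x \<in> int_lattice \<Longrightarrow> y \<in> int_lattice \<Longrightarrow> 0 \<le> a x y \<and> a x y \<le> C * jump_kernel (x - y)"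
    and sym: "\<And>x y. x \<in> int_lattice \<Longrightarrow> y \<in> int_lattice \<Longrightarrow> a x y = a y x" and C: "C \<ge> 0" and l: "l > 0"
    and f: "f summable_on int_lattice"
  obtains u where "(\<lambda>x. (u x)\<^sup>2) summable_on int_lattice"
    "\<And>x. x \<in> int_lattice \<Longrightarrow> l * u x - (\<Sum>\<^sub>\<infinity>y\<in>int_lattice. a x y * (u y - u x)) = f x"
proof -
  let ?L = "int_lattice :: (real ^ 'd) set"
  have arow: "(\<lambda>y. a x y) summable_on ?L" if "x \<in> ?L" for x
    by (rule summable_on_comparison_real[OF summable_on_cmult_right[OF jump_kernel_row(1)[OF that]]])
       (use a[OF that] in auto)
  define c where "c x = (\<Sum>\<^sub>\<infinity>y\<in>?L. a x y)" for x
  define cb where "cb = C * (\<Sum>\<^sub>\<infinity>z\<in>?L. jump_kernel z)"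
  have c0: "c x \<ge> 0" if "x \<in> ?L" for x unfolding c_def by (rule infsum_nonneg) (use a that in auto)
  have cb: "c x \<le> cb" if x: "x \<in> ?L" for x
  proof -
    have "c x \<le> (\<Sum>\<^sub>\<infinity>y\<in>?L. C * jump_kernel (x - y))"
      unfolding c_def by (rule infsum_mono[OF arow[OF x] summable_on_cmult_right[OF jump_kernel_row(1)[OF x]]])
        (use a x in auto)
    then show ?thesis by (simp add: infsum_cmult_right' jump_kernel_row(2)[OF x] cb_def)
  qed
  have cb0: "cb \<ge> 0" using c0[of 0] cb[of 0] by simp
  \<comment> \<open>The quotient c / (l + c) increases with c, so the uniform bound
    \<open>cb\<close> of the row sums gives one contraction factor below 1.\<close>
  define q where "q = cb / (l + cb)"
  have q: "0 \<le> q" "q < 1" using cb0 l by (auto simp: q_def field_simps)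
  have cq: "c x \<le> q * (l + c x)" if "x \<in> ?L" for x
    using cb[OF that] c0[OF that] l cb0 by (simp add: q_def field_simps)
  have lc: "l + c x > 0" if "x \<in> ?L" for x using c0[OF that] l by simp
  define P where "P g x = (\<Sum>\<^sub>\<infinity>y\<in>?L. a x y * g y) / (l + c x)" for g x
  define A where "A n = (P ^^ n) (\<lambda>x. f x / (l + c x))" for n
  have A0: "A 0 x = f x / (l + c x)" for x by (simp add: A_def)
  have AS: "A (Suc n) x = (\<Sum>\<^sub>\<infinity>y\<in>?L. a x y * A n y) / (l + c x)" for n x
    by (simp add: A_def P_def)
  have aK: "a x y \<le> C" if "x \<in> ?L" "y \<in> ?L" for x y
  proof -
    have "a x y \<le> C * jump_kernel (x - y)" using a[OF that] by simp
    also have "\<dots> \<le> C * 1"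
      by (intro mult_left_mono jump_kernel_le_1 int_lattice_diff that C)
    finally show ?thesis by simp
  qed
  define M where "M = (\<Sum>\<^sub>\<infinity>x\<in>?L. \<bar>f x\<bar>)"
  have fabs: "(\<lambda>x. \<bar>f x\<bar>) summable_on ?L" using summable_on_iff_abs_summable_on_real[THEN iffD1, OF f] by simp
  have An: "(\<lambda>x. (l + c x) * \<bar>A n x\<bar>) summable_on ?L \<and> (\<Sum>\<^sub>\<infinity>x\<in>?L. (l + c x) * \<bar>A n x\<bar>) \<le> q ^ n * M" for n
  proof (induction n)
    case 0
    have eq: "(l + c x) * \<bar>A 0 x\<bar> = \<bar>f x\<bar>" if "x \<in> ?L" for x
      using lc[OF that] by (simp only: A0 abs_divide) simp
    show ?case using fabs by (simp add: eq M_def cong: summable_on_cong infsum_cong)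
  next
    case (Suc n)
    then have S: "(\<lambda>x. (l + c x) * \<bar>A n x\<bar>) summable_on ?L"
      and B: "(\<Sum>\<^sub>\<infinity>x\<in>?L. (l + c x) * \<bar>A n x\<bar>) \<le> q ^ n * M" by auto
    have Sc: "(\<lambda>y. c y * \<bar>A n y\<bar>) summable_on ?L"
      by (rule summable_on_comparison_real[OF S]) (use c0 l in \<open>auto simp: abs_mult algebra_simps\<close>)
    \<comment> \<open>By symmetry of \<open>a\<close> the column sums are the row sums
      \<open>c\<close>. Hence the weighted norm of the next iterate is at most the sum of
      \<open>c y * \<bar>A n y\<bar>\<close>, and \<open>cq\<close> trades \<open>c y\<close> for
      \<open>q * (l + c y)\<close>.\<close>
    have col: "((\<lambda>x. a x y * \<bar>A n y\<bar>) has_sum c y * \<bar>A n y\<bar>) ?L" if y: "y \<in> ?L" for y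
    proof -
      have "((\<lambda>x. a y x * \<bar>A n y\<bar>) has_sum c y * \<bar>A n y\<bar>) ?L"
        unfolding c_def by (intro has_sum_cmult_left has_sum_infsum arow y)
      then show ?thesis by (rule has_sum_cong[THEN iffD1, rotated]) (use sym y in auto)
    qed
    have D: "(\<lambda>(y, x). a x y * \<bar>A n y\<bar>) summable_on ?L \<times> ?L"
      by (rule summable_on_SigmaI[where g = "\<lambda>y. c y * \<bar>A n y\<bar>"]) (use col Sc a in auto)
    note D' = summable_on_swap_square[OF D]
    have rowS: "(\<lambda>y. a x y * \<bar>A n y\<bar>) summable_on ?L" if "x \<in> ?L" for x
      using summable_on_SigmaD1[OF D'(1) that] by simp
    have bnd: "(l + c x) * \<bar>A (Suc n) x\<bar> \<le> (\<Sum>\<^sub>\<infinity>y\<in>?L. a x y * \<bar>A n y\<bar>)" if x: "x \<in> ?L" for x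
    proof -
      have "(l + c x) * \<bar>A (Suc n) x\<bar> = \<bar>\<Sum>\<^sub>\<infinity>y\<in>?L. a x y * A n y\<bar>"
        using lc[OF x] by (simp only: AS abs_divide) simp
      also have "\<dots> \<le> (\<Sum>\<^sub>\<infinity>y\<in>?L. norm (a x y * A n y))"
      proof -
        have "(\<lambda>y. norm (a x y * A n y)) summable_on ?L"
          by (rule summable_on_cong[THEN iffD1, OF _ rowS[OF x]])
             (use a[OF x] in \<open>auto simp: abs_mult\<close>)
        from norm_infsum_bound[OF this] show ?thesis by simp
      qed
      also have "\<dots> = (\<Sum>\<^sub>\<infinity>y\<in>?L. a x y * \<bar>A n y\<bar>)"
        by (rule infsum_cong) (use a x in \<open>auto simp: abs_mult\<close>)
      finally show ?thesis .
    qed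
    have SS: "(\<lambda>x. \<Sum>\<^sub>\<infinity>y\<in>?L. a x y * \<bar>A n y\<bar>) summable_on ?L"
      using summable_on_Sigma_banach[OF D'(1)] by simp
    have S1: "(\<lambda>x. (l + c x) * \<bar>A (Suc n) x\<bar>) summable_on ?L"
    proof (rule summable_on_comparison_real[OF SS])
      fix x assume x: "x \<in> ?L"
      show "\<bar>(l + c x) * \<bar>A (Suc n) x\<bar>\<bar> \<le> (\<Sum>\<^sub>\<infinity>y\<in>?L. a x y * \<bar>A n y\<bar>)"
        using bnd[OF x] lc[OF x] by (simp only: abs_mult abs_idempotent abs_of_pos)
    qed
    have "(\<Sum>\<^sub>\<infinity>x\<in>?L. (l + c x) * \<bar>A (Suc n) x\<bar>) \<le> (\<Sum>\<^sub>\<infinity>x\<in>?L. \<Sum>\<^sub>\<infinity>y\<in>?L. a x y * \<bar>A n y\<bar>)"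
      by (rule infsum_mono[OF S1 SS bnd])
    also have "\<dots> = (\<Sum>\<^sub>\<infinity>(y, x)\<in>?L \<times> ?L. a x y * \<bar>A n y\<bar>)"
      using infsum_Sigma'_banach[OF D'(1)] D'(2) by simp
    also have "\<dots> = (\<Sum>\<^sub>\<infinity>y\<in>?L. c y * \<bar>A n y\<bar>)"
      using infsum_Sigma'_banach[OF D, symmetric] col[THEN infsumI] by (simp cong: infsum_cong)
    also have "\<dots> \<le> (\<Sum>\<^sub>\<infinity>y\<in>?L. q * ((l + c y) * \<bar>A n y\<bar>))"
      by (rule infsum_mono[OF Sc summable_on_cmult_right[OF S]])
         (use cq in \<open>auto simp flip: mult.assoc intro!: mult_right_mono\<close>)
    also have "\<dots> = q * (\<Sum>\<^sub>\<infinity>y\<in>?L. (l + c y) * \<bar>A n y\<bar>)" by (rule infsum_cmult_right')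
    also have "\<dots> \<le> q * (q ^ n * M)" using B q by (intro mult_left_mono) auto
    finally show ?case using S1 by simp
  qed
  have M0: "M \<ge> 0" unfolding M_def by (rule infsum_nonneg) simp
  have Asum: "(\<lambda>x. \<bar>A n x\<bar>) summable_on ?L" for n
  proof (rule summable_on_comparison_real)
    show "(\<lambda>x. (1 / l) * ((l + c x) * \<bar>A n x\<bar>)) summable_on ?L"
      using An by (intro summable_on_cmult_right) auto
    fix x assume "x \<in> ?L"
    then have "l * \<bar>A n x\<bar> \<le> (l + c x) * \<bar>A n x\<bar>" using c0 by (intro mult_right_mono) auto
    then show "\<bar>\<bar>A n x\<bar>\<bar> \<le> (1 / l) * ((l + c x) * \<bar>A n x\<bar>)" using l by (simp add: field_simps)
  qed
  have Abd: "(\<Sum>\<^sub>\<infinity>x\<in>?L. \<bar>A n x\<bar>) \<le> (M / l) * q ^ n" for n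
  proof -
    have "(\<Sum>\<^sub>\<infinity>x\<in>?L. \<bar>A n x\<bar>) \<le> (\<Sum>\<^sub>\<infinity>x\<in>?L. (1 / l) * ((l + c x) * \<bar>A n x\<bar>))"
    proof (rule infsum_mono[OF Asum])
      show "(\<lambda>x. (1 / l) * ((l + c x) * \<bar>A n x\<bar>)) summable_on ?L"
        using An by (intro summable_on_cmult_right) auto
      fix x assume "x \<in> ?L"
      then have "l * \<bar>A n x\<bar> \<le> (l + c x) * \<bar>A n x\<bar>" using c0 by (intro mult_right_mono) auto
      then show "\<bar>A n x\<bar> \<le> (1 / l) * ((l + c x) * \<bar>A n x\<bar>)" using l by (simp add: field_simps)
    qed
    also have "\<dots> = (1 / l) * (\<Sum>\<^sub>\<infinity>x\<in>?L. (l + c x) * \<bar>A n x\<bar>)" by (rule infsum_cmult_right')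
    also have "\<dots> \<le> (1 / l) * (q ^ n * M)" using An l by (intro mult_left_mono) auto
    finally show ?thesis by (simp add: mult_ac)
  qed
  have geo: "(\<lambda>n. (M / l) * q ^ n) summable_on (UNIV :: nat set)"
  proof (intro summable_on_cmult_right norm_summable_imp_summable_on)
    have "summable (\<lambda>n. q ^ n)" by (rule summable_geometric) (use q in simp)
    then show "summable (\<lambda>n. norm (q ^ n))" using q(1) by simp
  qed
  \<comment> \<open>Joint summability in \<open>n\<close> and \<open>x\<close>, by comparison with
    the geometric series, permits exchanging the Neumann series with sums over the lattice.\<close>
  have T: "(\<lambda>(n, x). \<bar>A n x\<bar>) summable_on (UNIV :: nat set) \<times> ?L"
  proof (rule summable_on_SigmaI[where g = "\<lambda>n. \<Sum>\<^sub>\<infinity>x\<in>?L. \<bar>A n x\<bar>"])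
    show "(\<lambda>n. \<Sum>\<^sub>\<infinity>x\<in>?L. \<bar>A n x\<bar>) summable_on UNIV"
    proof (rule summable_on_comparison_real[OF geo])
      fix n
      have "(\<Sum>\<^sub>\<infinity>x\<in>?L. \<bar>A n x\<bar>) \<ge> 0" by (rule infsum_nonneg) simp
      then show "\<bar>\<Sum>\<^sub>\<infinity>x\<in>?L. \<bar>A n x\<bar>\<bar> \<le> (M / l) * q ^ n" using Abd[of n] by simp
    qed
    show "((\<lambda>x. case (n, x) of (n, x) \<Rightarrow> \<bar>A n x\<bar>) has_sum (\<Sum>\<^sub>\<infinity>x\<in>?L. \<bar>A n x\<bar>)) ?L" for n
      using has_sum_infsum[OF Asum] by simp
  qed simp
  have T': "(\<lambda>(x, n). \<bar>A n x\<bar>) summable_on ?L \<times> (UNIV :: nat set)"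
    using T by (subst summable_on_swap) simp
  have colS: "(\<lambda>n. A n x) summable_on UNIV" if "x \<in> ?L" for x
    by (rule abs_summable_summable) (use summable_on_SigmaD1[OF T' that] in simp)
  have colS': "(\<lambda>n. \<bar>A n x\<bar>) summable_on UNIV" if "x \<in> ?L" for x
    using summable_on_SigmaD1[OF T' that] by simp
  define u where "u x = (\<Sum>\<^sub>\<infinity>n. A n x)" for x
  define U where "U x = (\<Sum>\<^sub>\<infinity>n. \<bar>A n x\<bar>)" for x
  have US: "U summable_on ?L" unfolding U_def using summable_on_Sigma_banach[OF T'] by simp
  have uU: "\<bar>u x\<bar> \<le> U x" if "x \<in> ?L" for x
    using norm_infsum_bound[of "\<lambda>n. A n x" UNIV] colS'[OF that] by (simp add: u_def U_def)
  have U0: "U x \<ge> 0" for x unfolding U_def by (rule infsum_nonneg) simp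
  have UM: "U x \<le> (\<Sum>\<^sub>\<infinity>x\<in>?L. U x)" if "x \<in> ?L" for x
    using finite_sum_le_infsum[OF US, of "{x}"] that U0 by simp
  \<comment> \<open>A summable non-negative function is bounded by its total, so the square of
    \<open>u\<close> is at most a constant times \<open>U\<close>.\<close>
  have sq: "(\<lambda>x. (u x)\<^sup>2) summable_on ?L"
  proof (rule summable_on_comparison_real[OF summable_on_cmult_right[OF US]])
    fix x assume x: "x \<in> ?L"
    have "\<bar>u x\<bar> * \<bar>u x\<bar> \<le> (\<Sum>\<^sub>\<infinity>x\<in>?L. U x) * U x"
      using uU[OF x] UM[OF x] U0 by (intro mult_mono) (auto intro: order_trans infsum_nonneg)
    then show "\<bar>(u x)\<^sup>2\<bar> \<le> (\<Sum>\<^sub>\<infinity>x\<in>?L. U x) * U x" by (simp add: power2_eq_square)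
  qed
  have eq: "l * u x - (\<Sum>\<^sub>\<infinity>y\<in>?L. a x y * (u y - u x)) = f x" if x: "x \<in> ?L" for x
  proof -
    have au: "(\<lambda>y. a x y * u y) summable_on ?L"
    proof (rule summable_on_comparison_real[OF summable_on_cmult_right[OF US]])
      fix y assume y: "y \<in> ?L"
      show "\<bar>a x y * u y\<bar> \<le> C * U y" unfolding abs_mult
        using a[OF x y] aK[OF x y] uU[OF y] C by (intro mult_mono) auto
    qed
    have dbl: "(\<lambda>(n, y). a x y * A n y) summable_on (UNIV :: nat set) \<times> ?L"
      by (rule summable_on_comparison_real[OF summable_on_cmult_right[OF T, of C]])
         (use a[OF x] aK[OF x] C in \<open>auto simp: abs_mult intro!: mult_right_mono\<close>)
    have "(l + c x) * u x = (\<Sum>\<^sub>\<infinity>n. (l + c x) * A n x)"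
      unfolding u_def by (rule infsum_cmult_right'[symmetric])
    \<comment> \<open>The zeroth term reproduces \<open>f\<close>; by \<open>AS\<close> the shifted
      tail is \<open>a\<close> applied to the whole series, which is the fixed point
      equation.\<close>
    also have "\<dots> = (l + c x) * A 0 x + (\<Sum>\<^sub>\<infinity>n. (l + c x) * A (Suc n) x)"
    proof -
      have s: "summable (\<lambda>n. (l + c x) * A n x)"
        using summable_on_imp_summable[OF summable_on_cmult_right[OF colS[OF x]]] .
      have i: "(\<Sum>\<^sub>\<infinity>n. g n) = suminf g" if "g summable_on UNIV" for g :: "nat \<Rightarrow> real"
        using has_sum_imp_sums[OF has_sum_infsum[OF that]] by (simp add: sums_iff)
      have "(\<lambda>n. A (Suc n) x) summable_on UNIV"
        using summable_on_reindex[of Suc UNIV "\<lambda>n. A n x"] summable_on_subset_banach[OF colS[OF x], of "range Suc"]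
        by (simp add: o_def)
      then show ?thesis
        using suminf_split_head[OF s] i[OF summable_on_cmult_right[OF colS[OF x], of "l + c x"]]
          i[OF summable_on_cmult_right, of "\<lambda>n. A (Suc n) x" "l + c x"] by simp
    qed
    also have "(\<Sum>\<^sub>\<infinity>n. (l + c x) * A (Suc n) x) = (\<Sum>\<^sub>\<infinity>n. \<Sum>\<^sub>\<infinity>y\<in>?L. a x y * A n y)"
      using lc[OF x] by (simp add: AS)
    also have "\<dots> = (\<Sum>\<^sub>\<infinity>y\<in>?L. \<Sum>\<^sub>\<infinity>n. a x y * A n y)"
      using infsum_swap_banach[OF dbl] by simp
    also have "\<dots> = (\<Sum>\<^sub>\<infinity>y\<in>?L. a x y * u y)" by (simp add: u_def infsum_cmult_right')
    also have "(l + c x) * A 0 x = f x" using lc[OF x] by (simp add: A0)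
    finally have main: "(l + c x) * u x = f x + (\<Sum>\<^sub>\<infinity>y\<in>?L. a x y * u y)" .
    have "(\<Sum>\<^sub>\<infinity>y\<in>?L. a x y * (u y - u x)) = (\<Sum>\<^sub>\<infinity>y\<in>?L. a x y * u y + a x y * (- u x))"
      by (rule infsum_cong) (simp add: algebra_simps)
    also have "\<dots> = (\<Sum>\<^sub>\<infinity>y\<in>?L. a x y * u y) + c x * (- u x)"
      unfolding c_def by (subst infsum_add[OF au summable_on_cmult_left[OF arow[OF x]]])
        (simp add: infsum_uminus infsum_cmult_left')
    finally show ?thesis using main by (simp add: algebra_simps)
  qed
  show ?thesis by (rule that[OF sq eq])
qed

section \<open>Smooth functions and the limit resolvent\<close>

definition iterated_partial :: "'d list \<Rightarrow> (real ^ 'd \<Rightarrow> real) \<Rightarrow> real ^ 'd \<Rightarrow> real" where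
  "iterated_partial js g = foldr partial_deriv js g"

lemma iterated_partial_simps [simp]:
  "iterated_partial [] g = g"
  "iterated_partial (i # js) g = partial_deriv i (iterated_partial js g)"
  by (simp_all add: iterated_partial_def)

lemma smooth_compact_supportD:
  assumes "smooth_compact_support g"
  shows "iterated_partial js g differentiable (at x)"
  using assms by (simp add: smooth_compact_support_def iterated_partial_def)

lemma has_derivative_partial_deriv:
  fixes h :: "real ^ 'd \<Rightarrow> real"
  assumes "h differentiable (at x)"
  shows "(h has_derivative (\<lambda>v. \<Sum>i\<in>UNIV. v $ i * partial_deriv i h x)) (at x)"
proof -
  have d: "(h has_derivative frechet_derivative h (at x)) (at x)"
    using assms by (simp add: frechet_derivative_works)
  then interpret bounded_linear "frechet_derivative h (at x)" by (rule has_derivative_bounded_linear)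
  have "frechet_derivative h (at x) v = (\<Sum>i\<in>UNIV. v $ i * partial_deriv i h x)" for v
  proof -
    have "frechet_derivative h (at x) v = frechet_derivative h (at x) (\<Sum>i\<in>UNIV. v $ i *\<^sub>R axis i 1)"
      using basis_expansion[of v] by (simp add: scalar_mult_eq_scaleR)
    also have "\<dots> = (\<Sum>i\<in>UNIV. v $ i * partial_deriv i h x)"
      by (simp add: sum scaleR partial_deriv_def)
    finally show ?thesis .
  qed
  then have "frechet_derivative h (at x) = (\<lambda>v. \<Sum>i\<in>UNIV. v $ i * partial_deriv i h x)" by (rule ext)
  then show ?thesis using d by simp
qed

lemma DERIV_along_line:
  fixes h :: "real ^ 'd \<Rightarrow> real"
  assumes "\<And>x. h differentiable (at x)"
  shows "((\<lambda>t. h (x + t *\<^sub>R z)) has_real_derivative (\<Sum>i\<in>UNIV. z $ i * partial_deriv i h (x + t *\<^sub>R z))) (at t)"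
proof -
  have "((\<lambda>t. x + t *\<^sub>R z) has_derivative (\<lambda>s. s *\<^sub>R z)) (at t)"
    by (auto intro!: derivative_eq_intros)
  from has_derivative_compose[OF this has_derivative_partial_deriv[OF assms]]
  have "((\<lambda>t. h (x + t *\<^sub>R z)) has_derivative
      (\<lambda>s. \<Sum>i\<in>UNIV. (s *\<^sub>R z) $ i * partial_deriv i h (x + t *\<^sub>R z))) (at t)" .
  moreover have "(\<lambda>s. \<Sum>i\<in>UNIV. (s *\<^sub>R z) $ i * partial_deriv i h (x + t *\<^sub>R z))
      = (*) (\<Sum>i\<in>UNIV. z $ i * partial_deriv i h (x + t *\<^sub>R z))"
    by (auto simp: fun_eq_iff sum_distrib_left mult_ac)
  ultimately show ?thesis by (simp add: has_field_derivative_def)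
qed

lemma partial_deriv_eq_0:
  fixes h :: "real ^ 'd \<Rightarrow> real"
  assumes "open S" "x \<in> S" "\<And>y. y \<in> S \<Longrightarrow> h y = 0"
  shows "partial_deriv i h x = 0"
proof -
  have "(h has_derivative (\<lambda>_. 0)) (at x)"
    by (rule has_derivative_transform_within_open[of "\<lambda>_. 0" _ _ _ S]) (use assms in auto)
  from frechet_derivative_at[OF this] show ?thesis by (simp add: partial_deriv_def fun_eq_iff)
qed

lemma smooth_compact_support_continuous:
  assumes "smooth_compact_support g"
  shows "continuous_on S (iterated_partial js g)"
  using smooth_compact_supportD[OF assms]
  by (meson continuous_at_imp_continuous_on differentiable_imp_continuous_within)

text \<open>Derivatives vanish on an open set where the function does, so by induction one radius
  serves all orders at once.\<close>

lemma smooth_compact_support_vanish: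
  assumes g: "smooth_compact_support g"
  obtains M where "M > 0" "\<And>js x. norm x > M \<Longrightarrow> iterated_partial js g x = 0"
proof -
  have "bounded {x. g x \<noteq> 0}"
    using g unfolding smooth_compact_support_def
    by (meson bounded_subset closure_subset compact_imp_bounded)
  then obtain M where M: "M > 0" "\<And>x. g x \<noteq> 0 \<Longrightarrow> norm x \<le> M"
    by (auto simp: bounded_pos)
  have "\<forall>x. norm x > M \<longrightarrow> iterated_partial js g x = 0" for js
  proof (induction js)
    case Nil
    then show ?case using M(2) by (auto simp: not_le[symmetric])
  next
    case (Cons i js)
    have "open {x :: real ^ _. norm x > M}" by (intro open_Collect_less continuous_intros)
    then show ?case using Cons partial_deriv_eq_0[of "{x. norm x > M}"] by auto
  qed
  then show ?thesis using that M(1) by blast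
qed

text \<open>Each derivative is continuous and vanishes off a ball, and only finitely many index
  lists have length at most \<open>n\<close>.\<close>

lemma smooth_compact_support_bounded:
  fixes g :: "real ^ 'd \<Rightarrow> real"
  assumes g: "smooth_compact_support g"
  obtains B where "B > 0" "\<And>js x. length js \<le> n \<Longrightarrow> \<bar>iterated_partial js g x\<bar> \<le> B"
proof -
  obtain M where M: "M > 0" "\<And>js x. norm x > M \<Longrightarrow> iterated_partial js g x = 0"
    by (rule smooth_compact_support_vanish[OF g]) blast
  have "\<exists>b. \<forall>x. \<bar>iterated_partial js g x\<bar> \<le> b" for js
  proof -
    have "bounded (iterated_partial js g ` cball 0 M)"
      by (intro compact_imp_bounded compact_continuous_image smooth_compact_support_continuous g) auto
    then obtain b where b: "\<And>x. norm x \<le> M \<Longrightarrow> \<bar>iterated_partial js g x\<bar> \<le> b"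
      by (metis bounded_iff image_eqI mem_cball_0 real_norm_def)
    have "b \<ge> 0" using b[of 0] M(1) M(1) by simp
    then have "\<bar>iterated_partial js g x\<bar> \<le> b" for x
      using b[of x] M(2)[of x js] by (cases "norm x \<le> M") auto
    then show ?thesis by blast
  qed
  then obtain b where b: "\<And>js x. \<bar>iterated_partial js g x\<bar> \<le> b js" by metis
  define J where "J = {js :: 'd list. length js \<le> n}"
  have fin: "finite J" using finite_lists_length_le[of "UNIV :: 'd set" n] by (simp add: J_def)
  have b0: "b js \<ge> 0" for js using b[of js 0] by linarith
  show ?thesis
  proof (rule that[of "1 + sum b J"])
    show "0 < 1 + sum b J" using b0 by (simp add: add_pos_nonneg sum_nonneg)
    fix js :: "'d list" and x assume "length js \<le> n"
    then have "js \<in> J" by (simp add: J_def)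
    then have "b js \<le> sum b J" using fin b0 by (intro member_le_sum) auto
    then show "\<bar>iterated_partial js g x\<bar> \<le> 1 + sum b J" using b[of js x] by linarith
  qed
qed

lemma sum_component_bound:
  fixes z :: "real ^ 'd" and c :: "'d \<Rightarrow> real"
  assumes "\<And>i. \<bar>c i\<bar> \<le> B"
  shows "\<bar>\<Sum>i\<in>UNIV. z $ i * c i\<bar> \<le> real CARD('d) * (norm z * B)"
proof -
  have "\<bar>\<Sum>i\<in>UNIV. z $ i * c i\<bar> \<le> (\<Sum>i\<in>UNIV. \<bar>z $ i * c i\<bar>)" by (rule sum_abs)
  also have "\<dots> \<le> (\<Sum>i\<in>(UNIV :: 'd set). norm z * B)"
    unfolding abs_mult by (intro sum_mono mult_mono component_le_norm_cart assms) auto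
  finally show ?thesis by simp
qed

lemma line_mvt:
  fixes h :: "real ^ 'd \<Rightarrow> real"
  assumes "\<And>x. h differentiable (at x)"
  obtains t where "0 < t" "t < 1" "h y - h x = (\<Sum>i\<in>UNIV. (y - x) $ i * partial_deriv i h (x + t *\<^sub>R (y - x)))"
proof -
  have "\<exists>t. 0 < t \<and> t < 1 \<and> h (x + 1 *\<^sub>R (y - x)) - h (x + 0 *\<^sub>R (y - x))
      = (1 - 0) * (\<Sum>i\<in>UNIV. (y - x) $ i * partial_deriv i h (x + t *\<^sub>R (y - x)))"
    using MVT2[of 0 1 "\<lambda>t. h (x + t *\<^sub>R (y - x))"] DERIV_along_line[OF assms, of x "y - x"] by auto
  then show ?thesis using that by auto
qed

lemma lipschitz_of_partial_bound:
  fixes h :: "real ^ 'd \<Rightarrow> real"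
  assumes "\<And>x. h differentiable (at x)" "\<And>i x. \<bar>partial_deriv i h x\<bar> \<le> B"
  shows "\<bar>h y - h x\<bar> \<le> real CARD('d) * (norm (y - x) * B)"
proof -
  obtain t where "h y - h x = (\<Sum>i\<in>UNIV. (y - x) $ i * partial_deriv i h (x + t *\<^sub>R (y - x)))"
    using line_mvt[OF assms(1)] by metis
  then show ?thesis using sum_component_bound[of "\<lambda>i. partial_deriv i h (x + t *\<^sub>R (y - x))" B "y - x"] assms(2) by simp
qed

text \<open>The gradient is evaluated at a third point \<open>u\<close>, later a point of the lens.
  Its distance from the mean value point is at most \<open>3 * norm (y - x)\<close>, so moving there
  keeps the remainder quadratic.\<close>

lemma first_order_taylor:
  fixes g :: "real ^ 'd \<Rightarrow> real"
  assumes g: "smooth_compact_support g" and B: "\<And>js x. length js \<le> 2 \<Longrightarrow> \<bar>iterated_partial js g x\<bar> \<le> B"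
    and u: "norm (u - x) \<le> 2 * norm (y - x)"
  shows "\<bar>g y - g x - (\<Sum>i\<in>UNIV. (y - x) $ i * partial_deriv i g u)\<bar> \<le> 3 * real CARD('d) ^ 2 * B * norm (y - x) ^ 2"
proof -
  have B0: "B \<ge> 0" using B[of "[]" 0] by simp
  obtain t where t: "0 < t" "t < 1" "g y - g x = (\<Sum>i\<in>UNIV. (y - x) $ i * partial_deriv i g (x + t *\<^sub>R (y - x)))"
    using line_mvt[of g y x] smooth_compact_supportD[OF g, of "[]"] by auto
  have "\<bar>partial_deriv i g (x + t *\<^sub>R (y - x)) - partial_deriv i g u\<bar> \<le> real CARD('d) * (3 * norm (y - x) * B)" for i
  proof -
    have "norm ((x + t *\<^sub>R (y - x)) - u) \<le> norm (t *\<^sub>R (y - x)) + norm (u - x)"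
      by (metis add.commute add_diff_eq norm_minus_commute norm_triangle_ineq diff_add_eq_diff_diff_swap diff_diff_eq2)
    also have "norm (t *\<^sub>R (y - x)) \<le> 1 * norm (y - x)" using t by (simp add: mult_left_le_one_le)
    finally have n: "norm ((x + t *\<^sub>R (y - x)) - u) \<le> 3 * norm (y - x)" using u by simp
    have "\<bar>partial_deriv i g (x + t *\<^sub>R (y - x)) - partial_deriv i g u\<bar>
        \<le> real CARD('d) * (norm ((x + t *\<^sub>R (y - x)) - u) * B)"
      using lipschitz_of_partial_bound[of "partial_deriv i g" B "x + t *\<^sub>R (y - x)" u]
        smooth_compact_supportD[OF g, of "[i]"] B[of "[_, i]"] by simp
    also have "\<dots> \<le> real CARD('d) * (3 * norm (y - x) * B)"
      using n B0 by (intro mult_left_mono mult_right_mono) auto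
    finally show ?thesis .
  qed
  from sum_component_bound[OF this, of "y - x"]
  have "\<bar>\<Sum>i\<in>UNIV. (y - x) $ i * (partial_deriv i g (x + t *\<^sub>R (y - x)) - partial_deriv i g u)\<bar>
     \<le> real CARD('d) * (norm (y - x) * (real CARD('d) * (3 * norm (y - x) * B)))" .
  then show ?thesis by (simp add: t(3) right_diff_distrib sum_subtractf power2_eq_square mult_ac)
qed

text \<open>Maclaurin's formula along the segment from \<open>x\<close> to \<open>x + z\<close>; the
  factor 1/6 is given away.\<close>

lemma second_order_taylor:
  fixes g :: "real ^ 'd \<Rightarrow> real"
  assumes g: "smooth_compact_support g" and B: "\<And>js x. length js \<le> 3 \<Longrightarrow> \<bar>iterated_partial js g x\<bar> \<le> B"
  shows "\<bar>g (x + z) - g x - (\<Sum>i\<in>UNIV. z $ i * partial_deriv i g x)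
      - (\<Sum>i\<in>UNIV. \<Sum>j\<in>UNIV. z $ i * z $ j * partial_deriv j (partial_deriv i g) x) / 2\<bar>
    \<le> real CARD('d) ^ 3 * B * norm z ^ 3"
proof -
  have B0: "B \<ge> 0" using B[of "[]" 0] by simp
  define D1 where "D1 t = (\<Sum>i\<in>UNIV. z $ i * partial_deriv i g (x + t *\<^sub>R z))" for t
  define D2 where "D2 t = (\<Sum>i\<in>UNIV. z $ i * (\<Sum>j\<in>UNIV. z $ j * partial_deriv j (partial_deriv i g) (x + t *\<^sub>R z)))" for t
  define D3 where "D3 t = (\<Sum>i\<in>UNIV. z $ i * (\<Sum>j\<in>UNIV. z $ j *
      (\<Sum>k\<in>UNIV. z $ k * partial_deriv k (partial_deriv j (partial_deriv i g)) (x + t *\<^sub>R z))))" for t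
  define diff where "diff m = (if m = 0 then (\<lambda>t. g (x + t *\<^sub>R z)) else if m = 1 then D1 else if m = 2 then D2 else D3)" for m :: nat
  have d0: "((\<lambda>t. g (x + t *\<^sub>R z)) has_real_derivative D1 t) (at t)" for t
    unfolding D1_def using DERIV_along_line[of g] smooth_compact_supportD[OF g, of "[]"] by simp
  have d1: "(D1 has_real_derivative D2 t) (at t)" for t
    unfolding D1_def[abs_def] D2_def
    using DERIV_along_line[of "partial_deriv _ g"] smooth_compact_supportD[OF g, of "[_]"]
    by (intro DERIV_sum DERIV_cmult) simp
  have d2: "(D2 has_real_derivative D3 t) (at t)" for t
    unfolding D2_def[abs_def] D3_def
    using DERIV_along_line[of "partial_deriv _ (partial_deriv _ g)"] smooth_compact_supportD[OF g, of "[_, _]"]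
    by (intro DERIV_sum DERIV_cmult) simp
  have "\<exists>t>0. t < 1 \<and> g (x + 1 *\<^sub>R z) = (\<Sum>m<3. diff m 0 / fact m * 1 ^ m) + diff 3 t / fact 3 * 1 ^ 3"
  proof (rule Maclaurin)
    show "\<forall>m t. m < 3 \<and> 0 \<le> t \<and> t \<le> 1 \<longrightarrow> (diff m has_real_derivative diff (Suc m) t) (at t)"
    proof (intro allI impI)
      fix m :: nat and t :: real assume "m < 3 \<and> 0 \<le> t \<and> t \<le> 1"
      then have "m = 0 \<or> m = 1 \<or> m = 2" by linarith
      then show "(diff m has_real_derivative diff (Suc m) t) (at t)"
        using d0 d1 d2 by (auto simp: diff_def)
    qed
  qed (auto simp: diff_def)
  then obtain t where "g (x + z) = (\<Sum>m<3. diff m 0 / fact m) + D3 t / 6"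
    by (auto simp: diff_def fact_numeral)
  then have eq: "g (x + z) - g x - D1 0 - D2 0 / 2 = D3 t / 6"
    by (simp add: numeral_3_eq_3 diff_def fact_numeral)
  have "\<bar>D3 t\<bar> \<le> real CARD('d) * (norm z * (real CARD('d) * (norm z * (real CARD('d) * (norm z * B)))))"
    unfolding D3_def using B[of "[_, _, _]"] by (intro sum_component_bound) simp
  then have "\<bar>D3 t / 6\<bar> \<le> real CARD('d) ^ 3 * B * norm z ^ 3"
    by (simp add: power3_eq_cube mult_ac)
  then show ?thesis
    unfolding eq[symmetric] by (simp add: D1_def D2_def sum_distrib_left mult_ac)
qed


lemma iterated_partial_diff:
  assumes "smooth_compact_support f" "smooth_compact_support g"
  shows "iterated_partial js (\<lambda>x. f x - g x) = (\<lambda>x. iterated_partial js f x - iterated_partial js g x)"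
proof (induction js)
  case (Cons i js)
  have "partial_deriv i (\<lambda>x. iterated_partial js f x - iterated_partial js g x) x
      = partial_deriv i (iterated_partial js f) x - partial_deriv i (iterated_partial js g) x" for x
  proof -
    have "(iterated_partial js f has_derivative frechet_derivative (iterated_partial js f) (at x)) (at x)"
      "(iterated_partial js g has_derivative frechet_derivative (iterated_partial js g) (at x)) (at x)"
      using smooth_compact_supportD assms by (auto simp: frechet_derivative_works[symmetric])
    from frechet_derivative_at[OF has_derivative_diff[OF this]]
    show ?thesis by (simp add: partial_deriv_def fun_eq_iff)
  qed
  then show ?case by (simp add: Cons.IH fun_eq_iff)
qed simp

lemma smooth_compact_support_diff:
  assumes f: "smooth_compact_support f" and g: "smooth_compact_support g"
  shows "smooth_compact_support (\<lambda>x. f x - g x)"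
proof -
  have "iterated_partial js (\<lambda>x. f x - g x) differentiable (at x)" for js x
    unfolding iterated_partial_diff[OF f g]
    using smooth_compact_supportD assms by (intro differentiable_diff) auto
  moreover have "{x. f x - g x \<noteq> 0} \<subseteq> {x. f x \<noteq> 0} \<union> {x. g x \<noteq> 0}" by auto
  then have "bounded {x. f x - g x \<noteq> 0}"
    using assms unfolding smooth_compact_support_def compact_closure by (meson bounded_Un bounded_subset)
  ultimately show ?thesis
    unfolding smooth_compact_support_def compact_closure by (simp add: iterated_partial_def)
qed

lemma limit_generator_iterated:
  "limit_generator g x = a0 TYPE('d) * (\<Sum>i\<in>UNIV. iterated_partial [i, i] g (x :: real ^ 'd))"
  by (simp add: limit_generator_def laplacian_def)

lemma limit_generator_diff:
  assumes "smooth_compact_support f" "smooth_compact_support g"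
  shows "limit_generator (\<lambda>x. f x - g x) x = limit_generator f x - limit_generator g x"
  unfolding limit_generator_iterated iterated_partial_diff[OF assms]
  by (simp add: sum_subtractf right_diff_distrib)

section \<open>Dissipativity and identification of the limit resolvent\<close>

lemma integrable_continuous_vanish:
  fixes f :: "real ^ 'd \<Rightarrow> real"
  assumes "continuous_on UNIV f" "\<And>x. norm x > M \<Longrightarrow> f x = 0"
  shows "integrable lborel f"
proof -
  have "integrable lborel (\<lambda>x. indicator (cball 0 M) x *\<^sub>R f x)"
    by (rule borel_integrable_compact) (auto intro: continuous_on_subset[OF assms(1)])
  moreover have "(\<lambda>x. indicator (cball 0 M) x *\<^sub>R f x) = f"
    using assms(2) by (auto simp: fun_eq_iff indicator_def not_le)
  ultimately show ?thesis by simp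
qed

lemma integral_translate:
  fixes f :: "real ^ 'd \<Rightarrow> real"
  assumes "continuous_on UNIV f"
  shows "(LINT x|lborel. f (x + z)) = (LINT x|lborel. f x)"
proof -
  have "(LINT x|lborel. f x) = (LINT x|distr lborel borel ((+) z). f x)" by (simp add: lborel_distr_plus)
  also have "\<dots> = (LINT x|lborel. f (z + x))"
    by (rule integral_distr) (auto intro: borel_measurable_continuous_onI assms)
  finally show ?thesis by (simp add: add.commute)
qed

text \<open>Second differences are used instead of integration by parts: for them the sign is a
  consequence of translation invariance alone.\<close>
lemma integral_second_partial_nonpos:
  fixes g :: "real ^ 'd \<Rightarrow> real"
  assumes g: "smooth_compact_support g"
  shows "(LINT x|lborel. g x * partial_deriv i (partial_deriv i g) x) \<le> 0"
proof -
  obtain M where M: "M > 0" "\<And>js x. norm x > M \<Longrightarrow> iterated_partial js g x = 0"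
    by (rule smooth_compact_support_vanish[OF g]) blast
  obtain B where B: "B > 0" "\<And>js x. length js \<le> 3 \<Longrightarrow> \<bar>iterated_partial js g x\<bar> \<le> B"
    by (rule smooth_compact_support_bounded[OF g]) blast
  have g0: "g x = 0" if "norm x > M" for x using M(2)[OF that, of "[]"] by simp
  have cont: "continuous_on S (\<lambda>x. g (f x))" if "continuous_on S f" for f :: "real ^ 'd \<Rightarrow> real ^ 'd" and S
    using continuous_on_compose2[OF smooth_compact_support_continuous[OF g, of UNIV "[]"] that] by simp
  have cont': "continuous_on S g" for S using cont[of S "\<lambda>x. x"] by simp
  have cont2: "continuous_on S (partial_deriv i (partial_deriv i g))" for S
    using smooth_compact_support_continuous[OF g, of S "[i, i]"] by simp
  define C where "C = 2 * (real CARD('d) ^ 3 * B)"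
  have C: "C \<ge> 0" using B by (simp add: C_def)
  define I where "I = (LINT x|lborel. g x * partial_deriv i (partial_deriv i g) x)"
  define J where "J = (LINT x|lborel. \<bar>g x\<bar>)"
  have J: "J \<ge> 0" unfolding J_def by simp
  have main: "I \<le> C * h * J" if h: "h > 0" for h
  proof -
    define z :: "real ^ 'd" where "z = axis i h"
    have nz: "norm z = h" using h by (simp add: z_def norm_eq_sqrt_inner inner_axis_axis)
    have zi: "(\<Sum>k\<in>UNIV. z $ k * f k) = h * f i" for f :: "'d \<Rightarrow> real"
    proof -
      have "(\<Sum>k\<in>UNIV. z $ k * f k) = (\<Sum>k\<in>UNIV. if k = i then h * f i else 0)"
        by (rule sum.cong) (auto simp: z_def axis_def)
      then show ?thesis by simp
    qed
    have zz: "(\<Sum>k\<in>UNIV. \<Sum>j\<in>UNIV. z $ k * z $ j * f k j) = h ^ 2 * f i i" for f :: "'d \<Rightarrow> 'd \<Rightarrow> real"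
    proof -
      have "(\<Sum>k\<in>UNIV. \<Sum>j\<in>UNIV. z $ k * z $ j * f k j) = (\<Sum>k\<in>UNIV. z $ k * (\<Sum>j\<in>UNIV. z $ j * f k j))"
        by (simp add: sum_distrib_left mult_ac)
      then show ?thesis by (simp add: zi power2_eq_square)
    qed
    \<comment> \<open>\<open>S\<close> is \<open>g\<close> times a second difference: up to order
      h^3 it is h^2 times the integrand in question, and its integral has a sign.\<close>
    define S where "S x = g x * (g (x + z) + g (x - z) - 2 * g x)" for x
    have Sd: "\<bar>S x - h\<^sup>2 * (g x * partial_deriv i (partial_deriv i g) x)\<bar> \<le> \<bar>g x\<bar> * (C * h ^ 3)" for x
    proof -
      define P where "P = partial_deriv i (partial_deriv i g) x"
      have "\<bar>g (x + z) - g x - h * partial_deriv i g x - h ^ 2 * P / 2\<bar> \<le> real CARD('d) ^ 3 * B * h ^ 3"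
        using second_order_taylor[OF g B(2), where x = x and z = z] unfolding zz zi nz P_def by simp
      moreover have "\<bar>g (x - z) - g x + h * partial_deriv i g x - h ^ 2 * P / 2\<bar> \<le> real CARD('d) ^ 3 * B * h ^ 3"
        using second_order_taylor[OF g B(2), where x = x and z = "- z"] nz
        by (simp add: P_def sum_negf zz zi)
      ultimately have "\<bar>g (x + z) + g (x - z) - 2 * g x - h\<^sup>2 * P\<bar> \<le> C * h ^ 3"
        unfolding C_def by linarith
      then have "\<bar>g x\<bar> * \<bar>g (x + z) + g (x - z) - 2 * g x - h\<^sup>2 * P\<bar> \<le> \<bar>g x\<bar> * (C * h ^ 3)"
        by (intro mult_left_mono) auto
      then show ?thesis by (simp add: S_def P_def abs_mult[symmetric] algebra_simps)
    qed
    have i1: "integrable lborel (\<lambda>x. g x * g (x + z))" "integrable lborel (\<lambda>x. g x * g (x - z))"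
      "integrable lborel (\<lambda>x. g x * g x)" "integrable lborel (\<lambda>x. \<bar>g x\<bar>)"
      "integrable lborel (\<lambda>x. g x * partial_deriv i (partial_deriv i g) x)"
      by (rule integrable_continuous_vanish[where M = M], intro continuous_intros cont cont' cont2, simp add: g0)+
    have i2: "integrable lborel (\<lambda>x. g (x + z) * g (x + z))"
    proof (rule integrable_continuous_vanish[where M = "M + h"])
      fix x :: "real ^ 'd" assume "norm x > M + h"
      then have "norm (x + z) > M" using norm_diff_ineq[of x z] nz by simp
      then show "g (x + z) * g (x + z) = 0" by (simp add: g0)
    qed (intro continuous_intros cont)
    have e1: "(LINT x|lborel. g x * g (x - z)) = (LINT x|lborel. g x * g (x + z))"
    proof -
      have "continuous_on UNIV (\<lambda>x. g x * g (x - z))" by (intro continuous_intros cont cont')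
      from integral_translate[OF this, of z]
      have "(LINT x|lborel. g (x + z) * g x) = (LINT x|lborel. g x * g (x - z))" by simp
      moreover have "(LINT x|lborel. g (x + z) * g x) = (LINT x|lborel. g x * g (x + z))"
        by (rule Bochner_Integration.integral_cong) (simp_all add: mult.commute)
      ultimately show ?thesis by simp
    qed
    have e2: "(LINT x|lborel. g (x + z) * g (x + z)) = (LINT x|lborel. g x * g x)"
      by (rule integral_translate[of "\<lambda>x. g x * g x" z]) (intro continuous_intros cont')
    have S_eq: "S = (\<lambda>x. g x * g (x + z) + g x * g (x - z) - 2 * (g x * g x))"
      by (auto simp: S_def fun_eq_iff algebra_simps)
    have iS: "integrable lborel S" unfolding S_eq using i1 by auto
    \<comment> \<open>By translation invariance the integral of the squared first difference is
      exactly minus the integral of \<open>S\<close>.\<close>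
    have "0 \<le> (LINT x|lborel. (g (x + z) - g x)\<^sup>2)" by simp
    also have "\<dots> = (LINT x|lborel. g (x + z) * g (x + z) + g x * g x - 2 * (g x * g (x + z)))"
      by (rule Bochner_Integration.integral_cong) (auto simp: power2_eq_square algebra_simps)
    also have "\<dots> = (LINT x|lborel. g (x + z) * g (x + z)) + (LINT x|lborel. g x * g x) - 2 * (LINT x|lborel. g x * g (x + z))"
      using i1 i2 by simp
    also have "\<dots> = - (LINT x|lborel. S x)"
      unfolding S_eq using i1 by (simp add: e1 e2)
    finally have S0: "(LINT x|lborel. S x) \<le> 0" by simp
    have "(LINT x|lborel. h\<^sup>2 * (g x * partial_deriv i (partial_deriv i g) x)) \<le> (LINT x|lborel. S x + (C * h ^ 3) * \<bar>g x\<bar>)"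
      using Sd by (intro integral_mono Bochner_Integration.integrable_add integrable_mult_right iS i1)
        (auto simp: abs_le_iff mult.commute algebra_simps)
    then have "h\<^sup>2 * I \<le> (LINT x|lborel. S x) + C * h ^ 3 * J"
      using iS i1 by (simp add: I_def J_def)
    moreover have "C * h ^ 3 * J = h\<^sup>2 * (C * h * J)" by (simp add: power2_eq_square power3_eq_cube)
    ultimately have "h\<^sup>2 * I \<le> h\<^sup>2 * (C * h * J)" using S0 by linarith
    then show ?thesis using h by simp
  qed
  have "I \<le> 0"
  proof (rule ccontr)
    assume "\<not> I \<le> 0"
    then have I: "I > 0" by simp
    define c where "c = C * J + 1"
    \<comment> \<open>With this step width \<open>main\<close> would give
      \<open>I \<le> I / 2\<close>.\<close>
    define h where "h = I / (2 * c)"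
    have "C * J \<ge> 0" using C J by simp
    then have c: "c > 0" by (simp add: c_def)
    have h: "h > 0" unfolding h_def using I c by simp
    have "I \<le> (C * J) * h" using main[OF h] by (simp add: mult_ac)
    also have "\<dots> \<le> c * h" unfolding c_def using h by simp
    also have "\<dots> = I / 2" using c by (simp add: h_def)
    finally show False using I by simp
  qed
  then show ?thesis by (simp add: I_def)
qed


lemma smooth_square_integrable:
  assumes g: "smooth_compact_support g"
  shows "square_integrable_fun lborel g" "square_integrable_fun lborel (limit_generator g)"
    and smooth_limit_generator_continuous: "continuous_on UNIV (limit_generator g)"
proof -
  obtain M where M: "M > 0" "\<And>js x. norm x > M \<Longrightarrow> iterated_partial js g x = 0"
    by (rule smooth_compact_support_vanish[OF g]) blast
  note cont = smooth_compact_support_continuous[OF g, of UNIV]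
  show c: "continuous_on UNIV (limit_generator g)"
    unfolding limit_generator_iterated[abs_def] by (intro continuous_intros cont)
  have "continuous_on UNIV g" using cont[of "[]"] by simp
  then show "square_integrable_fun lborel g"
    unfolding square_integrable_fun_def using M(2)[of _ "[]"]
    by (auto intro!: integrable_continuous_vanish[where M = M] continuous_intros borel_measurable_continuous_onI)
  show "square_integrable_fun lborel (limit_generator g)"
    unfolding square_integrable_fun_def using c M(2)[of _ "[_, _]"]
    by (auto intro!: integrable_continuous_vanish[where M = M] continuous_intros borel_measurable_continuous_onI
        simp: limit_generator_iterated simp del: iterated_partial_simps)
qed

lemma nn_integral_square_eq:
  assumes "square_integrable_fun M f"
  shows "(\<integral>\<^sup>+x. ennreal ((f x)\<^sup>2) \<partial>M) = ennreal (LINT x|M. (f x)\<^sup>2)"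
  using assms by (intro nn_integral_eq_integral) (auto simp: square_integrable_fun_def)

text \<open>Testing with \<open>g\<close>: since \<open>a0\<close> is non-negative, the generator
  contributes with a favourable sign, and Young's inequality absorbs half of the term with
  \<open>l\<close>.\<close>

lemma limit_resolvent_estimate:
  fixes g :: "real ^ 'd \<Rightarrow> real"
  assumes g: "smooth_compact_support g" and l: "l > 0" and a0: "a0 TYPE('d) \<ge> 0"
  shows "(\<integral>\<^sup>+x. ennreal ((g x)\<^sup>2) \<partial>lborel)
    \<le> ennreal (1 / l\<^sup>2) * (\<integral>\<^sup>+x. ennreal ((l * g x - limit_generator g x)\<^sup>2) \<partial>lborel)"
proof -
  obtain M where M: "M > 0" "\<And>js x. norm x > M \<Longrightarrow> iterated_partial js g x = 0"
    by (rule smooth_compact_support_vanish[OF g]) blast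
  note cont = smooth_compact_support_continuous[OF g, of UNIV]
  have contg: "continuous_on UNIV g" using cont[of "[]"] by simp
  have g0: "g x = 0" if "norm x > M" for x using M(2)[OF that, of "[]"] by simp
  define f where "f x = l * g x - limit_generator g x" for x
  have contf: "continuous_on UNIV f" unfolding f_def
    by (intro continuous_intros contg smooth_limit_generator_continuous g)
  have f0: "f x = 0" if "norm x > M" for x
    unfolding f_def limit_generator_iterated using M(2)[OF that] g0[OF that] by (simp del: iterated_partial_simps)
  have i1: "integrable lborel (\<lambda>x. (g x)\<^sup>2)" "integrable lborel (\<lambda>x. (f x)\<^sup>2)" "integrable lborel (\<lambda>x. g x * f x)"
    by (rule integrable_continuous_vanish[where M = M], intro continuous_intros contf contg, simp add: g0 f0)+
  have i2: "integrable lborel (\<lambda>x. g x * iterated_partial [i, i] g x)" for i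
    by (rule integrable_continuous_vanish[where M = M], intro continuous_intros cont contg, simp add: g0)
  have "(LINT x|lborel. g x * f x) = (LINT x|lborel. l * (g x)\<^sup>2 - a0 TYPE('d) * (\<Sum>i\<in>UNIV. g x * iterated_partial [i, i] g x))"
    by (rule Bochner_Integration.integral_cong)
       (simp_all add: f_def limit_generator_iterated power2_eq_square algebra_simps sum_distrib_left del: iterated_partial_simps)
  also have "\<dots> = l * (LINT x|lborel. (g x)\<^sup>2) - a0 TYPE('d) * (\<Sum>i\<in>UNIV. (LINT x|lborel. g x * iterated_partial [i, i] g x))"
    using i1 i2 by (simp del: iterated_partial_simps)
  also have "\<dots> \<ge> l * (LINT x|lborel. (g x)\<^sup>2)"
    using mult_nonneg_nonpos[OF a0 sum_nonpos[of UNIV, OF integral_second_partial_nonpos[OF g]]] by simp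
  finally have 1: "l * (LINT x|lborel. (g x)\<^sup>2) \<le> (LINT x|lborel. g x * f x)" .
  have "(LINT x|lborel. g x * f x) \<le> (LINT x|lborel. (l / 2) * (g x)\<^sup>2 + (1 / (2 * l)) * (f x)\<^sup>2)"
  proof (rule integral_mono)
    fix x
    have "0 \<le> (l * g x - f x)\<^sup>2" by simp
    then have "2 * l * (g x * f x) \<le> l\<^sup>2 * (g x)\<^sup>2 + (f x)\<^sup>2" by (simp add: power2_diff power_mult_distrib)
    then show "g x * f x \<le> (l / 2) * (g x)\<^sup>2 + (1 / (2 * l)) * (f x)\<^sup>2"
      using l by (simp add: field_simps power2_eq_square)
  qed (use i1 in auto)
  also have "\<dots> = (l / 2) * (LINT x|lborel. (g x)\<^sup>2) + (1 / (2 * l)) * (LINT x|lborel. (f x)\<^sup>2)"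
    using i1 by simp
  finally have "l * (LINT x|lborel. (g x)\<^sup>2) \<le> (1 / l) * (LINT x|lborel. (f x)\<^sup>2)" using 1 by simp
  then have "(LINT x|lborel. (g x)\<^sup>2) \<le> (1 / l\<^sup>2) * (LINT x|lborel. (f x)\<^sup>2)"
    using l by (simp add: field_simps power2_eq_square)
  then have "ennreal (LINT x|lborel. (g x)\<^sup>2) \<le> ennreal (1 / l\<^sup>2) * ennreal (LINT x|lborel. (f x)\<^sup>2)"
    by (simp add: ennreal_mult[symmetric])
  moreover have "(\<integral>\<^sup>+x. ennreal ((g x)\<^sup>2) \<partial>lborel) = ennreal (LINT x|lborel. (g x)\<^sup>2)"
    "(\<integral>\<^sup>+x. ennreal ((f x)\<^sup>2) \<partial>lborel) = ennreal (LINT x|lborel. (f x)\<^sup>2)"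
    using i1 by (auto intro!: nn_integral_eq_integral)
  ultimately show ?thesis by (simp add: f_def)
qed

lemma L2_norm_lessD:
  assumes "L2_norm M f < ennreal e"
  shows "square_integrable_fun M f" "(\<integral>\<^sup>+x. ennreal ((f x)\<^sup>2) \<partial>M) \<le> ennreal (e\<^sup>2)"
proof -
  show s: "square_integrable_fun M f" using assms by (auto simp: L2_norm_def split: if_splits)
  then have "ennreal (sqrt (LINT x|M. (f x)\<^sup>2)) < ennreal e" using assms by (simp add: L2_norm_def)
  then have le: "sqrt (LINT x|M. (f x)\<^sup>2) < e" by (simp add: ennreal_less_iff)
  then have "(LINT x|M. (f x)\<^sup>2) \<le> e\<^sup>2" by (intro sqrt_le_D) simp
  then show "(\<integral>\<^sup>+x. ennreal ((f x)\<^sup>2) \<partial>M) \<le> ennreal (e\<^sup>2)"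
    by (simp add: nn_integral_square_eq[OF s])
qed

lemma nn_integral_square_add_le:
  fixes f g :: "'a \<Rightarrow> real"
  assumes [measurable]: "f \<in> borel_measurable M" "g \<in> borel_measurable M"
  shows "(\<integral>\<^sup>+x. ennreal ((f x + g x)\<^sup>2) \<partial>M)
    \<le> 2 * (\<integral>\<^sup>+x. ennreal ((f x)\<^sup>2) \<partial>M) + 2 * (\<integral>\<^sup>+x. ennreal ((g x)\<^sup>2) \<partial>M)"
proof -
  have "ennreal ((f x + g x)\<^sup>2) \<le> 2 * ennreal ((f x)\<^sup>2) + 2 * ennreal ((g x)\<^sup>2)" for x
  proof -
    have "(f x + g x)\<^sup>2 \<le> 2 * (f x)\<^sup>2 + 2 * (g x)\<^sup>2"
      using zero_le_power2[of "f x - g x"] by (simp add: power2_diff power2_sum)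
    then have "ennreal ((f x + g x)\<^sup>2) \<le> ennreal (2 * (f x)\<^sup>2 + 2 * (g x)\<^sup>2)" by (rule ennreal_leI)
    also have "\<dots> = 2 * ennreal ((f x)\<^sup>2) + 2 * ennreal ((g x)\<^sup>2)" by (simp add: ennreal_mult)
    finally show ?thesis .
  qed
  then have "(\<integral>\<^sup>+x. ennreal ((f x + g x)\<^sup>2) \<partial>M) \<le> (\<integral>\<^sup>+x. 2 * ennreal ((f x)\<^sup>2) + 2 * ennreal ((g x)\<^sup>2) \<partial>M)"
    by (intro nn_integral_mono)
  also have "\<dots> = 2 * (\<integral>\<^sup>+x. ennreal ((f x)\<^sup>2) \<partial>M) + 2 * (\<integral>\<^sup>+x. ennreal ((g x)\<^sup>2) \<partial>M)"
    by (simp add: nn_integral_add nn_integral_cmult)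
  finally show ?thesis .
qed

text \<open>\<open>limit_resolvent\<close> is an arbitrary choice, so every solution in the graph
  has to agree with \<open>g\<close>. A competitor is approximated by smooth \<open>G n\<close>; the
  a priori estimate applies to \<open>G n - g\<close> and forces equality in the limit.\<close>

lemma limit_resolvent_eq:
  fixes g :: "real ^ 'd \<Rightarrow> real"
  assumes g: "smooth_compact_support g" and l: "l > 0" and a0: "a0 TYPE('d) \<ge> 0"
    and f: "f = (\<lambda>x. l * g x - limit_generator g x)"
  shows "square_integrable_fun lborel (limit_resolvent l f)" "AE x in lborel. limit_resolvent l f x = g x"
proof -
  \<comment> \<open>The constant sequence puts \<open>g\<close> into the closure, so the choice
    ranges over a non-empty set.\<close>
  have "(g, limit_generator g) \<in> limit_generator_graph"
    unfolding limit_generator_graph_def using smooth_square_integrable[OF g] g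
    by (auto intro!: exI[of _ "\<lambda>_. g"] simp: L2_norm_def square_integrable_fun_def)
  then have "\<exists>u v. (u, v) \<in> limit_generator_graph \<and> (AE x in lborel. l * u x - v x = f x)"
    by (intro exI[of _ g] exI[of _ "limit_generator g"]) (simp add: f)
  from someI_ex[OF this] obtain v where uv: "(limit_resolvent l f, v) \<in> limit_generator_graph"
    and eq: "AE x in lborel. l * limit_resolvent l f x - v x = f x"
    unfolding limit_resolvent_def[symmetric] by blast
  define u where "u = limit_resolvent l f"
  have u: "square_integrable_fun lborel u" and v: "square_integrable_fun lborel v"
    using uv by (auto simp: limit_generator_graph_def u_def)
  obtain G where G: "\<And>n::nat. smooth_compact_support (G n)"
    "(\<lambda>n. L2_norm lborel (\<lambda>x. G n x - u x)) \<longlonglongrightarrow> 0"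
    "(\<lambda>n. L2_norm lborel (\<lambda>x. limit_generator (G n) x - v x)) \<longlonglongrightarrow> 0"
    using uv by (auto simp: limit_generator_graph_def u_def)
  show "square_integrable_fun lborel (limit_resolvent l f)" using u by (simp add: u_def)
  have [measurable]: "u \<in> borel_measurable lborel" "v \<in> borel_measurable lborel" "g \<in> borel_measurable lborel"
    "limit_generator g \<in> borel_measurable lborel"
    using u v smooth_square_integrable[OF g] by (auto simp: square_integrable_fun_def)
  have [measurable]: "G n \<in> borel_measurable lborel" "limit_generator (G n) \<in> borel_measurable lborel" for n
    using smooth_square_integrable[OF G(1)] by (auto simp: square_integrable_fun_def)
  define Q where "Q h = (\<integral>\<^sup>+x. ennreal ((h x)\<^sup>2) \<partial>lborel)" for h :: "real ^ 'd \<Rightarrow> real"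
  have Qcong: "Q h = Q h'" if "AE x in lborel. h x = h' x" for h h'
    unfolding Q_def by (rule nn_integral_cong_AE) (use that in auto)
  have Qmult: "Q (\<lambda>x. c * h x) = ennreal (c\<^sup>2) * Q h" if [measurable]: "h \<in> borel_measurable lborel" for c h
    unfolding Q_def by (simp add: power_mult_distrib ennreal_mult nn_integral_cmult)
  have Qneg: "Q (\<lambda>x. - h x) = Q h" for h unfolding Q_def by simp
  \<comment> \<open>From two uses of (a + b)^2 <= 2 a^2 + 2 b^2: twice the bound of
    \<open>Q p\<close>, which is 2 (l^2 + 1) / l^2 in units of e^2, plus 2 for
    \<open>G n - u\<close>.\<close>
  define c where "c = 2 + 4 * (1 / l\<^sup>2) * (l\<^sup>2 + 1)"
  have c: "c > 0" unfolding c_def by (intro add_pos_nonneg) auto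
  have bound: "Q (\<lambda>x. u x - g x) \<le> ennreal (c * e\<^sup>2)" if e: "e > 0" for e
  proof -
    have "\<forall>\<^sub>F n in sequentially. L2_norm lborel (\<lambda>x. G n x - u x) < ennreal e"
      "\<forall>\<^sub>F n in sequentially. L2_norm lborel (\<lambda>x. limit_generator (G n) x - v x) < ennreal e"
      using order_tendstoD(2)[OF G(2), of "ennreal e"] order_tendstoD(2)[OF G(3), of "ennreal e"] e by auto
    then have "\<forall>\<^sub>F n in sequentially. L2_norm lborel (\<lambda>x. G n x - u x) < ennreal e \<and>
       L2_norm lborel (\<lambda>x. limit_generator (G n) x - v x) < ennreal e" by (rule eventually_conj)
    then obtain n where "L2_norm lborel (\<lambda>x. G n x - u x) < ennreal e"
       "L2_norm lborel (\<lambda>x. limit_generator (G n) x - v x) < ennreal e"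
      by (auto simp: eventually_sequentially)
    from L2_norm_lessD(2)[OF this(1)] L2_norm_lessD(2)[OF this(2)]
    have q: "Q (\<lambda>x. G n x - u x) \<le> ennreal (e\<^sup>2)" "Q (\<lambda>x. limit_generator (G n) x - v x) \<le> ennreal (e\<^sup>2)"
      by (simp_all add: Q_def)
    define p where "p x = G n x - g x" for x
    have [measurable]: "p \<in> borel_measurable lborel" unfolding p_def by measurable
    have p: "smooth_compact_support p" unfolding p_def by (rule smooth_compact_support_diff[OF G(1) g])
    have "Q p \<le> ennreal (1 / l\<^sup>2) * Q (\<lambda>x. l * p x - limit_generator p x)"
      using limit_resolvent_estimate[OF p l a0] by (simp add: Q_def)
    \<comment> \<open>The equation for \<open>u\<close> holds only almost everywhere, hence
      \<open>Qcong\<close>; it replaces the right-hand side of the equation for \<open>g\<close> by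
      \<open>l * u x - v x\<close>.\<close>
    also have "Q (\<lambda>x. l * p x - limit_generator p x)
        = Q (\<lambda>x. l * (G n x - u x) + - (limit_generator (G n) x - v x))"
    proof (rule Qcong)
      show "AE x in lborel. l * p x - limit_generator p x = l * (G n x - u x) + - (limit_generator (G n) x - v x)"
        using eq by eventually_elim
          (simp add: p_def[abs_def] limit_generator_diff[OF G(1) g] f u_def algebra_simps)
    qed
    also have "\<dots> \<le> 2 * Q (\<lambda>x. l * (G n x - u x)) + 2 * Q (\<lambda>x. - (limit_generator (G n) x - v x))"
      unfolding Q_def by (rule nn_integral_square_add_le) measurable
    also have "\<dots> = 2 * (ennreal (l\<^sup>2) * Q (\<lambda>x. G n x - u x)) + 2 * Q (\<lambda>x. limit_generator (G n) x - v x)"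
      by (subst Qmult, measurable) (simp add: Qneg[of "\<lambda>x. limit_generator (G n) x - v x", simplified])
    also have "\<dots> \<le> 2 * (ennreal (l\<^sup>2) * ennreal (e\<^sup>2)) + 2 * ennreal (e\<^sup>2)"
      by (intro add_mono mult_left_mono q) auto
    also have "\<dots> = ennreal (2 * (l\<^sup>2 + 1) * e\<^sup>2)"
      by (simp add: ennreal_mult[symmetric] ennreal_plus[symmetric] algebra_simps del: ennreal_plus
          flip: ennreal_numeral)
    finally have "Q p \<le> ennreal (1 / l\<^sup>2) * ennreal (2 * (l\<^sup>2 + 1) * e\<^sup>2)"
      by (simp add: mult_left_mono)
    also have "\<dots> = ennreal (1 / l\<^sup>2 * (2 * (l\<^sup>2 + 1) * e\<^sup>2))" by (rule ennreal_mult[symmetric]) auto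
    finally have Qp: "Q p \<le> ennreal (1 / l\<^sup>2 * (2 * (l\<^sup>2 + 1) * e\<^sup>2))" .
    have "Q (\<lambda>x. u x - g x) = Q (\<lambda>x. p x + - (G n x - u x))" by (simp add: p_def)
    also have "\<dots> \<le> 2 * Q p + 2 * Q (\<lambda>x. - (G n x - u x))"
      unfolding Q_def by (rule nn_integral_square_add_le) measurable
    also have "\<dots> \<le> 2 * ennreal (1 / l\<^sup>2 * (2 * (l\<^sup>2 + 1) * e\<^sup>2)) + 2 * ennreal (e\<^sup>2)"
      unfolding Qneg by (intro add_mono mult_left_mono q Qp) auto
    also have "\<dots> = ennreal (c * e\<^sup>2)"
    proof -
      have "2 * ennreal (1 / l\<^sup>2 * (2 * (l\<^sup>2 + 1) * e\<^sup>2)) + 2 * ennreal (e\<^sup>2)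
          = ennreal (2 * (1 / l\<^sup>2 * (2 * (l\<^sup>2 + 1) * e\<^sup>2)) + 2 * e\<^sup>2)"
        by (simp add: ennreal_mult[symmetric] ennreal_plus[symmetric] del: ennreal_plus flip: ennreal_numeral)
      also have "2 * (1 / l\<^sup>2 * (2 * (l\<^sup>2 + 1) * e\<^sup>2)) + 2 * e\<^sup>2 = c * e\<^sup>2"
        unfolding c_def using l by (simp add: field_simps)
      finally show ?thesis .
    qed
    finally show ?thesis .
  qed
  have "Q (\<lambda>x. u x - g x) \<le> 0"
  proof (rule ennreal_le_epsilon)
    fix e :: real assume e: "e > 0"
    show "Q (\<lambda>x. u x - g x) \<le> 0 + ennreal e"
      using bound[of "sqrt (e / c)"] e c by simp
  qed
  then have "Q (\<lambda>x. u x - g x) = 0" by simp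
  then have "AE x in lborel. ennreal ((u x - g x)\<^sup>2) = 0"
    unfolding Q_def by (subst (asm) nn_integral_0_iff_AE) auto
  then show "AE x in lborel. limit_resolvent l f x = g x"
    by eventually_elim (simp add: u_def)
qed

section \<open>Consistency and energy estimates\<close>

text \<open>Three norm preserving involutions of the lattice are fed in below: point reflection,
  reflection of one coordinate and exchange of two coordinates. They settle the first and second
  moments of the kernel.\<close>

lemma sum_lattice_annulus_reindex:
  fixes f :: "real ^ 'd \<Rightarrow> real"
  assumes "\<And>z. T (T z) = z" "\<And>z. norm (T z) = norm z" "\<And>z. z \<in> int_lattice \<Longrightarrow> T z \<in> int_lattice"
  shows "(\<Sum>z\<in>lattice_annulus a b. f (T z)) = (\<Sum>z\<in>lattice_annulus a b. f z)"
  by (rule sum.reindex_bij_witness[of _ T T]) (use assms in \<open>auto simp: lattice_annulus_def\<close>)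

lemma lattice_annulus_first_moment:
  "(\<Sum>z\<in>(lattice_annulus a b :: (real ^ 'd) set). jump_kernel z * z $ i) = 0"
proof -
  have "(\<Sum>z\<in>(lattice_annulus a b :: (real ^ 'd) set). jump_kernel (- z) * (- z) $ i)
      = (\<Sum>z\<in>lattice_annulus a b. jump_kernel z * z $ i)"
    by (rule sum_lattice_annulus_reindex) (auto intro: int_lattice_uminus)
  then show ?thesis by (simp add: sum_negf)
qed

lemma lattice_annulus_mixed_moment:
  assumes "i \<noteq> j"
  shows "(\<Sum>z\<in>(lattice_annulus a b :: (real ^ 'd) set). jump_kernel z * (z $ i * z $ j)) = 0"
proof -
  define T where "T z = (\<chi> k. if k = i then - z $ k else z $ k)" for z :: "real ^ 'd"
  have n: "norm (T z) = norm z" for z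
    unfolding norm_vec_def T_def by (rule arg_cong[of _ _ "\<lambda>f. L2_set f UNIV"]) auto
  have "(\<Sum>z\<in>lattice_annulus a b. jump_kernel (T z) * (T z $ i * T z $ j))
      = (\<Sum>z\<in>lattice_annulus a b. jump_kernel z * (z $ i * z $ j))"
    by (rule sum_lattice_annulus_reindex[OF _ n]) (auto simp: T_def vec_eq_iff int_lattice_def)
  moreover have "jump_kernel (T z) = jump_kernel z" for z by (simp add: jump_kernel_def n)
  moreover have "T z $ i = - z $ i" "T z $ j = z $ j" for z using assms by (auto simp: T_def)
  ultimately show ?thesis by (simp add: sum_negf)
qed

lemma lattice_annulus_square_moment_eq:
  "(\<Sum>z\<in>(lattice_annulus a b :: (real ^ 'd) set). jump_kernel z * (z $ i)\<^sup>2)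
    = (\<Sum>z\<in>(lattice_annulus a b :: (real ^ 'd) set). jump_kernel z * (z $ j)\<^sup>2)"
proof -
  define T where "T z = (\<chi> k. z $ (Transposition.transpose i j k))" for z :: "real ^ 'd"
  have n: "norm (T z) = norm z" for z
  proof -
    have "(\<Sum>k\<in>UNIV. (z $ (Transposition.transpose i j k))\<^sup>2) = (\<Sum>k\<in>UNIV. (z $ k)\<^sup>2)"
      by (rule sum.reindex_bij_betw) (rule bij_transpose)
    then show ?thesis by (simp add: norm_vec_def L2_set_def T_def)
  qed
  have "(\<Sum>z\<in>lattice_annulus a b. jump_kernel (T z) * (T z $ j)\<^sup>2)
      = (\<Sum>z\<in>lattice_annulus a b. jump_kernel z * (z $ j)\<^sup>2)"
    by (rule sum_lattice_annulus_reindex[OF _ n]) (auto simp: T_def vec_eq_iff int_lattice_def)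
  moreover have "jump_kernel (T z) = jump_kernel z" for z by (simp add: jump_kernel_def n)
  moreover have "T z $ j = z $ i" for z by (simp add: T_def)
  ultimately show ?thesis by simp
qed

lemma jump_kernel_times_square:
  assumes "z \<noteq> (0 :: real ^ 'd)"
  shows "jump_kernel z * (norm z)\<^sup>2 = 1 / norm z ^ CARD('d)"
  using assms by (simp add: jump_kernel_def power_add power2_eq_square)

lemma norm_square_components: "(norm (z :: real ^ 'd))\<^sup>2 = (\<Sum>i\<in>UNIV. (z $ i)\<^sup>2)"
  by (simp add: norm_vec_def L2_set_def sum_nonneg)

lemma lattice_annulus_square_moment:
  "(\<Sum>z\<in>(lattice_annulus 0 b :: (real ^ 'd) set). jump_kernel z * (z $ i)\<^sup>2)
    = (\<Sum>z\<in>(lattice_annulus 0 b :: (real ^ 'd) set). 1 / norm z ^ CARD('d)) / real CARD('d)"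
proof -
  have "(\<Sum>z\<in>(lattice_annulus 0 b :: (real ^ 'd) set). 1 / norm z ^ CARD('d))
      = (\<Sum>z\<in>(lattice_annulus 0 b :: (real ^ 'd) set). \<Sum>j\<in>UNIV. jump_kernel z * (z $ j)\<^sup>2)"
    by (rule sum.cong[OF refl])
       (auto simp: lattice_annulus_def jump_kernel_times_square[symmetric] norm_square_components sum_distrib_left)
  also have "\<dots> = (\<Sum>j\<in>UNIV. \<Sum>z\<in>(lattice_annulus 0 b :: (real ^ 'd) set). jump_kernel z * (z $ j)\<^sup>2)"
    by (rule sum.swap)
  also have "\<dots> = (\<Sum>j\<in>(UNIV :: 'd set). \<Sum>z\<in>(lattice_annulus 0 b :: (real ^ 'd) set). jump_kernel z * (z $ i)\<^sup>2)"
    by (rule sum.cong[OF refl lattice_annulus_square_moment_eq])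
  finally show ?thesis by simp
qed

text \<open>By the lattice symmetries only the trace of \<open>h\<close> survives, with one factor
  for all directions; this is why the limit is a multiple of the Laplacian. Together with Taylor's
  1/2 it explains the 2 d in \<open>a0\<close>.\<close>

lemma lattice_annulus_second_moment:
  "(\<Sum>z\<in>(lattice_annulus 0 b :: (real ^ 'd) set). jump_kernel z * (\<Sum>i\<in>UNIV. \<Sum>j\<in>UNIV. z $ i * z $ j * h i j))
    = (\<Sum>z\<in>(lattice_annulus 0 b :: (real ^ 'd) set). 1 / norm z ^ CARD('d)) / real CARD('d) * (\<Sum>i\<in>UNIV. h i i)"
  (is "_ = ?S * _")
proof -
  have "(\<Sum>z\<in>(lattice_annulus 0 b :: (real ^ 'd) set). jump_kernel z * (\<Sum>i\<in>UNIV. \<Sum>j\<in>UNIV. z $ i * z $ j * h i j))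
      = (\<Sum>z\<in>(lattice_annulus 0 b :: (real ^ 'd) set). \<Sum>i\<in>UNIV. \<Sum>j\<in>UNIV. h i j * (jump_kernel z * (z $ i * z $ j)))"
    by (simp add: sum_distrib_left mult_ac)
  also have "\<dots> = (\<Sum>i\<in>UNIV. \<Sum>z\<in>(lattice_annulus 0 b :: (real ^ 'd) set). \<Sum>j\<in>UNIV. h i j * (jump_kernel z * (z $ i * z $ j)))"
    by (rule sum.swap)
  also have "\<dots> = (\<Sum>i\<in>UNIV. \<Sum>j\<in>UNIV. \<Sum>z\<in>(lattice_annulus 0 b :: (real ^ 'd) set). h i j * (jump_kernel z * (z $ i * z $ j)))"
    by (intro sum.cong refl sum.swap)
  also have "\<dots> = (\<Sum>i\<in>UNIV. \<Sum>j\<in>UNIV. if j = i then h i i * ?S else 0)"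
  proof (intro sum.cong refl)
    fix i j :: 'd
    show "(\<Sum>z\<in>(lattice_annulus 0 b :: (real ^ 'd) set). h i j * (jump_kernel z * (z $ i * z $ j)))
        = (if j = i then h i i * ?S else 0)"
      using lattice_annulus_mixed_moment[where i = i and j = j and a = 0 and b = b] lattice_annulus_square_moment[where i = i and b = b]
      unfolding sum_distrib_left[symmetric] power2_eq_square by auto
  qed
  also have "\<dots> = (\<Sum>i\<in>UNIV. h i i * ?S)" by simp
  also have "\<dots> = ?S * (\<Sum>i\<in>UNIV. h i i)" by (simp only: sum_distrib_right[symmetric] mult.commute)
  finally show ?thesis .
qed

text \<open>Conductances 1 and jumps of scaled length at most 1. First moments cancel, the second
  moments give \<open>a0\<close> times the Laplacian with error O(1/ln k), and the cubic remainder
  contributes k^2 / ln k times k^-3 times k, which is of the same order.\<close>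

lemma homogeneous_near_generator:
  fixes g :: "real ^ 'd \<Rightarrow> real"
  assumes g: "smooth_compact_support g"
  obtains C where "C > 0" "\<And>k x. k \<ge> 2 \<Longrightarrow>
     \<bar>real k ^ 2 / ln (real k) * (\<Sum>z\<in>lattice_annulus 0 (real k). jump_kernel z * (g (x + z /\<^sub>R real k) - g x))
       - limit_generator g x\<bar> \<le> C / ln (real k)"
proof -
  define d where "d = real CARD('d)"
  have d: "d > 0" by (simp add: d_def)
  obtain B where B: "B > 0" "\<And>js x. length js \<le> 3 \<Longrightarrow> \<bar>iterated_partial js g x\<bar> \<le> B"
    by (rule smooth_compact_support_bounded[OF g]) blast
  obtain A where A: "A > 0"
    "\<And>k. (\<Sum>z\<in>(lattice_annulus 0 (real k) :: (real ^ 'd) set). 1 / norm z ^ (CARD('d) - 1)) \<le> A * real k"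
    using lattice_power_sum_linear by blast
  obtain C where C: "C > 0"
    "\<And>k. k \<ge> 2 \<Longrightarrow> \<bar>(\<Sum>z\<in>(lattice_annulus 0 (real k) :: (real ^ 'd) set). 1 / norm z ^ CARD('d))
          / (2 * real CARD('d) * ln (real k)) - a0 TYPE('d)\<bar> \<le> C / ln (real k)"
    using a0_asymp by blast
  show ?thesis
  proof (rule that[of "d ^ 3 * B * A + C * (d * B)"])
    show "d ^ 3 * B * A + C * (d * B) > 0" using d A B C by (simp add: add_pos_pos)
    fix k :: nat and x :: "real ^ 'd" assume k: "k \<ge> 2"
    have l: "ln (real k) > 0" and k0: "real k > 0" using k by auto
    define S where "S = (\<Sum>z\<in>(lattice_annulus 0 (real k) :: (real ^ 'd) set). 1 / norm z ^ CARD('d))"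
    define P1 where "P1 z = (\<Sum>i\<in>UNIV. z $ i * partial_deriv i g x)" for z :: "real ^ 'd"
    define P2 where "P2 z = (\<Sum>i\<in>UNIV. \<Sum>j\<in>UNIV. z $ i * z $ j * partial_deriv j (partial_deriv i g) x)" for z :: "real ^ 'd"
    define r where "r z = g (x + z /\<^sub>R real k) - g x - P1 z / real k - P2 z / (2 * real k ^ 2)" for z :: "real ^ 'd"
    have r: "\<bar>r z\<bar> \<le> d ^ 3 * B * (norm z ^ 3 / real k ^ 3)" for z
    proof -
      have "P1 (z /\<^sub>R real k) = P1 z / real k"
        by (simp add: P1_def sum_distrib_left divide_inverse mult_ac)
      moreover have "P2 (z /\<^sub>R real k) = P2 z / real k ^ 2"
        by (simp add: P2_def sum_distrib_left divide_inverse mult_ac power2_eq_square)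
      moreover have "norm (z /\<^sub>R real k) = norm z / real k" by (simp add: divide_inverse_commute)
      ultimately show ?thesis
        using second_order_taylor[OF g B(2), of x "z /\<^sub>R real k"]
        by (simp add: r_def P1_def P2_def d_def power_divide)
    qed
    have "(\<Sum>z\<in>lattice_annulus 0 (real k). jump_kernel z * (g (x + z /\<^sub>R real k) - g x))
        = (\<Sum>z\<in>lattice_annulus 0 (real k). jump_kernel z * P1 z) / real k
        + (\<Sum>z\<in>lattice_annulus 0 (real k). jump_kernel z * P2 z) / (2 * real k ^ 2)
        + (\<Sum>z\<in>lattice_annulus 0 (real k). jump_kernel z * r z)"
      by (simp add: r_def sum_divide_distrib sum.distrib[symmetric] right_diff_distrib algebra_simps)
    also have "(\<Sum>z\<in>lattice_annulus 0 (real k). jump_kernel z * P1 z) = 0"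
    proof -
      have "(\<Sum>z\<in>lattice_annulus 0 (real k). jump_kernel z * P1 z)
          = (\<Sum>z\<in>lattice_annulus 0 (real k). \<Sum>i\<in>UNIV. partial_deriv i g x * (jump_kernel z * z $ i))"
        by (simp add: P1_def sum_distrib_left mult_ac)
      also have "\<dots> = (\<Sum>i\<in>UNIV. \<Sum>z\<in>lattice_annulus 0 (real k). partial_deriv i g x * (jump_kernel z * z $ i))"
        by (rule sum.swap)
      finally show ?thesis by (simp add: sum_distrib_left[symmetric] lattice_annulus_first_moment)
    qed
    also have "(\<Sum>z\<in>lattice_annulus 0 (real k). jump_kernel z * P2 z) = S / d * laplacian g x"
      unfolding P2_def lattice_annulus_second_moment laplacian_def S_def d_def ..
    finally have split: "(\<Sum>z\<in>lattice_annulus 0 (real k). jump_kernel z * (g (x + z /\<^sub>R real k) - g x))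
        = S / d * laplacian g x / (2 * real k ^ 2) + (\<Sum>z\<in>lattice_annulus 0 (real k). jump_kernel z * r z)" by simp
    have eq: "real k ^ 2 / ln (real k) * (\<Sum>z\<in>lattice_annulus 0 (real k). jump_kernel z * (g (x + z /\<^sub>R real k) - g x))
       - limit_generator g x
       = (S / (2 * d * ln (real k)) - a0 TYPE('d)) * laplacian g x
         + real k ^ 2 / ln (real k) * (\<Sum>z\<in>lattice_annulus 0 (real k). jump_kernel z * r z)"
    proof -
      have "real k ^ 2 / ln (real k) * (S / d * laplacian g x / (2 * real k ^ 2)) = S / (2 * d * ln (real k)) * laplacian g x"
        using k0 by simp
      then show ?thesis by (simp only: split limit_generator_def distrib_left left_diff_distrib)
    qed
    have "\<bar>laplacian g x\<bar> \<le> (\<Sum>i\<in>(UNIV :: 'd set). B)"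
      unfolding laplacian_def using B(2)[of "[_, _]"]
      by (intro order_trans[OF sum_abs] sum_mono) auto
    then have lap: "\<bar>laplacian g x\<bar> \<le> d * B" by (simp add: d_def)
    have 1: "\<bar>(S / (2 * d * ln (real k)) - a0 TYPE('d)) * laplacian g x\<bar> \<le> C / ln (real k) * (d * B)"
      unfolding abs_mult using C(2)[OF k] lap C(1) l by (intro mult_mono) (auto simp: S_def d_def)
    have "\<bar>\<Sum>z\<in>lattice_annulus 0 (real k). jump_kernel z * r z\<bar>
        \<le> (\<Sum>z\<in>(lattice_annulus 0 (real k) :: (real ^ 'd) set). d ^ 3 * B / real k ^ 3 * (1 / norm z ^ (CARD('d) - 1)))"
    proof (rule order_trans[OF sum_abs sum_mono])
      fix z :: "real ^ 'd" assume "z \<in> lattice_annulus 0 (real k)"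
      then have z: "norm z > 0" by (auto simp: lattice_annulus_def)
      have le: "\<bar>jump_kernel z * r z\<bar> \<le> jump_kernel z * (d ^ 3 * B * (norm z ^ 3 / real k ^ 3))"
        unfolding abs_mult using r[of z] by (intro mult_mono) auto
      have "jump_kernel z * norm z ^ 3 = 1 / norm z ^ (CARD('d) - 1)"
      proof -
        have "CARD('d) + 2 = (CARD('d) - 1) + 3" by (simp add: Suc_leI)
        then have "norm z ^ (CARD('d) + 2) = norm z ^ (CARD('d) - 1) * norm z ^ 3" by (metis power_add)
        then show ?thesis using z by (simp add: jump_kernel_def)
      qed
      then have "d ^ 3 * B / real k ^ 3 * (jump_kernel z * norm z ^ 3) = d ^ 3 * B / real k ^ 3 * (1 / norm z ^ (CARD('d) - 1))"
        by (rule arg_cong)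
      also have "d ^ 3 * B / real k ^ 3 * (jump_kernel z * norm z ^ 3) = jump_kernel z * (d ^ 3 * B * (norm z ^ 3 / real k ^ 3))"
        by simp
      finally show "\<bar>jump_kernel z * r z\<bar> \<le> d ^ 3 * B / real k ^ 3 * (1 / norm z ^ (CARD('d) - 1))"
        using le by linarith
    qed
    also have "\<dots> = d ^ 3 * B / real k ^ 3 * (\<Sum>z\<in>(lattice_annulus 0 (real k) :: (real ^ 'd) set). 1 / norm z ^ (CARD('d) - 1))"
      by (rule sum_distrib_left[symmetric])
    also have "\<dots> \<le> d ^ 3 * B / real k ^ 3 * (A * real k)"
      using A(2) B(1) d by (intro mult_left_mono) auto
    finally have "\<bar>real k ^ 2 / ln (real k) * (\<Sum>z\<in>lattice_annulus 0 (real k). jump_kernel z * r z)\<bar>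
        \<le> real k ^ 2 / ln (real k) * (d ^ 3 * B / real k ^ 3 * (A * real k))"
      unfolding abs_mult using l by (intro mult_mono) auto
    also have "\<dots> = d ^ 3 * B * A / ln (real k)"
      using k0 by (simp add: power2_eq_square power3_eq_cube field_simps)
    finally have 2: "\<bar>real k ^ 2 / ln (real k) * (\<Sum>z\<in>lattice_annulus 0 (real k). jump_kernel z * r z)\<bar>
        \<le> d ^ 3 * B * A / ln (real k)" .
    show "\<bar>real k ^ 2 / ln (real k) * (\<Sum>z\<in>lattice_annulus 0 (real k). jump_kernel z * (g (x + z /\<^sub>R real k) - g x))
       - limit_generator g x\<bar> \<le> (d ^ 3 * B * A + C * (d * B)) / ln (real k)"
    proof -
      have "(d ^ 3 * B * A + C * (d * B)) / ln (real k) = d ^ 3 * B * A / ln (real k) + C / ln (real k) * (d * B)"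
        by (simp add: add_divide_distrib)
      with 1 2 show ?thesis unfolding eq
        by (intro order_trans[OF abs_triangle_ineq]) linarith
    qed
  qed
qed

text \<open>The error coefficients live on pairs touching a finite set \<open>F\<close>. Such a pair
  sum costs one kernel row per point of \<open>F\<close>, once for each end; the sum of two
  indicators is symmetric and splits by linearity.\<close>

lemma summable_on_finite_rows:
  fixes \<phi> :: "real ^ 'd \<Rightarrow> real"
  assumes F: "finite F" "F \<subseteq> int_lattice" and \<phi>: "\<phi> summable_on int_lattice" "\<And>z. \<phi> z \<ge> 0" "\<And>z. \<phi> (- z) = \<phi> z"
  shows "(\<lambda>(x, y). (indicator F x + indicator F y) * \<phi> (x - y)) summable_on int_lattice \<times> int_lattice"
    "(\<Sum>\<^sub>\<infinity>(x, y)\<in>int_lattice \<times> int_lattice. (indicator F x + indicator F y) * \<phi> (x - y))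
      = 2 * real (card F) * (\<Sum>\<^sub>\<infinity>z\<in>int_lattice. \<phi> z)"
proof -
  let ?L = "int_lattice :: (real ^ 'd) set"
  let ?s = "\<Sum>\<^sub>\<infinity>z\<in>?L. \<phi> z"
  have row: "((\<lambda>y. \<phi> (x - y)) has_sum ?s) ?L" if "x \<in> ?L" for x
    using has_sum_reindex_bij_betw[OF int_lattice_translate_bij[OF that], of \<phi> ?s] has_sum_infsum[OF \<phi>(1)] by simp
  have col: "((\<lambda>x. indicator F x * ?s) has_sum (real (card F) * ?s)) ?L"
    by (rule has_sum_finite_neutralI[of F]) (use F in \<open>auto simp: indicator_def\<close>)
  have 1: "(\<lambda>(x, y). indicator F x * \<phi> (x - y)) summable_on ?L \<times> ?L"
  proof (rule summable_on_SigmaI)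
    show "((\<lambda>y. case (x, y) of (x, y) \<Rightarrow> indicator F x * \<phi> (x - y)) has_sum indicator F x * ?s) ?L" if "x \<in> ?L" for x
      using has_sum_cmult_right[OF row[OF that], of "indicator F x"] by simp
    show "(\<lambda>x. indicator F x * ?s) summable_on ?L" using col by (rule has_sum_imp_summable)
  qed (use \<phi>(2) in auto)
  have s1: "(\<Sum>\<^sub>\<infinity>(x, y)\<in>?L \<times> ?L. indicator F x * \<phi> (x - y)) = real (card F) * ?s"
  proof -
    have "(\<Sum>\<^sub>\<infinity>(x, y)\<in>?L \<times> ?L. indicator F x * \<phi> (x - y)) = (\<Sum>\<^sub>\<infinity>x\<in>?L. \<Sum>\<^sub>\<infinity>y\<in>?L. indicator F x * \<phi> (x - y))"
      using infsum_Sigma'_banach[OF 1] by simp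
    also have "\<dots> = (\<Sum>\<^sub>\<infinity>x\<in>?L. indicator F x * ?s)"
      by (rule infsum_cong) (simp add: infsum_cmult_right' infsumI[OF row])
    also have "\<dots> = real (card F) * ?s" using col by (rule infsumI)
    finally show ?thesis .
  qed
  note sw = summable_on_swap_square[OF 1]
  have flip: "\<phi> (y - x) = \<phi> (x - y)" for x y using \<phi>(3)[of "x - y"] by simp
  have eq: "(\<lambda>(x, y). (indicator F x + indicator F y) * \<phi> (x - y))
      = (\<lambda>p. (\<lambda>(x, y). indicator F x * \<phi> (x - y)) p + (\<lambda>(x, y). indicator F y * \<phi> (y - x)) p)"
    by (auto simp: fun_eq_iff distrib_right flip)
  show "(\<lambda>(x, y). (indicator F x + indicator F y) * \<phi> (x - y)) summable_on ?L \<times> ?L"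
    unfolding eq by (rule summable_on_add[OF 1 sw(1)])
  show "(\<Sum>\<^sub>\<infinity>(x, y)\<in>?L \<times> ?L. (indicator F x + indicator F y) * \<phi> (x - y)) = 2 * real (card F) * ?s"
    unfolding eq infsum_add[OF 1 sw(1)] sw(2) s1 by simp
qed

lemma energy_summable:
  fixes v :: "real ^ 'd \<Rightarrow> real"
  assumes v: "(\<lambda>x. (v x)\<^sup>2) summable_on int_lattice"
    and a: "\<And>x y. x \<in> int_lattice \<Longrightarrow> y \<in> int_lattice \<Longrightarrow> \<bar>a x y\<bar> \<le> C * jump_kernel (x - y)" and C: "C \<ge> 0"
  shows "(\<lambda>(x, y). a x y * (v y - v x)\<^sup>2) summable_on int_lattice \<times> int_lattice"
proof (rule kernel_product_summable[OF v v a _ C, where c = 2])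
  fix x y :: "real ^ 'd"
  have "(v y - v x)\<^sup>2 \<le> 2 * ((v x)\<^sup>2 + (v y)\<^sup>2)"
    using zero_le_power2[of "v x + v y"] unfolding power2_diff power2_sum by (simp add: algebra_simps)
  also have "\<dots> \<le> 2 * ((v x)\<^sup>2 + (v y)\<^sup>2 + (v x)\<^sup>2 + (v y)\<^sup>2)" by simp
  finally show "\<bar>(v y - v x)\<^sup>2\<bar> \<le> 2 * ((v x)\<^sup>2 + (v y)\<^sup>2 + (v x)\<^sup>2 + (v y)\<^sup>2)"
    unfolding abs_power2 .
qed auto

text \<open>Young's inequality with a free parameter: the bound on the square of \<open>c\<close>
  puts one kernel factor into the Dirichlet energy and leaves the summable \<open>e\<close> as the
  price. Later \<open>t\<close> is the lower ellipticity constant, so that the energy can be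
  absorbed.\<close>

lemma weighted_young:
  fixes v :: "real ^ 'd \<Rightarrow> real"
  assumes v: "(\<lambda>x. (v x)\<^sup>2) summable_on int_lattice"
    and c: "\<And>x y. x \<in> int_lattice \<Longrightarrow> y \<in> int_lattice \<Longrightarrow> (c x y)\<^sup>2 \<le> jump_kernel (x - y) * e x y"
    and e: "(\<lambda>(x, y). e x y) summable_on int_lattice \<times> int_lattice"
    and e0: "\<And>x y. e x y \<ge> 0" and t: "t > 0"
  shows "(\<lambda>(x, y). c x y * (v y - v x)) summable_on int_lattice \<times> int_lattice"
    "\<bar>\<Sum>\<^sub>\<infinity>(x, y)\<in>int_lattice \<times> int_lattice. c x y * (v y - v x)\<bar>
      \<le> t * (\<Sum>\<^sub>\<infinity>(x, y)\<in>int_lattice \<times> int_lattice. jump_kernel (x - y) * (v y - v x)\<^sup>2)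
        + 1 / (4 * t) * (\<Sum>\<^sub>\<infinity>(x, y)\<in>int_lattice \<times> int_lattice. e x y)"
proof -
  let ?L = "int_lattice :: (real ^ 'd) set"
  let ?b = "\<lambda>p. t * (\<lambda>(x, y). jump_kernel (x - y) * (v y - v x)\<^sup>2) p + 1 / (4 * t) * (\<lambda>(x, y). e x y) p"
  have D: "(\<lambda>(x, y). jump_kernel (x - y) * (v y - v x)\<^sup>2) summable_on ?L \<times> ?L"
    by (rule energy_summable[OF v, where C = 1]) auto
  have b: "?b summable_on ?L \<times> ?L" by (intro summable_on_add summable_on_cmult_right D e)
  have pt: "\<bar>c x y * (v y - v x)\<bar> \<le> t * (jump_kernel (x - y) * (v y - v x)\<^sup>2) + 1 / (4 * t) * e x y"
    if xy: "x \<in> ?L" "y \<in> ?L" for x y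
  proof -
    define K where "K = jump_kernel (x - y)"
    define D where "D = v y - v x"
    have K: "K \<ge> 0" by (simp add: K_def)
    have "(2 * \<bar>c x y * D\<bar>)\<^sup>2 = 4 * ((c x y)\<^sup>2 * D\<^sup>2)" by (simp add: power_mult_distrib)
    also have "\<dots> \<le> 4 * ((K * e x y) * D\<^sup>2)"
      using c[OF xy] by (intro mult_left_mono mult_right_mono) (auto simp: K_def)
    also have "\<dots> = 4 * ((2 * t * (K * D\<^sup>2)) * (1 / (2 * t) * e x y))" using t by simp
    also have "\<dots> \<le> (2 * t * (K * D\<^sup>2) + 1 / (2 * t) * e x y)\<^sup>2"
      using zero_le_power2[of "2 * t * (K * D\<^sup>2) - 1 / (2 * t) * e x y"]
      by (simp add: power2_eq_square algebra_simps)
    finally have "2 * \<bar>c x y * D\<bar> \<le> 2 * t * (K * D\<^sup>2) + 1 / (2 * t) * e x y"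
      by (rule power2_le_imp_le) (use t K e0 in simp)
    then show ?thesis by (simp add: K_def D_def)
  qed
  show S: "(\<lambda>(x, y). c x y * (v y - v x)) summable_on ?L \<times> ?L"
    by (rule summable_on_comparison_real[OF b]) (use pt in auto)
  have le: "(\<Sum>\<^sub>\<infinity>(x, y)\<in>?L \<times> ?L. c x y * (v y - v x)) \<le> infsum ?b (?L \<times> ?L)"
    by (rule infsum_mono[OF S b]) (use pt in \<open>force simp: abs_le_iff\<close>)
  have "(\<Sum>\<^sub>\<infinity>p\<in>?L \<times> ?L. - (\<lambda>(x, y). c x y * (v y - v x)) p) \<le> infsum ?b (?L \<times> ?L)"
    by (rule infsum_mono[OF _ b]) (use S pt in \<open>force simp: abs_le_iff summable_on_uminus\<close>)+
  then have ge: "- (\<Sum>\<^sub>\<infinity>(x, y)\<in>?L \<times> ?L. c x y * (v y - v x)) \<le> infsum ?b (?L \<times> ?L)"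
    by (simp add: infsum_uminus)
  have "infsum ?b (?L \<times> ?L) = t * (\<Sum>\<^sub>\<infinity>(x, y)\<in>?L \<times> ?L. jump_kernel (x - y) * (v y - v x)\<^sup>2)
        + 1 / (4 * t) * (\<Sum>\<^sub>\<infinity>(x, y)\<in>?L \<times> ?L. e x y)"
    by (subst infsum_add[OF summable_on_cmult_right[OF D] summable_on_cmult_right[OF e]])
       (simp only: infsum_cmult_right')
  with le ge show "\<bar>\<Sum>\<^sub>\<infinity>(x, y)\<in>?L \<times> ?L. c x y * (v y - v x)\<bar>
      \<le> t * (\<Sum>\<^sub>\<infinity>(x, y)\<in>?L \<times> ?L. jump_kernel (x - y) * (v y - v x)\<^sup>2)
        + 1 / (4 * t) * (\<Sum>\<^sub>\<infinity>(x, y)\<in>?L \<times> ?L. e x y)"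
    by (simp add: abs_le_iff)
qed

text \<open>Symmetric in the two ends and large: it contains the lattice ball of radius
  \<open>norm (x - y)\<close> about \<open>x\<close>, hence a number of points of order |x - y|^d.
  On the other hand a lens point has \<open>norm (u - y) / 2 \<le> norm (x - y)\<close>, the origin
  of the \<open>max\<close> in the fluctuation bounds.\<close>

definition lens :: "real ^ 'd \<Rightarrow> real ^ 'd \<Rightarrow> (real ^ 'd) set" where
  "lens x y = {u \<in> int_lattice. norm (u - x) \<le> 2 * norm (x - y) \<and> norm (u - y) \<le> 2 * norm (x - y)}"

definition lens_weight :: "real ^ 'd \<Rightarrow> real ^ 'd \<Rightarrow> real ^ 'd \<Rightarrow> real" where
  "lens_weight u x y = indicator (lens x y) u / real (card (lens x y))"

lemma lens_commute: "lens x y = lens y x"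
  by (auto simp: lens_def norm_minus_commute)

lemma lens_weight_commute: "lens_weight u x y = lens_weight u y x"
  by (simp add: lens_weight_def lens_commute)

lemma finite_lens [simp]: "finite (lens x y :: (real ^ 'd) set)"
proof (rule finite_subset)
  show "lens x y \<subseteq> lattice_ball (2 * norm (x - y) + norm x)"
    unfolding lens_def lattice_ball_def by (auto intro: order_trans[OF norm_triangle_sub[of _ x]])
qed simp

lemma lens_nonempty: "x \<in> int_lattice \<Longrightarrow> x \<in> lens x y"
  by (simp add: lens_def norm_minus_commute)

lemma sum_lens_weight:
  assumes "x \<in> int_lattice" "finite F" "lens x y \<subseteq> F"
  shows "(\<Sum>u\<in>F. lens_weight u x y) = 1"
proof -
  have "(\<Sum>u\<in>F. lens_weight u x y) = (\<Sum>u\<in>lens x y. 1 / real (card (lens x y)))"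
    unfolding lens_weight_def using assms by (intro sum.mono_neutral_cong_right) (auto simp: indicator_def)
  then show ?thesis using lens_nonempty[OF assms(1), of y] by (auto simp: card_gt_0_iff)
qed

definition mid_range :: "real \<Rightarrow> nat \<Rightarrow> real ^ 'd \<Rightarrow> real ^ 'd \<Rightarrow> bool" where
  "mid_range R k x y \<longleftrightarrow> R < norm (x - y) \<and> norm (x - y) \<le> real k"

text \<open>The coefficient of \<open>v y - v u\<close> in direction \<open>i\<close> after the
  splitting. With \<open>u\<close> and \<open>y\<close> fixed, the weights belong to different
  unordered pairs \<open>{x, y}\<close> and so are independent. The gradient of \<open>g\<close> at
  \<open>u\<close> is factored out: no test function occurs, and the exceptional events serve all of
  them.\<close>

definition fluctuation :: "(real ^ 'd \<Rightarrow> real ^ 'd \<Rightarrow> real) \<Rightarrow> real \<Rightarrow> nat \<Rightarrow> 'd \<Rightarrow> real ^ 'd \<Rightarrow> real ^ 'd \<Rightarrow> real" where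
  "fluctuation \<xi> R k i u y = (\<Sum>x\<in>{x \<in> int_lattice. mid_range R k x y}.
      lens_weight u x y * \<xi> x y * jump_kernel (x - y) * (y - x) $ i)"

lemma finite_mid_range [simp]: "finite {x \<in> int_lattice. mid_range R k x y}"
proof (rule finite_subset)
  show "{x \<in> int_lattice. mid_range R k x y} \<subseteq> lattice_ball (real k + norm y)"
    unfolding mid_range_def lattice_ball_def by (auto intro: order_trans[OF norm_triangle_sub[of _ y]])
qed simp

lemma mid_range_commute: "mid_range R k x y = mid_range R k y x"
  by (simp add: mid_range_def norm_minus_commute)

text \<open>Every increment is split at an intermediate point of the lens; for fixed intermediate and end
  point the coefficient is a sum of many independent centred terms.\<close>
lemma three_point_identity:
  fixes q :: "'a \<Rightarrow> 'a \<Rightarrow> 'a \<Rightarrow> real"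
  assumes F: "finite F" and sym: "\<And>u x y. x \<in> F \<Longrightarrow> y \<in> F \<Longrightarrow> q u x y = - q u y x"
  shows "(\<Sum>x\<in>F. \<Sum>y\<in>F. \<Sum>u\<in>F. q u x y * (v y - v x)) = 2 * (\<Sum>u\<in>F. \<Sum>y\<in>F. (\<Sum>x\<in>F. q u x y) * (v y - v u))"
proof -
  have 1: "(\<Sum>x\<in>F. \<Sum>y\<in>F. \<Sum>u\<in>F. q u x y * (v y - v u)) = (\<Sum>u\<in>F. \<Sum>y\<in>F. (\<Sum>x\<in>F. q u x y) * (v y - v u))"
  proof -
    have "(\<Sum>x\<in>F. \<Sum>y\<in>F. \<Sum>u\<in>F. q u x y * (v y - v u)) = (\<Sum>y\<in>F. \<Sum>x\<in>F. \<Sum>u\<in>F. q u x y * (v y - v u))"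
      by (rule sum.swap)
    also have "\<dots> = (\<Sum>y\<in>F. \<Sum>u\<in>F. \<Sum>x\<in>F. q u x y * (v y - v u))"
      by (intro sum.cong refl sum.swap)
    also have "\<dots> = (\<Sum>u\<in>F. \<Sum>y\<in>F. \<Sum>x\<in>F. q u x y * (v y - v u))" by (rule sum.swap)
    finally show ?thesis by (simp add: sum_distrib_right)
  qed
  \<comment> \<open>Exchanging \<open>x\<close> and \<open>y\<close> and using antisymmetry, the
    part with \<open>v x - v u\<close> is minus the part with \<open>v y - v u\<close>, whence the
    factor 2.\<close>
  have 2: "(\<Sum>x\<in>F. \<Sum>y\<in>F. \<Sum>u\<in>F. q u x y * (v x - v u)) = - (\<Sum>x\<in>F. \<Sum>y\<in>F. \<Sum>u\<in>F. q u x y * (v y - v u))"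
  proof -
    have "(\<Sum>x\<in>F. \<Sum>y\<in>F. \<Sum>u\<in>F. q u x y * (v x - v u)) = (\<Sum>y\<in>F. \<Sum>x\<in>F. \<Sum>u\<in>F. q u x y * (v x - v u))"
      by (rule sum.swap)
    also have "\<dots> = (\<Sum>y\<in>F. \<Sum>x\<in>F. \<Sum>u\<in>F. - (q u y x * (v x - v u)))"
      by (intro sum.cong refl) (subst sym, simp_all)
    finally show ?thesis by (simp add: sum_negf)
  qed
  have "(\<Sum>x\<in>F. \<Sum>y\<in>F. \<Sum>u\<in>F. q u x y * (v y - v x))
      = (\<Sum>x\<in>F. \<Sum>y\<in>F. \<Sum>u\<in>F. q u x y * (v y - v u)) - (\<Sum>x\<in>F. \<Sum>y\<in>F. \<Sum>u\<in>F. q u x y * (v x - v u))"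
    unfolding sum_subtractf[symmetric] by (intro sum.cong refl) (simp add: algebra_simps)
  then show ?thesis using 1 2 by simp
qed

text \<open>The squared size of the deterministic error coefficients over the kernel: jumps longer than
  \<open>k\<close>, jumps shorter than \<open>R\<close>, the Taylor remainder in between, and the bound for
  the fluctuations.\<close>
definition error_profile :: "real \<Rightarrow> nat \<Rightarrow> real ^ 'd \<Rightarrow> real" where
  "error_profile R k z =
     jump_kernel z * (if norm z > real k then 1 else if norm z \<le> R then (norm z / real k)\<^sup>2 else ((norm z / real k)\<^sup>2)\<^sup>2)
     + 1 / norm z ^ (CARD('d) + 1) / (real k)\<^sup>2"

lemma error_profile_nonneg: "error_profile R k z \<ge> 0"
  by (simp add: error_profile_def)

lemma error_profile_minus: "error_profile R k (- z) = error_profile R k z"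
  by (simp add: error_profile_def)

text \<open>Long jumps, Taylor remainders and the fluctuation term contribute a constant over k^2
  each; the jumps shorter than \<open>R\<close> alone carry \<open>ln R\<close>.\<close>

lemma error_profile_bound:
  assumes "CARD('d) \<ge> 2"
  obtains A where "A > 0"
    "\<And>R k. k \<ge> 1 \<Longrightarrow> 1 \<le> R \<Longrightarrow> R \<le> real k \<Longrightarrow> (error_profile R k :: real ^ 'd \<Rightarrow> real) summable_on int_lattice"
    "\<And>R k. k \<ge> 1 \<Longrightarrow> 1 \<le> R \<Longrightarrow> R \<le> real k \<Longrightarrow>
      (\<Sum>\<^sub>\<infinity>z\<in>(int_lattice :: (real ^ 'd) set). error_profile R k z) \<le> A * (1 + ln R) / (real k)\<^sup>2"
proof -
  obtain A1 where A1: "A1 > 0" "\<And>F k. finite F \<Longrightarrow> k \<ge> 1 \<Longrightarrow> F \<subseteq> {z \<in> int_lattice. norm z > real k} \<Longrightarrow>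
      (\<Sum>z\<in>(F :: (real ^ 'd) set). 1 / norm z ^ (CARD('d) + 2)) \<le> A1 / real k ^ 2"
    using lattice_power_sum_tail by blast
  obtain A2 where A2: "A2 > 0"
    "\<And>r. r \<ge> 1 \<Longrightarrow> (\<Sum>z\<in>(lattice_annulus 0 r :: (real ^ 'd) set). 1 / norm z ^ CARD('d)) \<le> A2 * (1 + ln r)"
    using lattice_power_sum_log by blast
  obtain A3 where A3: "A3 > 0"
    "\<And>k. (\<Sum>z\<in>(lattice_annulus 0 (real k) :: (real ^ 'd) set). 1 / norm z ^ (CARD('d) - 2)) \<le> A3 * real k ^ 2"
    using lattice_power_sum_quadratic[OF assms] by blast
  obtain A4 where A4: "A4 > 0" "\<And>F. finite F \<Longrightarrow> F \<subseteq> int_lattice - {0} \<Longrightarrow>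
      (\<Sum>z\<in>(F :: (real ^ 'd) set). 1 / norm z ^ (CARD('d) + 1)) \<le> A4"
    using lattice_power_sum_bounded by blast
  define A where "A = A1 + A2 + A3 + A4"
  have fin: "sum (error_profile R k) F \<le> A * (1 + ln R) / (real k)\<^sup>2"
    if k: "k \<ge> 1" and R: "1 \<le> R" "R \<le> real k" and F: "finite F" "F \<subseteq> int_lattice" for R k and F :: "(real ^ 'd) set"
  proof -
    have k0: "real k > 0" using k by simp
    have lR: "1 + ln R \<ge> 1" using R by simp
    define F1 where "F1 = {z \<in> F. norm z > real k}"
    define F2 where "F2 = {z \<in> F. 0 < norm z \<and> norm z \<le> R}"
    define F3 where "F3 = {z \<in> F. 0 < norm z \<and> norm z \<le> real k}"
    define F4 where "F4 = {z \<in> F. 0 < norm z}"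
    have Kp: "jump_kernel z * ((norm z)\<^sup>2)\<^sup>2 = 1 / norm z ^ (CARD('d) - 2)" if "z \<noteq> 0" for z :: "real ^ 'd"
    proof -
      have "CARD('d) + 2 = (CARD('d) - 2) + 4" using assms by simp
      then have "norm z ^ (CARD('d) + 2) = norm z ^ (CARD('d) - 2) * norm z ^ 4" by (metis power_add)
      then show ?thesis using that by (simp add: jump_kernel_def power_mult[symmetric])
    qed
    have pt: "error_profile R k z \<le> (if norm z > real k then 1 / norm z ^ (CARD('d) + 2) else 0)
        + (if 0 < norm z \<and> norm z \<le> R then 1 / norm z ^ CARD('d) / (real k)\<^sup>2 else 0)
        + (if 0 < norm z \<and> norm z \<le> real k then 1 / norm z ^ (CARD('d) - 2) / ((real k)\<^sup>2)\<^sup>2 else 0)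
        + (if 0 < norm z then 1 / norm z ^ (CARD('d) + 1) / (real k)\<^sup>2 else 0)" for z :: "real ^ 'd"
    proof (cases "z = 0")
      case False
      have "jump_kernel z * (norm z / real k)\<^sup>2 = 1 / norm z ^ CARD('d) / (real k)\<^sup>2"
        using jump_kernel_times_square[OF False] by (simp add: power_divide)
      moreover have "jump_kernel z * ((norm z / real k)\<^sup>2)\<^sup>2 = 1 / norm z ^ (CARD('d) - 2) / ((real k)\<^sup>2)\<^sup>2"
        using Kp[OF False] by (simp add: power_divide)
      ultimately show ?thesis using False
        by (auto simp: error_profile_def jump_kernel_def)
    qed (simp add: error_profile_def)
    have "sum (error_profile R k) F \<le> (\<Sum>z\<in>F. (if norm z > real k then 1 / norm z ^ (CARD('d) + 2) else 0)
        + (if 0 < norm z \<and> norm z \<le> R then 1 / norm z ^ CARD('d) / (real k)\<^sup>2 else 0)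
        + (if 0 < norm z \<and> norm z \<le> real k then 1 / norm z ^ (CARD('d) - 2) / ((real k)\<^sup>2)\<^sup>2 else 0)
        + (if 0 < norm z then 1 / norm z ^ (CARD('d) + 1) / (real k)\<^sup>2 else 0))"
      by (rule sum_mono) (rule pt)
    also have "\<dots> = (\<Sum>z\<in>F1. 1 / norm z ^ (CARD('d) + 2)) + (\<Sum>z\<in>F2. 1 / norm z ^ CARD('d)) / (real k)\<^sup>2
        + (\<Sum>z\<in>F3. 1 / norm z ^ (CARD('d) - 2)) / ((real k)\<^sup>2)\<^sup>2 + (\<Sum>z\<in>F4. 1 / norm z ^ (CARD('d) + 1)) / (real k)\<^sup>2"
      unfolding sum.distrib F1_def F2_def F3_def F4_def sum_divide_distrib
      using F(1) by (simp only: sum.inter_filter[symmetric])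
    also have "\<dots> \<le> A1 / (real k)\<^sup>2 + (A2 * (1 + ln R)) / (real k)\<^sup>2 + (A3 * (real k)\<^sup>2) / ((real k)\<^sup>2)\<^sup>2 + A4 / (real k)\<^sup>2"
    proof (intro add_mono divide_right_mono)
      show "(\<Sum>z\<in>F1. 1 / norm z ^ (CARD('d) + 2)) \<le> A1 / (real k)\<^sup>2"
        by (rule A1(2)[OF _ k]) (use F in \<open>auto simp: F1_def\<close>)
      have "(\<Sum>z\<in>F2. 1 / norm z ^ CARD('d)) \<le> (\<Sum>z\<in>(lattice_annulus 0 R :: (real ^ 'd) set). 1 / norm z ^ CARD('d))"
        using F by (intro sum_mono2 finite_lattice_annulus) (auto simp: F2_def lattice_annulus_def)
      then show "(\<Sum>z\<in>F2. 1 / norm z ^ CARD('d)) \<le> A2 * (1 + ln R)" using A2(2)[OF R(1)] by linarith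
      have "(\<Sum>z\<in>F3. 1 / norm z ^ (CARD('d) - 2)) \<le> (\<Sum>z\<in>(lattice_annulus 0 (real k) :: (real ^ 'd) set). 1 / norm z ^ (CARD('d) - 2))"
        using F by (intro sum_mono2 finite_lattice_annulus) (auto simp: F3_def lattice_annulus_def)
      then show "(\<Sum>z\<in>F3. 1 / norm z ^ (CARD('d) - 2)) \<le> A3 * (real k)\<^sup>2" using A3(2)[of k] by linarith
      show "(\<Sum>z\<in>F4. 1 / norm z ^ (CARD('d) + 1)) \<le> A4"
        by (rule A4(2)) (use F in \<open>auto simp: F4_def\<close>)
    qed auto
    also have "(A3 * (real k)\<^sup>2) / ((real k)\<^sup>2)\<^sup>2 = A3 / (real k)\<^sup>2" using k0 by (simp add: power2_eq_square)
    also have "A1 / (real k)\<^sup>2 + A2 * (1 + ln R) / (real k)\<^sup>2 + A3 / (real k)\<^sup>2 + A4 / (real k)\<^sup>2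
        = (A1 + A2 * (1 + ln R) + A3 + A4) / (real k)\<^sup>2" by (simp add: add_divide_distrib)
    also have "\<dots> \<le> (A * (1 + ln R)) / (real k)\<^sup>2"
    proof (rule divide_right_mono)
      have "A1 \<le> A1 * (1 + ln R)" "A3 \<le> A3 * (1 + ln R)" "A4 \<le> A4 * (1 + ln R)"
        using A1(1) A3(1) A4(1) lR by simp_all
      then show "A1 + A2 * (1 + ln R) + A3 + A4 \<le> A * (1 + ln R)" by (simp only: A_def distrib_right)
    qed simp
    finally show ?thesis .
  qed
  have sm: "(error_profile R k :: real ^ 'd \<Rightarrow> real) summable_on int_lattice"
    if "k \<ge> 1" "1 \<le> R" "R \<le> real k" for R k
    by (rule nonneg_bdd_above_summable_on) (use fin[OF that] error_profile_nonneg in \<open>auto simp: bdd_above_def\<close>)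
  show ?thesis
  proof (rule that[of A])
    show "A > 0" using A1(1) A2(1) A3(1) A4(1) by (simp add: A_def)
    show "(error_profile R k :: real ^ 'd \<Rightarrow> real) summable_on int_lattice"
      if "k \<ge> 1" "1 \<le> R" "R \<le> real k" for R k by (rule sm[OF that])
    show "(\<Sum>\<^sub>\<infinity>z\<in>(int_lattice :: (real ^ 'd) set). error_profile R k z) \<le> A * (1 + ln R) / (real k)\<^sup>2"
      if "k \<ge> 1" "1 \<le> R" "R \<le> real k" for R k
      by (rule infsum_le_finite_sums[OF sm[OF that]]) (rule fin[OF that])
  qed
qed

text \<open>The derivative of the rescaled function sending x to g(x / k), at the point
  \<open>u\<close> in direction \<open>z\<close>.\<close>

definition scaled_gradient :: "(real ^ 'd \<Rightarrow> real) \<Rightarrow> nat \<Rightarrow> real ^ 'd \<Rightarrow> real ^ 'd \<Rightarrow> real" where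
  "scaled_gradient g k u z = (\<Sum>i\<in>UNIV. z $ i * (partial_deriv i g (u /\<^sub>R real k) / real k))"

definition lens_gradient :: "(real ^ 'd \<Rightarrow> real) \<Rightarrow> nat \<Rightarrow> real ^ 'd \<Rightarrow> real ^ 'd \<Rightarrow> real" where
  "lens_gradient g k x y = (\<Sum>u\<in>lens x y. lens_weight u x y * scaled_gradient g k u (y - x))"

text \<open>The weighted increment of \<open>g\<close>, minus its mean part (jumps up to
  \<open>k\<close>, weight 1), minus the linearised fluctuation reserved for concentration. What is
  left is the full weighted increment beyond \<open>k\<close>, \<open>wt x y - 1\<close> times the
  increment up to \<open>R\<close>, and \<open>wt x y - 1\<close> times a Taylor remainder in
  between.\<close>

definition remainder_coeff :: "(real ^ 'd \<Rightarrow> real ^ 'd \<Rightarrow> real) \<Rightarrow> (real ^ 'd \<Rightarrow> real) \<Rightarrow> real \<Rightarrow> nat \<Rightarrow> real ^ 'd \<Rightarrow> real ^ 'd \<Rightarrow> real" where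
  "remainder_coeff wt g R k x y = jump_kernel (x - y) *
     (wt x y * (g (y /\<^sub>R real k) - g (x /\<^sub>R real k))
      - (if norm (x - y) \<le> real k then g (y /\<^sub>R real k) - g (x /\<^sub>R real k) else 0)
      - (if mid_range R k x y then (wt x y - 1) * lens_gradient g k x y else 0))"

text \<open>According to the length of the jump the bracket is controlled by boundedness, by the
  Lipschitz estimate or by \<open>first_order_taylor\<close>; these are the three branches of
  \<open>error_profile\<close>.\<close>

lemma remainder_coeff_bound:
  fixes g :: "real ^ 'd \<Rightarrow> real"
  assumes g: "smooth_compact_support g" and B: "\<And>js x. length js \<le> 2 \<Longrightarrow> \<bar>iterated_partial js g x\<bar> \<le> B"
    and M: "M > 0" "\<And>js x. norm x > M \<Longrightarrow> iterated_partial js g x = 0"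
    and k: "k \<ge> 1" and R: "1 \<le> R" "R \<le> real k" and x: "x \<in> int_lattice" and y: "y \<in> int_lattice"
    and wt: "x \<noteq> y \<Longrightarrow> 0 \<le> wt x y \<and> wt x y \<le> C2" and C2: "C2 \<ge> 0"
    and F: "F = lattice_ball ((M + 3) * real k)"
  shows "(remainder_coeff wt g R k x y)\<^sup>2 \<le> jump_kernel (x - y) *
     (((C2 + 1) * (3 * real CARD('d) ^ 2 * B + 2 * B))\<^sup>2 * ((indicator F x + indicator F y) * error_profile R k (x - y)))"
proof -
  define d where "d = real CARD('d)"
  have d: "d \<ge> 1" by (simp add: d_def Suc_leI)
  have B0: "B \<ge> 0" using B[of "[]" 0] by simp
  define C where "C = (C2 + 1) * (3 * d ^ 2 * B + 2 * B)"
  define K where "K = jump_kernel (x - y)"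
  define \<rho> where "\<rho> = norm (x - y)"
  define dg where "dg = g (y /\<^sub>R real k) - g (x /\<^sub>R real k)"
  define s where "s = wt x y * dg - (if \<rho> \<le> real k then dg else 0) - (if mid_range R k x y then (wt x y - 1) * lens_gradient g k x y else 0)"
  define \<theta> where "\<theta> = (if \<rho> > real k then 1 else if \<rho> \<le> R then \<rho> / real k else (\<rho> / real k)\<^sup>2)"
  have k0: "real k > 0" using k by simp
  have K0: "K \<ge> 0" by (simp add: K_def)
  have c_eq: "remainder_coeff wt g R k x y = K * s"
    by (simp add: remainder_coeff_def K_def s_def dg_def \<rho>_def)
  have normk: "norm (u /\<^sub>R real k) = norm u / real k" for u :: "real ^ 'd" by (simp add: divide_inverse_commute)
  have vanish: "iterated_partial js g (u /\<^sub>R real k) = 0" if "norm u > M * real k" for js and u :: "real ^ 'd"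
  proof (rule M(2))
    have "M < norm u / real k" using that k0 by (simp add: pos_less_divide_eq)
    then show "M < norm (u /\<^sub>R real k)" by (simp only: normk)
  qed
  have sg0: "scaled_gradient g k u z = 0" if "norm u > M * real k" for u z
    using vanish[OF that, of "[_]"] by (simp add: scaled_gradient_def)
  have prof: "K * \<theta>\<^sup>2 \<le> error_profile R k (x - y)"
    by (simp add: error_profile_def K_def \<theta>_def \<rho>_def)
  show ?thesis
  proof (cases "x = y")
    case True
    then have "remainder_coeff wt g R k x y = 0" by (simp add: remainder_coeff_def)
    then show ?thesis using True by simp
  next
    case xy: False
    have \<rho>0: "\<rho> > 0" using xy by (simp add: \<rho>_def)
    have w: "0 \<le> wt x y" "wt x y \<le> C2" using wt[OF xy] by auto
    have w1: "\<bar>wt x y - 1\<bar> \<le> C2 + 1" using w by (simp add: abs_le_iff)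
    show ?thesis
    proof (cases "x \<in> F \<or> y \<in> F")
      case False
      \<comment> \<open>Lens points of intermediate pairs lie within \<open>2 * real k\<close> of
        \<open>x\<close>. From outside radius \<open>(M + 3) * real k\<close> the lens thus misses
        the ball of radius \<open>M * real k\<close> that carries \<open>g\<close>, and every part
        of the bracket vanishes.\<close>
      have xl: "norm x > (M + 3) * real k" "norm y > (M + 3) * real k"
        using False x y by (auto simp: F lattice_ball_def)
      have Mk: "M * real k \<le> (M + 3) * real k" using k0 by simp
      have "g (x /\<^sub>R real k) = 0" "g (y /\<^sub>R real k) = 0"
        using vanish[of x "[]"] vanish[of y "[]"] xl Mk by auto
      then have dg0: "dg = 0" by (simp add: dg_def)
      have "lens_gradient g k x y = 0" if "mid_range R k x y"
        unfolding lens_gradient_def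
      proof (rule sum.neutral, intro ballI)
        fix u assume "u \<in> lens x y"
        then have "norm (u - x) \<le> 2 * real k" using that by (auto simp: lens_def mid_range_def)
        moreover have "norm x \<le> norm u + norm (u - x)" by (metis norm_minus_commute norm_triangle_sub)
        ultimately have "norm u > M * real k" using xl(1) k0 by (simp add: algebra_simps)
        then show "lens_weight u x y * scaled_gradient g k u (y - x) = 0" by (simp add: sg0)
      qed
      then have "s = 0" by (simp add: s_def dg0)
      then show ?thesis using error_profile_nonneg[of R k "x - y"] by (simp add: c_eq)
    next
      case True
      have B2: "\<bar>dg\<bar> \<le> 2 * B"
        using B[of "[]" "y /\<^sub>R real k"] B[of "[]" "x /\<^sub>R real k"] unfolding dg_def by (simp add: abs_le_iff)
      have diff_norm: "norm (y /\<^sub>R real k - x /\<^sub>R real k) = \<rho> / real k"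
        using normk[of "y - x"] by (simp add: scaleR_diff_right \<rho>_def norm_minus_commute)
      have s: "\<bar>s\<bar> \<le> C * \<theta>"
      proof -
        consider "\<rho> > real k" | "\<rho> \<le> R" | "R < \<rho>" "\<rho> \<le> real k" by linarith
        then show ?thesis
        proof cases
          case 1
          then have s_eq: "s = wt x y * dg" by (simp add: s_def mid_range_def \<rho>_def)
          have "\<bar>s\<bar> \<le> C2 * (2 * B)" unfolding s_eq abs_mult using w B2 C2 by (intro mult_mono) auto
          also have "\<dots> \<le> (C2 + 1) * (3 * d ^ 2 * B + 2 * B)" using C2 B0 by (intro mult_mono) auto
          finally show ?thesis using 1 by (simp add: C_def \<theta>_def)
        next
          case 2
          then have s_eq: "s = (wt x y - 1) * dg" using R by (simp add: s_def mid_range_def \<rho>_def algebra_simps)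
          have "\<bar>dg\<bar> \<le> d * (\<rho> / real k * B)"
            using lipschitz_of_partial_bound[of g B "y /\<^sub>R real k" "x /\<^sub>R real k"]
              smooth_compact_supportD[OF g, of "[]"] B[of "[_]"] by (simp add: diff_norm d_def dg_def)
          then have "\<bar>s\<bar> \<le> (C2 + 1) * (d * (\<rho> / real k * B))"
            unfolding s_eq abs_mult using w1 C2 by (intro mult_mono) auto
          also have "\<dots> = (C2 + 1) * (d * B) * (\<rho> / real k)" by simp
          also have "\<dots> \<le> (C2 + 1) * (3 * d ^ 2 * B + 2 * B) * (\<rho> / real k)"
          proof (intro mult_right_mono mult_left_mono)
            have "d * 1 \<le> d * (3 * d)" using d by (intro mult_left_mono) auto
            then have "d * B \<le> 3 * d ^ 2 * B" using B0 by (intro mult_right_mono) (auto simp: power2_eq_square)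
            then show "d * B \<le> 3 * d ^ 2 * B + 2 * B" using B0 by simp
          qed (use C2 k0 \<rho>0 in auto)
          finally show ?thesis using 2 R by (simp add: C_def \<theta>_def)
        next
          case 3
          then have mid: "mid_range R k x y" by (simp add: mid_range_def \<rho>_def)
          have s_eq: "s = (wt x y - 1) * (dg - lens_gradient g k x y)" using 3 mid by (simp add: s_def algebra_simps)
          \<comment> \<open>The lens weights sum to 1, so the increment is itself a lens average and
            the remainder can be estimated for each \<open>u\<close>.\<close>
          have "dg = (\<Sum>u\<in>lens x y. lens_weight u x y * dg)"
            by (simp add: sum_distrib_right[symmetric] sum_lens_weight[OF x])
          then have "dg - lens_gradient g k x y = (\<Sum>u\<in>lens x y. lens_weight u x y * (dg - scaled_gradient g k u (y - x)))"
            by (simp add: lens_gradient_def right_diff_distrib sum_subtractf)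
          also have "\<bar>\<dots>\<bar> \<le> (\<Sum>u\<in>lens x y. lens_weight u x y * (3 * d ^ 2 * B * (\<rho> / real k)\<^sup>2))"
          proof (rule order_trans[OF sum_abs sum_mono])
            fix u assume u: "u \<in> lens x y"
            have "norm (u - x) \<le> 2 * \<rho>" using u by (simp add: lens_def \<rho>_def)
            then have "norm (u /\<^sub>R real k - x /\<^sub>R real k) \<le> 2 * norm (y /\<^sub>R real k - x /\<^sub>R real k)"
              unfolding diff_norm using normk[of "u - x"] k0 by (simp add: scaleR_diff_right divide_right_mono)
            from first_order_taylor[OF g B this]
            have "\<bar>dg - (\<Sum>i\<in>UNIV. (y /\<^sub>R real k - x /\<^sub>R real k) $ i * partial_deriv i g (u /\<^sub>R real k))\<bar>
                \<le> 3 * d ^ 2 * B * (\<rho> / real k)\<^sup>2" by (simp add: dg_def diff_norm d_def)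
            moreover have "(\<Sum>i\<in>UNIV. (y /\<^sub>R real k - x /\<^sub>R real k) $ i * partial_deriv i g (u /\<^sub>R real k))
                = scaled_gradient g k u (y - x)"
            proof -
              have "(y /\<^sub>R real k - x /\<^sub>R real k) $ i = (y - x) $ i / real k" for i
                by (simp add: divide_inverse right_diff_distrib mult.commute[of _ "inverse _"])
              then show ?thesis by (simp only: scaled_gradient_def) (simp add: mult.commute)
            qed
            ultimately have "\<bar>dg - scaled_gradient g k u (y - x)\<bar> \<le> 3 * d ^ 2 * B * (\<rho> / real k)\<^sup>2" by simp
            then show "\<bar>lens_weight u x y * (dg - scaled_gradient g k u (y - x))\<bar>
                \<le> lens_weight u x y * (3 * d ^ 2 * B * (\<rho> / real k)\<^sup>2)"
              unfolding abs_mult by (intro mult_mono) (auto simp: lens_weight_def)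
          qed
          also have "\<dots> = 3 * d ^ 2 * B * (\<rho> / real k)\<^sup>2"
            by (simp only: sum_distrib_right[symmetric] sum_lens_weight[OF x finite_lens subset_refl] mult_1)
          finally have "\<bar>s\<bar> \<le> (C2 + 1) * (3 * d ^ 2 * B * (\<rho> / real k)\<^sup>2)"
            unfolding s_eq abs_mult using w1 C2 by (intro mult_mono) auto
          also have "\<dots> = (C2 + 1) * (3 * d ^ 2 * B) * (\<rho> / real k)\<^sup>2" by simp
          also have "\<dots> \<le> C * (\<rho> / real k)\<^sup>2"
            unfolding C_def using C2 B0 by (intro mult_right_mono mult_left_mono) auto
          finally show ?thesis using 3 by (simp add: \<theta>_def)
        qed
      qed
      \<comment> \<open>One kernel factor is kept aside for the Dirichlet energy, the other goes
        into the profile.\<close>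
      have "(K * s)\<^sup>2 = K * (K * \<bar>s\<bar>\<^sup>2)" by (simp add: power2_eq_square)
      also have "\<dots> \<le> K * (K * (C * \<theta>)\<^sup>2)"
        using s K0 by (intro mult_left_mono power_mono) auto
      also have "\<dots> = K * (C\<^sup>2 * (1 * (K * \<theta>\<^sup>2)))" by (simp add: power_mult_distrib)
      also have "\<dots> \<le> K * (C\<^sup>2 * ((indicator F x + indicator F y) * error_profile R k (x - y)))"
      proof (intro mult_left_mono mult_mono prof)
        show "1 \<le> (indicator F x + indicator F y :: real)" using True by (auto simp: indicator_def)
        show "0 \<le> K * \<theta>\<^sup>2" using K0 by simp
      qed (use K0 in \<open>auto simp: indicator_def\<close>)
      finally show ?thesis by (simp add: c_eq C_def K_def d_def)
    qed
  qed
qed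

text \<open>On the diagonal a bound by \<open>jump_kernel (u - y)\<close>, which is 0 there, could
  not hold for a non-zero coefficient. Setting it to 0 is harmless, because the increment
  \<open>v y - v u\<close> vanishes.\<close>

definition fluctuation_coeff :: "(real ^ 'd \<Rightarrow> real ^ 'd \<Rightarrow> real) \<Rightarrow> (real ^ 'd \<Rightarrow> real) \<Rightarrow> (real ^ 'd) set \<Rightarrow> real \<Rightarrow> nat \<Rightarrow> real ^ 'd \<Rightarrow> real ^ 'd \<Rightarrow> real" where
  "fluctuation_coeff \<xi> g F R k u y = (if u \<in> F \<and> y \<in> F \<and> u \<noteq> y
      then (\<Sum>i\<in>UNIV. partial_deriv i g (u /\<^sub>R real k) / real k * fluctuation \<xi> R k i u y) else 0)"

text \<open>A count of exponents: 3 d + 1 is d - 2 plus 2 d + 3. The first part cancels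
  \<open>R ^ (CARD('d) - 2)\<close>; the second is d + 2 for the kernel and d + 1 for the last term
  of \<open>error_profile\<close>.\<close>

lemma fluctuation_coeff_bound:
  fixes g :: "real ^ 'd \<Rightarrow> real"
  assumes d2: "CARD('d) \<ge> 2" and B: "\<And>js x. length js \<le> 1 \<Longrightarrow> \<bar>iterated_partial js g x\<bar> \<le> B"
    and k: "k \<ge> 1" and R: "1 \<le> R" and H: "H \<ge> 0"
    and fl: "\<And>i. u \<in> F \<Longrightarrow> y \<in> F \<Longrightarrow> (fluctuation \<xi> R k i u y)\<^sup>2
        \<le> H * R ^ (CARD('d) - 2) / max R (norm (u - y) / 2) ^ (3 * CARD('d) + 1)"
  shows "(fluctuation_coeff \<xi> g F R k u y)\<^sup>2 \<le> jump_kernel (u - y) *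
     (real CARD('d) ^ 2 * B\<^sup>2 * H * 2 ^ (2 * CARD('d) + 3) * ((indicator F u + indicator F y) * error_profile R k (u - y)))"
proof (cases "u \<in> F \<and> y \<in> F \<and> u \<noteq> y")
  case False
  then show ?thesis
    using error_profile_nonneg[of R k "u - y"] H by (auto simp: fluctuation_coeff_def)
next
  case True
  define d where "d = CARD('d)"
  define n where "n = norm (u - y)"
  define m where "m = max R (n / 2)"
  have n: "n > 0" using True by (simp add: n_def)
  have m: "m \<ge> R" "m \<ge> n / 2" "m > 0" using R by (auto simp: m_def)
  define W where "W = H * R ^ (d - 2) / m ^ (3 * d + 1)"
  have W0: "W \<ge> 0" using H R m by (simp add: W_def)
  have fl': "\<bar>fluctuation \<xi> R k i u y\<bar> \<le> sqrt W" for i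
    using fl[of i] True by (intro real_le_rsqrt) (simp add: W_def m_def n_def d_def)
  have B0: "B \<ge> 0" using B[of "[]" 0] by simp
  have "\<bar>fluctuation_coeff \<xi> g F R k u y\<bar> \<le> (\<Sum>i\<in>(UNIV :: 'd set). B / real k * sqrt W)"
  proof -
    have "fluctuation_coeff \<xi> g F R k u y = (\<Sum>i\<in>UNIV. partial_deriv i g (u /\<^sub>R real k) / real k * fluctuation \<xi> R k i u y)"
      using True by (simp add: fluctuation_coeff_def)
    moreover have "\<bar>partial_deriv i g (u /\<^sub>R real k) / real k * fluctuation \<xi> R k i u y\<bar> \<le> B / real k * sqrt W"
 for i
      unfolding abs_mult using fl' B0 k B[of "[i]" "u /\<^sub>R real k"] by (intro mult_mono) (auto simp: divide_right_mono)
    ultimately show ?thesis by (simp only:) (intro order_trans[OF sum_abs sum_mono])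
  qed
  then have "(fluctuation_coeff \<xi> g F R k u y)\<^sup>2 \<le> (real d * (B / real k * sqrt W))\<^sup>2"
    by (intro power2_le_iff_abs_le[THEN iffD2]) (use B0 W0 in \<open>auto simp: d_def\<close>)
  also have "\<dots> = real d ^ 2 * B\<^sup>2 / (real k)\<^sup>2 * W"
    using W0 by (simp add: power_mult_distrib power_divide)
  also have "\<dots> \<le> real d ^ 2 * B\<^sup>2 / (real k)\<^sup>2 * (H * (2 ^ (2 * d + 3) / n ^ (2 * d + 3)))"
  proof (intro mult_left_mono)
    have "R ^ (d - 2) * (n / 2) ^ (2 * d + 3) \<le> m ^ (d - 2) * m ^ (2 * d + 3)"
      using m n R by (intro mult_mono power_mono) auto
    also have "\<dots> = m ^ (3 * d + 1)"
    proof -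
      have "(d - 2) + (2 * d + 3) = 3 * d + 1" using d2 by (simp add: d_def)
      then show ?thesis by (metis power_add)
    qed
    finally have "R ^ (d - 2) / m ^ (3 * d + 1) \<le> 1 / (n / 2) ^ (2 * d + 3)"
      using m n by (simp add: divide_simps mult_ac)
    then have "H * (R ^ (d - 2) / m ^ (3 * d + 1)) \<le> H * (1 / (n / 2) ^ (2 * d + 3))"
      using H by (rule mult_left_mono)
    then show "W \<le> H * (2 ^ (2 * d + 3) / n ^ (2 * d + 3))" by (simp add: W_def power_divide)
  qed auto
  also have "\<dots> = jump_kernel (u - y) * (real d ^ 2 * B\<^sup>2 * H * 2 ^ (2 * d + 3) * (1 * (1 / n ^ (d + 1) / (real k)\<^sup>2)))"
  proof -
    have "2 * d + 3 = (d + 2) + (d + 1)" by simp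
    then have "n ^ (2 * d + 3) = n ^ (d + 2) * n ^ (d + 1)" by (metis power_add)
    moreover have "jump_kernel (u - y) = 1 / n ^ (d + 2)" by (simp only: jump_kernel_def n_def d_def)
    ultimately show ?thesis by (simp only:) (simp add: mult_ac)
  qed
  also have "\<dots> \<le> jump_kernel (u - y) * (real d ^ 2 * B\<^sup>2 * H * 2 ^ (2 * d + 3) *
      ((indicator F u + indicator F y) * error_profile R k (u - y)))"
  proof (intro mult_left_mono mult_mono)
    show "1 \<le> (indicator F u + indicator F y :: real)" using True by simp
    show "1 / n ^ (d + 1) / (real k)\<^sup>2 \<le> error_profile R k (u - y)"
      by (simp add: error_profile_def n_def d_def)
  qed (use H n in \<open>auto simp: indicator_def\<close>)
  finally show ?thesis by (simp add: d_def)
qed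

lemma card_lattice_ball_le:
  assumes "c > 0"
  obtains A where "A > 0" "\<And>k::nat. k \<ge> 1 \<Longrightarrow>
    real (card (lattice_ball (c * real k) :: (real ^ 'd) set)) \<le> A * real k ^ CARD('d)"
proof (rule that[of "unit_ball_vol (real CARD('d)) * (c + real CARD('d)) ^ CARD('d)"])
  show "unit_ball_vol (real CARD('d)) * (c + real CARD('d)) ^ CARD('d) > 0"
    using assms by (simp add: add_pos_nonneg)
  fix k :: nat assume k: "k \<ge> 1"
  have "real (card (lattice_ball (c * real k) :: (real ^ 'd) set))
      \<le> unit_ball_vol (real CARD('d)) * (c * real k + real CARD('d)) ^ CARD('d)"
    by (rule card_lattice_ball_upper) (use assms in simp)
  also have "\<dots> \<le> unit_ball_vol (real CARD('d)) * ((c + real CARD('d)) * real k) ^ CARD('d)"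
    using k assms by (intro mult_left_mono power_mono) (auto simp: distrib_right)
  finally show "real (card (lattice_ball (c * real k) :: (real ^ 'd) set))
    \<le> unit_ball_vol (real CARD('d)) * (c + real CARD('d)) ^ CARD('d) * real k ^ CARD('d)"
    by (simp add: power_mult_distrib mult_ac)
qed

lemma infsum_finite_support:
  fixes f :: "'a \<Rightarrow> real"
  assumes "finite F" "F \<subseteq> A" "\<And>x. x \<in> A \<Longrightarrow> x \<notin> F \<Longrightarrow> f x = 0"
  shows "(f has_sum sum f F) A"
  by (rule has_sum_finite_neutralI[of F]) (use assms in auto)

text \<open>Both sides have finite support: the gradient vanishes outside radius
  \<open>M * real k\<close>, and an intermediate pair whose lens meets that ball has both ends in
  \<open>F\<close>. So \<open>three_point_identity\<close> applies and supplies the factor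
  2.\<close>

lemma fluctuation_sum:
  fixes g v :: "real ^ 'd \<Rightarrow> real"
  assumes M: "M > 0" "\<And>js x. norm x > M \<Longrightarrow> iterated_partial js g x = 0"
    and k: "k \<ge> 1" and F: "F = lattice_ball ((M + 3) * real k)"
    and \<xi>: "\<And>x y. x \<in> int_lattice \<Longrightarrow> y \<in> int_lattice \<Longrightarrow> x \<noteq> y \<Longrightarrow> \<xi> x y = \<xi> y x"
  shows "((\<lambda>(x, y). (if mid_range R k x y then jump_kernel (x - y) * \<xi> x y * lens_gradient g k x y else 0) * (v y - v x))
    has_sum 2 * (\<Sum>\<^sub>\<infinity>(x, y)\<in>int_lattice \<times> int_lattice. fluctuation_coeff \<xi> g F R k x y * (v y - v x)))
    (int_lattice \<times> int_lattice)"
proof -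
  let ?L = "int_lattice :: (real ^ 'd) set"
  have k0: "real k > 0" using k by simp
  have finF: "finite F" by (simp add: F)
  have FL: "F \<subseteq> ?L" by (auto simp: F lattice_ball_def)
  have normk: "norm (u /\<^sub>R real k) = norm u / real k" for u :: "real ^ 'd" by (simp add: divide_inverse_commute)
  have vanish: "partial_deriv i g (u /\<^sub>R real k) = 0" if "norm u > M * real k" for i and u :: "real ^ 'd"
  proof -
    have "M < norm u / real k" using that k0 by (simp add: pos_less_divide_eq)
    then have "iterated_partial [i] g (u /\<^sub>R real k) = 0" by (intro M(2)) (simp only: normk)
    then show ?thesis by simp
  qed
  have sg0: "scaled_gradient g k u z = 0" if "norm u > M * real k" for u z
    using vanish[OF that] by (simp add: scaled_gradient_def)
  have Mk: "M * real k \<le> (M + 3) * real k" using k0 by simp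
  have near: "x \<in> F" if "x \<in> ?L" "norm u \<le> M * real k" "norm (u - x) \<le> 2 * real k" for x u
  proof -
    have "norm x \<le> norm u + norm (u - x)" by (metis norm_minus_commute norm_triangle_sub)
    then show ?thesis using that k0 by (simp add: F lattice_ball_def algebra_simps)
  qed
  have lens_near: "x \<in> F \<and> y \<in> F" if "x \<in> ?L" "y \<in> ?L" "mid_range R k x y" "u \<in> lens x y" "norm u \<le> M * real k" for x y u
    using that near[of x u] near[of y u] by (auto simp: lens_def mid_range_def)
  define q where "q u x y = (if mid_range R k x y then \<xi> x y * jump_kernel (x - y) * lens_weight u x y * scaled_gradient g k u (y - x) else 0)" for u x y
  define th where "th x y = (if mid_range R k x y then jump_kernel (x - y) * \<xi> x y * lens_gradient g k x y else 0)" for x y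
  have th_q: "th x y = (\<Sum>u\<in>F. q u x y)" if xy: "x \<in> ?L" "y \<in> ?L" for x y
  proof -
    have "lens_gradient g k x y = (\<Sum>u\<in>F. lens_weight u x y * scaled_gradient g k u (y - x))"
    proof -
      have "lens_gradient g k x y = (\<Sum>u\<in>lens x y \<inter> F. lens_weight u x y * scaled_gradient g k u (y - x))"
        unfolding lens_gradient_def
      proof (rule sum.mono_neutral_right)
        show "\<forall>u\<in>lens x y - lens x y \<inter> F. lens_weight u x y * scaled_gradient g k u (y - x) = 0"
        proof
          fix u assume u: "u \<in> lens x y - lens x y \<inter> F"
          then have "norm u > (M + 3) * real k" by (auto simp: lens_def F lattice_ball_def)
          then show "lens_weight u x y * scaled_gradient g k u (y - x) = 0" using sg0[of u] Mk by simp
        qed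
      qed auto
      also have "\<dots> = (\<Sum>u\<in>F. lens_weight u x y * scaled_gradient g k u (y - x))"
        by (rule sum.mono_neutral_left) (auto simp: finF lens_weight_def)
      finally show ?thesis .
    qed
    then show ?thesis by (simp add: th_def q_def sum_distrib_left mult_ac)
  qed
  have th0: "th x y = 0" if xy: "x \<in> ?L" "y \<in> ?L" and n: "\<not> (x \<in> F \<and> y \<in> F)" for x y
  proof (cases "mid_range R k x y")
    case True
    have "lens_gradient g k x y = 0" unfolding lens_gradient_def
    proof (rule sum.neutral, intro ballI)
      fix u assume "u \<in> lens x y"
      then have "norm u > M * real k" using lens_near[OF xy True] n by (meson not_le)
      then show "lens_weight u x y * scaled_gradient g k u (y - x) = 0" by (simp add: sg0)
    qed
    then show ?thesis by (simp add: th_def)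
  qed (simp add: th_def)
  have "((\<lambda>(x, y). th x y * (v y - v x)) has_sum (\<Sum>(x, y)\<in>F \<times> F. th x y * (v y - v x))) (?L \<times> ?L)"
  proof (rule infsum_finite_support)
    fix p assume "p \<in> ?L \<times> ?L" "p \<notin> F \<times> F"
    then have "th (fst p) (snd p) = 0" by (intro th0) (auto simp: mem_Times_iff)
    then show "(case p of (x, y) \<Rightarrow> th x y * (v y - v x)) = 0" by (simp add: case_prod_unfold)
  qed (use finF FL in auto)
  also have "(\<Sum>(x, y)\<in>F \<times> F. th x y * (v y - v x)) = (\<Sum>x\<in>F. \<Sum>y\<in>F. th x y * (v y - v x))"
    by (rule sum.cartesian_product[symmetric])
  also have "\<dots> = (\<Sum>x\<in>F. \<Sum>y\<in>F. \<Sum>u\<in>F. q u x y * (v y - v x))"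
    by (intro sum.cong refl) (simp only: th_q[OF subsetD[OF FL] subsetD[OF FL]] sum_distrib_right)
  also have "\<dots> = 2 * (\<Sum>u\<in>F. \<Sum>y\<in>F. (\<Sum>x\<in>F. q u x y) * (v y - v u))"
  proof (rule three_point_identity[OF finF])
    fix u x y assume xy: "x \<in> F" "y \<in> F"
    \<comment> \<open>The gradient term is odd in the jump while the other factors are symmetric,
      hence \<open>q\<close> is antisymmetric in its two ends.\<close>
    have sg: "scaled_gradient g k u (y - x) = - scaled_gradient g k u (x - y)"
      unfolding scaled_gradient_def sum_negf[symmetric]
      by (intro sum.cong refl) (simp only: mult_minus_left[symmetric] vector_minus_component minus_diff_eq)
    show "q u x y = - q u y x"
    proof (cases "x = y")
      case False
      then show ?thesis using xy FL \<xi>[of x y]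
        by (auto simp: q_def mid_range_commute[of _ _ x y] lens_weight_commute[of u x y] jump_kernel_commute[of x y] sg)
    qed (simp add: q_def)
  qed
  also have "(\<Sum>u\<in>F. \<Sum>y\<in>F. (\<Sum>x\<in>F. q u x y) * (v y - v u))
      = (\<Sum>u\<in>F. \<Sum>y\<in>F. fluctuation_coeff \<xi> g F R k u y * (v y - v u))"
  proof (intro sum.cong refl)
    fix u y assume uy: "u \<in> F" "y \<in> F"
    show "(\<Sum>x\<in>F. q u x y) * (v y - v u) = fluctuation_coeff \<xi> g F R k u y * (v y - v u)"
    proof (cases "u = y")
      case False
      have "(\<Sum>x\<in>F. q u x y) = (\<Sum>i\<in>UNIV. partial_deriv i g (u /\<^sub>R real k) / real k * fluctuation \<xi> R k i u y)"
      \<comment> \<open>If the gradient at \<open>u\<close> vanishes, both sides are 0. Otherwise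
        every \<open>x\<close> whose lens with \<open>y\<close> contains \<open>u\<close> lies in
        \<open>F\<close>, so the sum over \<open>F\<close> is the full
        \<open>fluctuation\<close>.\<close>
      proof (cases "norm u > M * real k")
        case True
        then have "(\<Sum>x\<in>F. q u x y) = 0" by (intro sum.neutral) (simp add: q_def sg0)
        then show ?thesis using True by (simp add: vanish)
      next
        case nu: False
        have "(\<Sum>x\<in>F. q u x y) = (\<Sum>x\<in>F \<inter> {x \<in> ?L. mid_range R k x y}. q u x y)"
          using FL by (intro sum.mono_neutral_right) (auto simp: finF q_def)
        also have "\<dots> = (\<Sum>x\<in>{x \<in> ?L. mid_range R k x y}. q u x y)"
        proof (rule sum.mono_neutral_left)
          show "\<forall>x\<in>{x \<in> ?L. mid_range R k x y} - F \<inter> {x \<in> ?L. mid_range R k x y}. q u x y = 0"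
          proof
            fix x assume x: "x \<in> {x \<in> ?L. mid_range R k x y} - F \<inter> {x \<in> ?L. mid_range R k x y}"
            then have "u \<notin> lens x y" using lens_near[of x y u] nu uy FL by auto
            then show "q u x y = 0" by (simp add: q_def lens_weight_def)
          qed
        qed auto
        also have "\<dots> = (\<Sum>x\<in>{x \<in> ?L. mid_range R k x y}. \<Sum>i\<in>UNIV. partial_deriv i g (u /\<^sub>R real k) / real k *
            (lens_weight u x y * \<xi> x y * jump_kernel (x - y) * (y - x) $ i))"
          by (rule sum.cong) (auto simp: q_def scaled_gradient_def sum_distrib_left mult_ac)
        also have "\<dots> = (\<Sum>i\<in>UNIV. \<Sum>x\<in>{x \<in> ?L. mid_range R k x y}. partial_deriv i g (u /\<^sub>R real k) / real k *
            (lens_weight u x y * \<xi> x y * jump_kernel (x - y) * (y - x) $ i))"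
          by (rule sum.swap)
        finally show ?thesis by (simp only: fluctuation_def sum_distrib_left)
      qed
      then show ?thesis using uy False by (simp add: fluctuation_coeff_def)
    qed simp
  qed
  also have "\<dots> = (\<Sum>(u, y)\<in>F \<times> F. fluctuation_coeff \<xi> g F R k u y * (v y - v u))"
    by (rule sum.cartesian_product)
  also have "\<dots> = (\<Sum>\<^sub>\<infinity>(x, y)\<in>?L \<times> ?L. fluctuation_coeff \<xi> g F R k x y * (v y - v x))"
  proof (rule infsumI[symmetric], rule infsum_finite_support)
    fix p assume "p \<notin> F \<times> F"
    then have "fluctuation_coeff \<xi> g F R k (fst p) (snd p) = 0"
      by (auto simp: fluctuation_coeff_def mem_Times_iff)
    then show "(case p of (x, y) \<Rightarrow> fluctuation_coeff \<xi> g F R k x y * (v y - v x)) = 0"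
      by (simp add: case_prod_unfold)
  qed (use finF FL in auto)
  finally show ?thesis by (simp add: th_def)
qed


lemma near_row_sum:
  fixes g :: "real ^ 'd \<Rightarrow> real"
  assumes x: "x \<in> int_lattice"
  shows "(\<Sum>\<^sub>\<infinity>y\<in>int_lattice. (if norm (x - y) \<le> r then jump_kernel (x - y) else 0) * (g (y /\<^sub>R c) - g (x /\<^sub>R c)))
    = (\<Sum>z\<in>lattice_annulus 0 r. jump_kernel z * (g (x /\<^sub>R c + z /\<^sub>R c) - g (x /\<^sub>R c)))"
proof -
  let ?L = "int_lattice :: (real ^ 'd) set"
  let ?f = "\<lambda>y. (if norm (x - y) \<le> r then jump_kernel (x - y) else 0) * (g (y /\<^sub>R c) - g (x /\<^sub>R c))"
  have bij: "bij_betw (\<lambda>z. x + z) ?L ?L"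
    by (rule bij_betw_byWitness[of _ "\<lambda>y. y - x"]) (auto simp: x int_lattice_add int_lattice_diff)
  have "infsum ?f ?L = (\<Sum>\<^sub>\<infinity>z\<in>?L. ?f (x + z))" by (rule infsum_reindex_bij_betw[OF bij, symmetric])
  also have "\<dots> = (\<Sum>z\<in>lattice_annulus 0 r. ?f (x + z))"
    by (rule infsumI, rule infsum_finite_support[OF finite_lattice_annulus]) (auto simp: lattice_annulus_def)
  also have "\<dots> = (\<Sum>z\<in>lattice_annulus 0 r. jump_kernel z * (g (x /\<^sub>R c + z /\<^sub>R c) - g (x /\<^sub>R c)))"
    by (rule sum.cong) (auto simp: lattice_annulus_def scaleR_add_right)
  finally show ?thesis .
qed

text \<open>All randomness is confined to the hypothesis on \<open>fluctuation\<close>.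
  \<open>C\<close> and \<open>M\<close> are fixed before \<open>k\<close>, \<open>R\<close>,
  \<open>wt\<close> and \<open>U\<close>, so the constant is non-random and \<open>R\<close> may be
  chosen for each \<open>k\<close> separately.\<close>

theorem deterministic_estimate:
  fixes g :: "real ^ 'd \<Rightarrow> real"
  assumes g: "smooth_compact_support g" and d2: "CARD('d) \<ge> 2" and l: "l > 0" and C1: "0 < C1" and C2: "C1 \<le> C2" and H: "H \<ge> 0"
  obtains C M where "C > 0" "M > 0"
    "\<And>k R wt U. k \<ge> 2 \<Longrightarrow> 1 \<le> R \<Longrightarrow> R \<le> real k \<Longrightarrow>
       (\<And>x y. x \<in> int_lattice \<Longrightarrow> y \<in> int_lattice \<Longrightarrow> x \<noteq> y \<Longrightarrow> wt x y = wt y x \<and> C1 \<le> wt x y \<and> wt x y \<le> C2) \<Longrightarrow>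
       (\<And>i u y. u \<in> lattice_ball ((M + 3) * real k) \<Longrightarrow> y \<in> lattice_ball ((M + 3) * real k) \<Longrightarrow>
         (fluctuation (\<lambda>x y. wt x y - 1) R k i u y)\<^sup>2
          \<le> H * R ^ (CARD('d) - 2) / max R (norm (u - y) / 2) ^ (3 * CARD('d) + 1)) \<Longrightarrow>
       (\<lambda>x. (U x)\<^sup>2) summable_on int_lattice \<Longrightarrow>
       (\<And>x. x \<in> int_lattice \<Longrightarrow> l * U x
          - (\<Sum>\<^sub>\<infinity>y\<in>int_lattice. (real k ^ 2 / ln (real k) * (wt x y * jump_kernel (x - y))) * (U y - U x))
          = l * g (x /\<^sub>R real k) - limit_generator g (x /\<^sub>R real k)) \<Longrightarrow>
       (\<lambda>x. (U x - g (x /\<^sub>R real k))\<^sup>2) summable_on int_lattice \<and>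
       (\<Sum>\<^sub>\<infinity>x\<in>int_lattice. (U x - g (x /\<^sub>R real k))\<^sup>2) \<le> C * real k ^ CARD('d) * (1 + ln R) / ln (real k)"
proof -
  let ?L = "int_lattice :: (real ^ 'd) set"
  define d where "d = CARD('d)"
  have C2_0: "C2 \<ge> 0" using C1 C2 by simp
  obtain B where B: "B > 0" "\<And>js x. length js \<le> 3 \<Longrightarrow> \<bar>iterated_partial js g x\<bar> \<le> B"
    by (rule smooth_compact_support_bounded[OF g]) blast
  obtain M where M: "M > 0" "\<And>js x. norm x > M \<Longrightarrow> iterated_partial js g x = 0"
    by (rule smooth_compact_support_vanish[OF g]) blast
  obtain A where A: "A > 0"
    "\<And>R k. k \<ge> 1 \<Longrightarrow> 1 \<le> R \<Longrightarrow> R \<le> real k \<Longrightarrow> (error_profile R k :: real ^ 'd \<Rightarrow> real) summable_on int_lattice"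
    "\<And>R k. k \<ge> 1 \<Longrightarrow> 1 \<le> R \<Longrightarrow> R \<le> real k \<Longrightarrow>
      (\<Sum>\<^sub>\<infinity>z\<in>?L. error_profile R k z) \<le> A * (1 + ln R) / (real k)\<^sup>2"
    using error_profile_bound[OF d2] by blast
  obtain N where N: "N > 0" "\<And>k::nat. k \<ge> 1 \<Longrightarrow>
    real (card (lattice_ball ((M + 3) * real k) :: (real ^ 'd) set)) \<le> N * real k ^ d"
    using card_lattice_ball_le[where 'd='d and c="M + 3"] M(1) unfolding d_def by (metis add_pos_pos zero_less_numeral)
  obtain Cn where Cn: "Cn > 0" "\<And>k x. k \<ge> 2 \<Longrightarrow>
     \<bar>real k ^ 2 / ln (real k) * (\<Sum>z\<in>lattice_annulus 0 (real k). jump_kernel z * (g (x + z /\<^sub>R real k) - g x))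
       - limit_generator g x\<bar> \<le> Cn / ln (real k)"
    using homogeneous_near_generator[OF g] by blast
  define Cr where "Cr = ((C2 + 1) * (3 * real d ^ 2 * B + 2 * B))\<^sup>2"
  define Cf where "Cf = real d ^ 2 * B\<^sup>2 * H * 2 ^ (2 * d + 3)"
  define Ce where "Ce = 2 * Cr + 8 * Cf"
  have Cr0: "Cr \<ge> 0" and Cf0: "Cf \<ge> 0" using H by (auto simp: Cr_def Cf_def)
  \<comment> \<open>The first summand stems from the consistency error with conductances 1, the
    second from Young's inequality for the error coefficients; the 1 secures positivity.\<close>
  define C where "C = (1 / l) * (Cn\<^sup>2 * N / ln 2 / l + Ce * N * A / C1 + 1)"
  show ?thesis
  proof (rule that[of C M])
    have "0 \<le> Cn\<^sup>2 * N / ln 2 / l + Ce * N * A / C1" using Cn N A C1 l Cr0 Cf0 by (simp add: Ce_def)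
    then show "C > 0" unfolding C_def using l by (intro mult_pos_pos) auto
    show "M > 0" by (rule M(1))
    fix k :: nat and R :: real and wt U
    assume k: "k \<ge> 2" and R: "1 \<le> R" "R \<le> real k"
      and wt: "\<And>x y. x \<in> ?L \<Longrightarrow> y \<in> ?L \<Longrightarrow> x \<noteq> y \<Longrightarrow> wt x y = wt y x \<and> C1 \<le> wt x y \<and> wt x y \<le> C2"
      and fl: "\<And>i u y. u \<in> lattice_ball ((M + 3) * real k) \<Longrightarrow> y \<in> lattice_ball ((M + 3) * real k) \<Longrightarrow>
         (fluctuation (\<lambda>x y. wt x y - 1) R k i u y)\<^sup>2
          \<le> H * R ^ (CARD('d) - 2) / max R (norm (u - y) / 2) ^ (3 * CARD('d) + 1)"
      and U: "(\<lambda>x. (U x)\<^sup>2) summable_on ?L"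
      and eq: "\<And>x. x \<in> ?L \<Longrightarrow> l * U x
          - (\<Sum>\<^sub>\<infinity>y\<in>?L. (real k ^ 2 / ln (real k) * (wt x y * jump_kernel (x - y))) * (U y - U x))
          = l * g (x /\<^sub>R real k) - limit_generator g (x /\<^sub>R real k)"
    have k1: "k \<ge> 1" and k0: "real k > 0" and lk: "ln (real k) > 0" using k by auto
    define F where "F = (lattice_ball ((M + 3) * real k) :: (real ^ 'd) set)"
    have finF: "finite F" by (simp add: F_def)
    have FL: "F \<subseteq> ?L" by (auto simp: F_def lattice_ball_def)
    define \<kappa> where "\<kappa> = real k ^ 2 / ln (real k)"
    have \<kappa>: "\<kappa> > 0" using k0 lk by (simp add: \<kappa>_def)
    define \<xi> where "\<xi> x y = wt x y - 1" for x y
    define G where "G x = g (x /\<^sub>R real k)" for x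
    define v where "v x = U x - G x" for x
    define K where "K x y = jump_kernel (x - y)" for x y :: "real ^ 'd"
    define a where "a x y = \<kappa> * (wt x y * K x y)" for x y
    define b where "b x y = (if norm (x - y) \<le> real k then K x y else 0)" for x y
    have normk: "norm (u /\<^sub>R real k) = norm u / real k" for u :: "real ^ 'd" by (simp add: divide_inverse_commute)
    have vanish: "iterated_partial js g (u /\<^sub>R real k) = 0" if "norm u > M * real k" for js u
    proof (rule M(2))
      have "M < norm u / real k" using that k0 by (simp add: pos_less_divide_eq)
      then show "M < norm (u /\<^sub>R real k)" by (simp only: normk)
    qed
    have outF: "norm u > (M + 1) * real k" if "u \<in> ?L" "u \<notin> F" for u
      using that k0 by (auto simp: F_def lattice_ball_def algebra_simps)
    have G0: "G u = 0" if "norm u > M * real k" for u using vanish[OF that, of "[]"] by (simp add: G_def)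
    have Lg0: "limit_generator g (u /\<^sub>R real k) = 0" if "norm u > M * real k" for u
      unfolding limit_generator_iterated using vanish[OF that] by (simp del: iterated_partial_simps)
    have MM: "M * real k \<le> (M + 1) * real k" using k0 by simp
    have G2: "(\<lambda>x. (G x)\<^sup>2) summable_on ?L"
      by (rule has_sum_imp_summable, rule infsum_finite_support[OF finF FL]) (use G0 outF MM in force)
    have v2: "(\<lambda>x. (v x)\<^sup>2) summable_on ?L" unfolding v_def by (rule square_summable_diff[OF U G2])
    have K0: "K x y \<ge> 0" for x y by (simp add: K_def)
    have a_bd: "0 \<le> a x y \<and> a x y \<le> \<kappa> * C2 * jump_kernel (x - y)" if "x \<in> ?L" "y \<in> ?L" for x y
    proof (cases "x = y")
      case False
      then show ?thesis using wt[OF that False] C1 \<kappa> K0[of x y]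
        by (auto simp: a_def K_def mult_right_mono mult.assoc)
    qed (simp add: a_def K_def)
    have a_abs: "\<bar>a x y\<bar> \<le> \<kappa> * C2 * jump_kernel (x - y)" if "x \<in> ?L" "y \<in> ?L" for x y
      using a_bd[OF that] by simp
    have a_sym: "a x y = a y x" if "x \<in> ?L" "y \<in> ?L" for x y
      using wt[OF that] by (cases "x = y") (auto simp: a_def K_def jump_kernel_commute[of x y])
    have b_abs: "\<bar>b x y\<bar> \<le> 1 * jump_kernel (x - y)" for x y by (simp add: b_def K_def)
    have b_sym: "b x y = b y x" for x y by (simp add: b_def K_def norm_minus_commute jump_kernel_commute[of x y])
    have \<kappa>C2: "\<kappa> * C2 \<ge> 0" using \<kappa> C2_0 by simp
    have rows: "(\<lambda>y. a x y * (p y - p x)) summable_on ?L"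
      if "(\<lambda>x. (p x)\<^sup>2) summable_on ?L" "x \<in> ?L" for p x
      by (rule kernel_row_summable[OF that \<kappa>C2]) (rule a_abs[OF that(2)])
    \<comment> \<open>Consistency error for conductances 1 and jumps up to \<open>k\<close>. It is
      bounded on the lattice and vanishes outside \<open>F\<close>.\<close>
    define r where "r x = \<kappa> * (\<Sum>\<^sub>\<infinity>y\<in>?L. b x y * (G y - G x)) - limit_generator g (x /\<^sub>R real k)" for x
    have r_bd: "\<bar>r x\<bar> \<le> Cn / ln (real k)" if "x \<in> ?L" for x
      using Cn(2)[OF k, of "x /\<^sub>R real k"] unfolding r_def b_def K_def G_def near_row_sum[OF that] \<kappa>_def .
    have r0: "r x = 0" if x: "x \<in> ?L" "x \<notin> F" for x
    proof -
      have nx: "norm x > (M + 1) * real k" by (rule outF[OF x])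
      have "(\<Sum>\<^sub>\<infinity>y\<in>?L. b x y * (G y - G x)) = (\<Sum>\<^sub>\<infinity>y\<in>?L. 0)"
      proof (rule infsum_cong)
        fix y assume "y \<in> ?L"
        show "b x y * (G y - G x) = 0"
        proof (cases "norm (x - y) \<le> real k")
          case True
          have "norm x \<le> norm y + norm (x - y)" by (rule norm_triangle_sub)
          then have "norm y > M * real k" using True nx by (simp add: algebra_simps)
          then show ?thesis using G0[of x] G0[of y] nx MM by simp
        qed (simp add: b_def)
      qed
      then show ?thesis using Lg0[of x] nx MM by (simp add: r_def)
    qed
    \<comment> \<open>\<open>v\<close> solves the discrete equation with the consistency error of
      \<open>g\<close> as right-hand side.\<close>
    have rhs: "l * v x - (\<Sum>\<^sub>\<infinity>y\<in>?L. a x y * (v y - v x))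
        = (\<Sum>\<^sub>\<infinity>y\<in>?L. a x y * (G y - G x)) - limit_generator g (x /\<^sub>R real k)" if x: "x \<in> ?L" for x
    proof -
      have "(\<Sum>\<^sub>\<infinity>y\<in>?L. a x y * (v y - v x)) = (\<Sum>\<^sub>\<infinity>y\<in>?L. a x y * (U y - U x) + - (a x y * (G y - G x)))"
        by (rule infsum_cong) (simp add: v_def algebra_simps)
      also have "\<dots> = (\<Sum>\<^sub>\<infinity>y\<in>?L. a x y * (U y - U x)) - (\<Sum>\<^sub>\<infinity>y\<in>?L. a x y * (G y - G x))"
        using infsum_add[OF rows[OF U x] summable_on_uminus[THEN iffD2, OF rows[OF G2 x]]] x
        by (simp add: infsum_uminus)
      finally show ?thesis using eq[OF x] by (simp add: v_def G_def a_def \<kappa>_def K_def algebra_simps)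
    qed
    define Ea where "Ea = (\<Sum>\<^sub>\<infinity>(x, y)\<in>?L \<times> ?L. a x y * (v y - v x)\<^sup>2)"
    define Ba where "Ba = (\<Sum>\<^sub>\<infinity>(x, y)\<in>?L \<times> ?L. a x y * ((G y - G x) * (v y - v x)))"
    define Bb where "Bb = (\<Sum>\<^sub>\<infinity>(x, y)\<in>?L \<times> ?L. b x y * ((G y - G x) * (v y - v x)))"
    define V where "V = (\<Sum>\<^sub>\<infinity>x\<in>?L. (v x)\<^sup>2)"
    define D where "D = (\<Sum>\<^sub>\<infinity>(x, y)\<in>?L \<times> ?L. jump_kernel (x - y) * (v y - v x)\<^sup>2)"
    have e1: "((\<lambda>x. v x * ((\<Sum>\<^sub>\<infinity>y\<in>?L. a x y * (G y - G x)) - limit_generator g (x /\<^sub>R real k))) has_sum l * V + 1 / 2 * Ea) ?L"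
    proof -
      have "((\<lambda>x. v x * (l * v x - (\<Sum>\<^sub>\<infinity>y\<in>?L. a x y * (v y - v x)))) has_sum l * V + 1 / 2 * Ea) ?L"
        unfolding V_def Ea_def by (rule energy_identity[OF v2 a_abs a_sym \<kappa>C2])
      then show ?thesis by (rule has_sum_cong[THEN iffD1, rotated]) (simp add: rhs)
    qed
    have e2: "((\<lambda>x. v x * (\<Sum>\<^sub>\<infinity>y\<in>?L. a x y * (G y - G x))) has_sum - (1 / 2) * Ba) ?L"
      unfolding Ba_def by (rule summation_by_parts[OF G2 v2 a_abs a_sym \<kappa>C2])
    have e3: "((\<lambda>x. v x * (\<Sum>\<^sub>\<infinity>y\<in>?L. b x y * (G y - G x))) has_sum - (1 / 2) * Bb) ?L"
      unfolding Bb_def by (rule summation_by_parts[OF G2 v2 b_abs b_sym]) simp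
    have e4: "((\<lambda>x. v x * r x) has_sum (\<Sum>x\<in>F. v x * r x)) ?L"
      by (rule infsum_finite_support[OF finF FL]) (simp add: r0)
    \<comment> \<open>The operator with conductances 1 and jumps up to \<open>k\<close> is added and
      subtracted: \<open>r\<close> holds its distance from the limit generator, \<open>Ba\<close>
      and \<open>Bb\<close> the difference of the two discrete operators.\<close>
    have "((\<lambda>x. v x * (\<Sum>\<^sub>\<infinity>y\<in>?L. a x y * (G y - G x)) + (v x * r x + - (\<kappa> * (v x * (\<Sum>\<^sub>\<infinity>y\<in>?L. b x y * (G y - G x))))))
        has_sum - (1 / 2) * Ba + ((\<Sum>x\<in>F. v x * r x) + - (\<kappa> * (- (1 / 2) * Bb)))) ?L"
      by (intro has_sum_add has_sum_uminusI has_sum_cmult_right e2 e3 e4)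
    then have "((\<lambda>x. v x * ((\<Sum>\<^sub>\<infinity>y\<in>?L. a x y * (G y - G x)) - limit_generator g (x /\<^sub>R real k)))
        has_sum - (1 / 2) * Ba + ((\<Sum>x\<in>F. v x * r x) + - (\<kappa> * (- (1 / 2) * Bb)))) ?L"
      by (rule has_sum_cong[THEN iffD1, rotated]) (simp add: r_def algebra_simps)
    from has_sum_unique[OF e1 this]
    have "l * V + 1 / 2 * Ea = - (1 / 2) * Ba + ((\<Sum>x\<in>F. v x * r x) + - (\<kappa> * (- (1 / 2) * Bb)))" .
    moreover have "s = t - 1 / 2 * (p - q * p')" if "s = - (1 / 2) * p + (t + - (q * (- (1 / 2) * p')))" for s t p p' q :: real
      using that by (simp add: field_simps)
    ultimately have energy: "l * V + 1 / 2 * Ea = (\<Sum>x\<in>F. v x * r x) - 1 / 2 * (Ba - \<kappa> * Bb)" by blast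

    define e where "e x y = (indicator F x + indicator F y) * error_profile R k (x - y)" for x y
    have e0: "e x y \<ge> 0" for x y using error_profile_nonneg[of R k "x - y"] by (auto simp: e_def indicator_def)
    note prof = A(2)[OF k1 R] A(3)[OF k1 R]
    note esum = summable_on_finite_rows[OF finF FL prof(1) error_profile_nonneg error_profile_minus]
    have e_sum: "(\<lambda>(x, y). e x y) summable_on ?L \<times> ?L" using esum(1) by (simp add: e_def)
    have e_val: "(\<Sum>\<^sub>\<infinity>(x, y)\<in>?L \<times> ?L. e x y) \<le> 2 * (N * real k ^ d) * (A * (1 + ln R) / (real k)\<^sup>2)"
    proof -
      have "(\<Sum>\<^sub>\<infinity>(x, y)\<in>?L \<times> ?L. e x y) = 2 * real (card F) * (\<Sum>\<^sub>\<infinity>z\<in>?L. error_profile R k z)"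
        using esum(2) by (simp add: e_def)
      also have "\<dots> \<le> 2 * (N * real k ^ d) * (A * (1 + ln R) / (real k)\<^sup>2)"
        using N(2)[OF k1] prof(2) N(1) k0 by (intro mult_mono) (auto simp: F_def infsum_nonneg error_profile_nonneg)
      finally show ?thesis .
    qed
    define c1 where "c1 = remainder_coeff wt g R k"
    define c2 where "c2 = fluctuation_coeff \<xi> g F R k"
    have c1_bd: "(c1 x y)\<^sup>2 \<le> jump_kernel (x - y) * (Cr * e x y)" if "x \<in> ?L" "y \<in> ?L" for x y
      unfolding c1_def Cr_def e_def d_def
      by (rule remainder_coeff_bound[OF g B(2) M k1 R that _ C2_0 F_def]) (use wt[OF that] C1 in auto)
    have c2_bd: "(c2 x y)\<^sup>2 \<le> jump_kernel (x - y) * (Cf * e x y)" for x y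
      unfolding c2_def Cf_def e_def d_def
      by (rule fluctuation_coeff_bound[OF d2 B(2) k1 R(1) H]) (use fl in \<open>auto simp: \<xi>_def[abs_def] F_def\<close>)
    \<comment> \<open>The 2 comes from the symmetrisation in \<open>fluctuation_sum\<close>.\<close>
    define c where "c x y = c1 x y + 2 * c2 x y" for x y
    have c_bd: "(c x y)\<^sup>2 \<le> jump_kernel (x - y) * (Ce * e x y)" if "x \<in> ?L" "y \<in> ?L" for x y
    proof -
      have "(c x y)\<^sup>2 \<le> 2 * (c1 x y)\<^sup>2 + 8 * (c2 x y)\<^sup>2"
        using zero_le_power2[of "c1 x y - 2 * c2 x y"] unfolding c_def power2_diff power2_sum by (simp add: algebra_simps)
      also have "\<dots> \<le> 2 * (jump_kernel (x - y) * (Cr * e x y)) + 8 * (jump_kernel (x - y) * (Cf * e x y))"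
        using c1_bd[OF that] c2_bd[of x y] by (intro add_mono mult_left_mono) auto
      also have "\<dots> = jump_kernel (x - y) * (Ce * e x y)" by (simp add: Ce_def algebra_simps)
      finally show ?thesis .
    qed
    have es: "(\<lambda>(x, y). z * e x y) summable_on ?L \<times> ?L" for z
      using summable_on_cmult_right[OF e_sum, of z] by (simp add: case_prod_unfold)
    have z0: "z \<ge> 0 \<Longrightarrow> z * e x y \<ge> 0" for z x y using e0 by simp
    have S1: "(\<lambda>(x, y). c1 x y * (v y - v x)) summable_on ?L \<times> ?L"
      by (rule weighted_young(1)[OF v2 c1_bd es z0[OF Cr0] zero_less_one])
    have S2: "(\<lambda>(x, y). c2 x y * (v y - v x)) summable_on ?L \<times> ?L"
      by (rule weighted_young(1)[OF v2 c2_bd es z0[OF Cf0] zero_less_one])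
    have Ce0: "Ce \<ge> 0" using Cr0 Cf0 by (simp add: Ce_def)
    define S where "S = (\<Sum>\<^sub>\<infinity>(x, y)\<in>?L \<times> ?L. c x y * (v y - v x))"
    \<comment> \<open>The Young parameter is the lower ellipticity constant: multiplied by
      \<open>\<kappa> / 2\<close>, the energy term is at most half of \<open>Ea\<close> by
      \<open>ED\<close>.\<close>
    have S_bd: "\<bar>S\<bar> \<le> C1 * D + 1 / (4 * C1) * (\<Sum>\<^sub>\<infinity>(x, y)\<in>?L \<times> ?L. Ce * e x y)"
      unfolding S_def D_def by (rule weighted_young(2)[OF v2 c_bd es z0[OF Ce0] C1])
    have Ee: "(\<Sum>\<^sub>\<infinity>(x, y)\<in>?L \<times> ?L. Ce * e x y) = Ce * (\<Sum>\<^sub>\<infinity>(x, y)\<in>?L \<times> ?L. e x y)"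
      using infsum_cmult_right'[of Ce "\<lambda>(x, y). e x y" "?L \<times> ?L"] by (simp add: case_prod_unfold)

    have split: "Ba - \<kappa> * Bb = \<kappa> * S"
    proof -
      have bsum: "(\<lambda>(x, y). b x y * ((G y - G x) * (v y - v x))) summable_on ?L \<times> ?L"
      proof (rule kernel_product_summable[OF G2 v2 b_abs, where c = 4])
        fix x y
        have "\<bar>(G y - G x) * (v y - v x)\<bar> \<le> (G y - G x)\<^sup>2 + (v y - v x)\<^sup>2" by (rule abs_mult_le_squares)
        also have "\<dots> \<le> 2 * ((G x)\<^sup>2 + (G y)\<^sup>2) + 2 * ((v x)\<^sup>2 + (v y)\<^sup>2)"
          using zero_le_power2[of "G x + G y"] zero_le_power2[of "v x + v y"]
          unfolding power2_diff power2_sum by (simp add: algebra_simps)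
        also have "\<dots> \<le> 4 * ((G x)\<^sup>2 + (G y)\<^sup>2 + (v x)\<^sup>2 + (v y)\<^sup>2)" by simp
        finally show "\<bar>(G y - G x) * (v y - v x)\<bar> \<le> 4 * ((G x)\<^sup>2 + (G y)\<^sup>2 + (v x)\<^sup>2 + (v y)\<^sup>2)" .
      qed simp
      define th where "th x y = (if mid_range R k x y then K x y * \<xi> x y * lens_gradient g k x y else 0)" for x y
      have th: "((\<lambda>(x, y). th x y * (v y - v x)) has_sum 2 * (\<Sum>\<^sub>\<infinity>(x, y)\<in>?L \<times> ?L. c2 x y * (v y - v x))) (?L \<times> ?L)"
        unfolding th_def c2_def K_def by (rule fluctuation_sum[OF M k1 F_def]) (use wt in \<open>auto simp: \<xi>_def\<close>)
      have H1: "((\<lambda>p. (\<lambda>(x, y). b x y * ((G y - G x) * (v y - v x))) p + ((\<lambda>(x, y). c1 x y * (v y - v x)) p + (\<lambda>(x, y). th x y * (v y - v x)) p))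
          has_sum Bb + ((\<Sum>\<^sub>\<infinity>(x, y)\<in>?L \<times> ?L. c1 x y * (v y - v x)) + 2 * (\<Sum>\<^sub>\<infinity>(x, y)\<in>?L \<times> ?L. c2 x y * (v y - v x)))) (?L \<times> ?L)"
        unfolding Bb_def by (intro has_sum_add has_sum_infsum bsum S1 th)
      \<comment> \<open>\<open>remainder_coeff\<close> is defined so that this decomposition into
        mean, remainder and fluctuation holds in every range of the jump.\<close>
      have ptw: "a x y * ((G y - G x) * (v y - v x)) = \<kappa> * (b x y * ((G y - G x) * (v y - v x)) + (c1 x y * (v y - v x) + th x y * (v y - v x)))" for x y
        by (simp add: a_def b_def c1_def th_def remainder_coeff_def K_def \<xi>_def G_def algebra_simps)
      have "Ba = \<kappa> * (Bb + ((\<Sum>\<^sub>\<infinity>(x, y)\<in>?L \<times> ?L. c1 x y * (v y - v x)) + 2 * (\<Sum>\<^sub>\<infinity>(x, y)\<in>?L \<times> ?L. c2 x y * (v y - v x))))"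
        unfolding Ba_def ptw
        by (rule infsumI) (use has_sum_cmult_right[OF H1, of \<kappa>] in \<open>simp add: case_prod_unfold\<close>)
      moreover have "S = (\<Sum>\<^sub>\<infinity>(x, y)\<in>?L \<times> ?L. c1 x y * (v y - v x)) + 2 * (\<Sum>\<^sub>\<infinity>(x, y)\<in>?L \<times> ?L. c2 x y * (v y - v x))"
        unfolding S_def
        by (rule infsumI)
           (use has_sum_add[OF has_sum_infsum[OF S1] has_sum_cmult_right[OF has_sum_infsum[OF S2], of 2]]
            in \<open>simp add: case_prod_unfold c_def algebra_simps\<close>)
      ultimately show ?thesis by (simp add: algebra_simps)
    qed
    \<comment> \<open>Ellipticity: the weights are at least \<open>C1\<close>, so the kernel energy
      is dominated by the random one.\<close>
    have ED: "\<kappa> * C1 * D \<le> Ea"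
    proof -
      have DS: "(\<lambda>(x, y). jump_kernel (x - y) * (v y - v x)\<^sup>2) summable_on ?L \<times> ?L"
        by (rule energy_summable[OF v2, where C = 1]) auto
      have ES: "(\<lambda>(x, y). a x y * (v y - v x)\<^sup>2) summable_on ?L \<times> ?L"
        by (rule energy_summable[OF v2 a_abs \<kappa>C2])
      have "\<kappa> * C1 * D = (\<Sum>\<^sub>\<infinity>p\<in>?L \<times> ?L. \<kappa> * C1 * (\<lambda>(x, y). jump_kernel (x - y) * (v y - v x)\<^sup>2) p)"
        unfolding D_def by (rule infsum_cmult_right'[symmetric])
      also have "\<dots> \<le> Ea" unfolding Ea_def
      proof (rule infsum_mono[OF summable_on_cmult_right[OF DS] ES])
        fix p assume "p \<in> ?L \<times> ?L"
        then obtain x y where p: "p = (x, y)" "x \<in> ?L" "y \<in> ?L" by auto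
        have "\<kappa> * C1 * jump_kernel (x - y) \<le> a x y"
        proof (cases "x = y")
          case False
          have "C1 * jump_kernel (x - y) \<le> wt x y * jump_kernel (x - y)"
            using wt[OF p(2,3) False] by (intro mult_right_mono) auto
          then show ?thesis using \<kappa> by (simp add: a_def K_def mult.assoc)
        qed (simp add: a_def K_def)
        then have "\<kappa> * C1 * jump_kernel (x - y) * (v y - v x)\<^sup>2 \<le> a x y * (v y - v x)\<^sup>2"
          by (rule mult_right_mono) simp
        then show "\<kappa> * C1 * (case p of (x, y) \<Rightarrow> jump_kernel (x - y) * (v y - v x)\<^sup>2) \<le> (case p of (x, y) \<Rightarrow> a x y * (v y - v x)\<^sup>2)"
          by (simp add: p mult.assoc)
      qed
      finally show ?thesis .
    qed
    \<comment> \<open>Young's inequality with weight \<open>l / 2\<close>: half of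
      \<open>l * V\<close> is given up, and \<open>r\<close> costs its squared supremum times the
      number of points of \<open>F\<close>.\<close>
    have R1: "(\<Sum>x\<in>F. v x * r x) \<le> l / 2 * V + 1 / (2 * l) * (N * real k ^ d * (Cn / ln (real k))\<^sup>2)"
    proof -
      have "(\<Sum>x\<in>F. v x * r x) \<le> (\<Sum>x\<in>F. l / 2 * (v x)\<^sup>2 + 1 / (2 * l) * (Cn / ln (real k))\<^sup>2)"
      proof (rule sum_mono)
        fix x assume "x \<in> F"
        then have "\<bar>r x\<bar> \<le> Cn / ln (real k)" using FL by (intro r_bd) auto
        then have r2: "(r x)\<^sup>2 \<le> (Cn / ln (real k))\<^sup>2" by (rule power2_le_iff_abs_le[THEN iffD2, rotated]) (use Cn lk in simp)
        have "0 \<le> (l * v x - r x)\<^sup>2" by simp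
        then have "2 * l * (v x * r x) \<le> l\<^sup>2 * (v x)\<^sup>2 + (r x)\<^sup>2" by (simp add: power2_diff power_mult_distrib)
        also have "\<dots> \<le> l\<^sup>2 * (v x)\<^sup>2 + (Cn / ln (real k))\<^sup>2" using r2 by simp
        finally have "v x * r x \<le> (l\<^sup>2 * (v x)\<^sup>2 + (Cn / ln (real k))\<^sup>2) / (2 * l)"
          using l by (simp add: pos_le_divide_eq mult.commute)
        also have "\<dots> = l / 2 * (v x)\<^sup>2 + 1 / (2 * l) * (Cn / ln (real k))\<^sup>2"
          using l by (simp add: add_divide_distrib power2_eq_square)
        finally show "v x * r x \<le> l / 2 * (v x)\<^sup>2 + 1 / (2 * l) * (Cn / ln (real k))\<^sup>2" .
      qed
      also have "\<dots> = l / 2 * (\<Sum>x\<in>F. (v x)\<^sup>2) + 1 / (2 * l) * (real (card F) * (Cn / ln (real k))\<^sup>2)"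
        by (simp add: sum.distrib sum_distrib_left)
      also have "\<dots> \<le> l / 2 * V + 1 / (2 * l) * (N * real k ^ d * (Cn / ln (real k))\<^sup>2)"
        unfolding V_def using l N(2)[OF k1] finite_sum_le_infsum[OF v2 finF FL]
        by (intro add_mono mult_left_mono mult_right_mono) (auto simp: F_def)
      finally show ?thesis .
    qed
    define Q where "Q = Ce * (2 * (N * real k ^ d) * (A * (1 + ln R) / (real k)\<^sup>2))"
    have S_bd': "- S \<le> C1 * D + 1 / (4 * C1) * Q"
    proof -
      have "1 / (4 * C1) * (\<Sum>\<^sub>\<infinity>(x, y)\<in>?L \<times> ?L. Ce * e x y) \<le> 1 / (4 * C1) * Q"
        unfolding Ee Q_def using C1 Ce0 e_val by (intro mult_left_mono) auto
      then show ?thesis using S_bd by linarith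
    qed
    have "l * V + 1 / 2 * Ea = (\<Sum>x\<in>F. v x * r x) + \<kappa> / 2 * (- S)" unfolding energy split by simp
    also have "\<dots> \<le> (\<Sum>x\<in>F. v x * r x) + \<kappa> / 2 * (C1 * D + 1 / (4 * C1) * Q)"
      using S_bd' \<kappa> by (intro add_left_mono mult_left_mono) auto
    also have "\<kappa> / 2 * (C1 * D + 1 / (4 * C1) * Q) = \<kappa> * C1 * D / 2 + \<kappa> * Q / (8 * C1)"
      by (simp add: distrib_left)
    finally have en: "l * V + 1 / 2 * Ea \<le> (\<Sum>x\<in>F. v x * r x) + (\<kappa> * C1 * D / 2 + \<kappa> * Q / (8 * C1))" .
    have lR: "1 \<le> 1 + ln R" using R by simp
    define Z where "Z = real k ^ d * (1 + ln R) / ln (real k)"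
    have Z0: "Z \<ge> 0" unfolding Z_def using lR lk by simp
    \<comment> \<open>One of the two factors 1/ln k is bounded by a constant: the consistency error
      with conductances 1 is of smaller order than the target.\<close>
    have t1: "N * real k ^ d * (Cn / ln (real k))\<^sup>2 \<le> Cn\<^sup>2 * N / ln 2 * Z"
    proof -
      have "1 / ln (real k) \<le> 1 / ln 2" using k by (intro divide_left_mono mult_pos_pos) auto
      also have "\<dots> = 1 / ln 2 * 1" by simp
      also have "\<dots> \<le> 1 / ln 2 * (1 + ln R)" using lR by (intro mult_left_mono) auto
      finally have "Cn\<^sup>2 * N * real k ^ d / ln (real k) * (1 / ln (real k)) \<le> Cn\<^sup>2 * N * real k ^ d / ln (real k) * ((1 / ln 2) * (1 + ln R))"
        using N lk by (intro mult_left_mono) auto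
      moreover have "N * real k ^ d * (Cn / ln (real k))\<^sup>2 = Cn\<^sup>2 * N * real k ^ d / ln (real k) * (1 / ln (real k))"
        by (simp add: power_divide power2_eq_square)
      moreover have "Cn\<^sup>2 * N / ln 2 * Z = Cn\<^sup>2 * N * real k ^ d / ln (real k) * ((1 / ln 2) * (1 + ln R))"
        by (simp add: Z_def mult_ac)
      ultimately show ?thesis by (simp only:)
    qed
    have t2: "\<kappa> * Q / (8 * C1) = Ce * N * A / C1 / 4 * Z"
    proof -
      have "\<kappa> * (A * (1 + ln R) / (real k)\<^sup>2) = A * (1 + ln R) / ln (real k)" using k0 by (simp add: \<kappa>_def)
      moreover have "\<kappa> * Q = 2 * Ce * N * real k ^ d * (\<kappa> * (A * (1 + ln R) / (real k)\<^sup>2))"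
        by (simp add: Q_def)
      ultimately have "\<kappa> * Q = 2 * Ce * N * real k ^ d * (A * (1 + ln R) / ln (real k))" by (simp only:)
      then show ?thesis by (simp add: Z_def mult_ac)
    qed
    define Y where "Y = 1 / (2 * l) * (Cn\<^sup>2 * N / ln 2 * Z)"
    have Y: "1 / (2 * l) * (N * real k ^ d * (Cn / ln (real k))\<^sup>2) \<le> Y"
      unfolding Y_def using t1 l by (intro mult_left_mono) auto
    have lV: "l / 2 * V = l * V / 2" by simp
    have R1': "(\<Sum>x\<in>F. v x * r x) \<le> l * V / 2 + Y"
      using R1 Y unfolding lV by linarith
    \<comment> \<open>The half of \<open>Ea\<close> cancels the energy spent in Young's inequality,
      and half of \<open>l * V\<close> remains.\<close>
    have fin: "p / 2 \<le> y + q" if "p + 1 / 2 * ea \<le> s + (x / 2 + q)" "s \<le> p / 2 + y" "x \<le> ea" for p ea s x q y :: real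
      using that by linarith
    have "l * V / 2 \<le> Y + \<kappa> * Q / (8 * C1)" by (rule fin[OF en R1' ED])
    then have "V \<le> 2 / l * (Y + Ce * N * A / C1 / 4 * Z)"
      unfolding t2 using l by (simp add: pos_le_divide_eq mult.commute)
    also have "\<dots> = (1 / l) * (Cn\<^sup>2 * N / ln 2 / l + Ce * N * A / C1 / 2) * Z"
      unfolding Y_def by (simp add: distrib_left distrib_right mult_ac)
    also have "\<dots> \<le> C * Z"
    proof (intro mult_right_mono Z0)
      have "Ce * N * A / C1 \<ge> 0" using Ce0 N(1) A(1) C1 by simp
      moreover have "x / 2 \<le> x" if "x \<ge> 0" for x :: real using that by simp
      ultimately have "Ce * N * A / C1 / 2 \<le> Ce * N * A / C1" by blast
      then show "1 / l * (Cn\<^sup>2 * N / ln 2 / l + Ce * N * A / C1 / 2) \<le> C"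
        unfolding C_def using l by (intro mult_left_mono) auto
    qed
    finally show "(\<lambda>x. (U x - g (x /\<^sub>R real k))\<^sup>2) summable_on ?L \<and>
       (\<Sum>\<^sub>\<infinity>x\<in>?L. (U x - g (x /\<^sub>R real k))\<^sup>2) \<le> C * real k ^ CARD('d) * (1 + ln R) / ln (real k)"
      using v2 by (simp add: V_def v_def G_def Z_def d_def)
  qed
qed

section \<open>Concentration of the fluctuations\<close>

text \<open>Below twice the dimension the origin alone suffices, so the lower bound of order r^d
  starts at radius 1.\<close>

lemma card_lattice_ball_ge:
  obtains c where "c > 0" "\<And>r. r \<ge> 1 \<Longrightarrow> real (card (lattice_ball r :: (real ^ 'd) set)) \<ge> c * r ^ CARD('d)"
proof -
  define s where "s = 2 * real CARD('d)"
  define V where "V = unit_ball_vol (real CARD('d))"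
  have s: "s \<ge> 2" by (simp add: s_def Suc_leI)
  have V: "V > 0" by (simp add: V_def)
  define c where "c = min (V / 2 ^ CARD('d)) (1 / s ^ CARD('d))"
  show ?thesis
  proof (rule that[of c])
    show "c > 0" using s V by (simp add: c_def)
    fix r :: real assume r: "r \<ge> 1"
    show "real (card (lattice_ball r :: (real ^ 'd) set)) \<ge> c * r ^ CARD('d)"
    proof (cases "r \<ge> s")
      case True
      have "c * r ^ CARD('d) \<le> V / 2 ^ CARD('d) * r ^ CARD('d)"
        using r by (intro mult_right_mono) (auto simp: c_def)
      also have "\<dots> = V * (r / 2) ^ CARD('d)" by (simp add: power_divide)
      also have "\<dots> \<le> V * (r - real CARD('d)) ^ CARD('d)"
        using V r True by (intro mult_left_mono power_mono) (auto simp: s_def)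
      also have "\<dots> \<le> real (card (lattice_ball r :: (real ^ 'd) set))"
        unfolding V_def by (rule card_lattice_ball_lower) (use True in \<open>simp add: s_def\<close>)
      finally show ?thesis .
    next
      case False
      have "c * r ^ CARD('d) \<le> 1 / s ^ CARD('d) * s ^ CARD('d)"
        using r s False by (intro mult_mono power_mono) (auto simp: c_def)
      also have "\<dots> = 1" using s by simp
      also have "1 \<le> real (card (lattice_ball r :: (real ^ 'd) set))"
      proof -
        have "0 \<in> (lattice_ball r :: (real ^ 'd) set)" using r by (simp add: lattice_ball_def)
        then have "card (lattice_ball r :: (real ^ 'd) set) > 0" by (auto simp: card_gt_0_iff)
        then show ?thesis by simp
      qed
      finally show ?thesis .
    qed
  qed
qed

lemma card_lens_ge:
  fixes x y :: "real ^ 'd"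
  assumes "x \<in> int_lattice"
  shows "card (lattice_ball (norm (x - y)) :: (real ^ 'd) set) \<le> card (lens x y)"
proof (rule card_inj_on_le[of "\<lambda>z. x + z"])
  show "(\<lambda>z. x + z) ` lattice_ball (norm (x - y)) \<subseteq> lens x y"
  proof
    fix u assume "u \<in> (\<lambda>z. x + z) ` lattice_ball (norm (x - y))"
    then obtain z where z: "u = x + z" "z \<in> int_lattice" "norm z \<le> norm (x - y)"
      by (auto simp: lattice_ball_def)
    have "norm (u - y) \<le> norm z + norm (x - y)"
      unfolding z(1) using norm_triangle_ineq[of z "x - y"] by (simp add: algebra_simps)
    moreover have "norm (u - x) \<le> 2 * norm (x - y)"
      using z(3) norm_ge_zero[of "x - y"] by (simp only: z(1) add_diff_cancel_left')
    ultimately show "u \<in> lens x y" using z assms by (auto simp: lens_def int_lattice_add)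
  qed
qed auto

text \<open>At distance r a summand is of order r^-d (lens weight) times r^-(d+2) (kernel) times r.
  Its square r^-(4d+2) is r^-(3d+1) times the summable r^-(d+1). The first factor is taken out at
  the smallest admissible distance, which exceeds \<open>R\<close> by the range and is at least
  \<open>norm (u - y) / 2\<close> by the lens.\<close>

lemma fluctuation_variance_bound:
  obtains A where "A > 0"
    "\<And>R k i u y. 1 \<le> R \<Longrightarrow> y \<in> int_lattice \<Longrightarrow>
      (\<Sum>x\<in>{x \<in> int_lattice. mid_range R k x y}. (lens_weight u x y * jump_kernel (x - y) * (y - x) $ i)\<^sup>2)
        \<le> A / max R (norm (u - (y :: real ^ 'd)) / 2) ^ (3 * CARD('d) + 1)"
proof -
  define d where "d = CARD('d)"
  obtain c where c: "c > 0" "\<And>r. r \<ge> 1 \<Longrightarrow> real (card (lattice_ball r :: (real ^ 'd) set)) \<ge> c * r ^ d"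
    unfolding d_def using card_lattice_ball_ge by blast
  obtain A4 where A4: "A4 > 0" "\<And>F. finite F \<Longrightarrow> F \<subseteq> int_lattice - {0} \<Longrightarrow>
      (\<Sum>z\<in>(F :: (real ^ 'd) set). 1 / norm z ^ (d + 1)) \<le> A4"
    unfolding d_def using lattice_power_sum_bounded by blast
  show ?thesis
  proof (rule that[of "A4 / c\<^sup>2"])
    show "A4 / c\<^sup>2 > 0" using A4(1) c(1) by simp
    fix R :: real and k i and u y :: "real ^ 'd" assume R: "1 \<le> R" and y: "y \<in> int_lattice"
    define m where "m = max R (norm (u - y) / 2)"
    have m: "m \<ge> 1" using R by (simp add: m_def)
    let ?I = "{x \<in> int_lattice. mid_range R k x y}"
    have pt: "(lens_weight u x y * jump_kernel (x - y) * (y - x) $ i)\<^sup>2 \<le> 1 / c\<^sup>2 / m ^ (3 * d + 1) * (1 / norm (x - y) ^ (d + 1))"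
      if x: "x \<in> ?I" for x
    proof (cases "u \<in> lens x y")
      case False
      then show ?thesis using m by (simp add: lens_weight_def)
    next
      case True
      define \<rho> where "\<rho> = norm (x - y)"
      have \<rho>R: "\<rho> > R" using x by (simp add: mid_range_def \<rho>_def)
      have \<rho>: "\<rho> \<ge> 1" using \<rho>R R by simp
      have "norm (u - y) / 2 \<le> \<rho>" using True by (simp add: lens_def \<rho>_def)
      then have \<rho>m: "m \<le> \<rho>" using \<rho>R by (simp add: m_def)
      have "c * \<rho> ^ d \<le> real (card (lens x y))"
        using c(2)[OF \<rho>] card_lens_ge[of x y] x unfolding \<rho>_def by (smt (verit) mem_Collect_eq of_nat_mono)
      moreover have cr: "c * \<rho> ^ d > 0" using c(1) \<rho> by simp
      ultimately have "lens_weight u x y \<le> 1 / (c * \<rho> ^ d)"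
        unfolding lens_weight_def using True by (simp add: divide_left_mono)
      moreover have "\<bar>(y - x) $ i\<bar> \<le> \<rho>" using component_le_norm_cart[of "y - x" i] by (simp add: \<rho>_def norm_minus_commute)
      ultimately have "\<bar>lens_weight u x y * jump_kernel (x - y) * (y - x) $ i\<bar> \<le> 1 / (c * \<rho> ^ d) * (1 / \<rho> ^ (d + 2)) * \<rho>"
        unfolding abs_mult using cr \<rho> by (intro mult_mono) (auto simp: lens_weight_def jump_kernel_def \<rho>_def d_def)
      also have "\<dots> = 1 / (c * \<rho> ^ (2 * d + 1))"
      proof -
        have e: "\<rho> ^ d * \<rho> ^ (d + 2) = \<rho> ^ (2 * d + 1) * \<rho>"
          by (simp add: power_add mult_2 power2_eq_square)
        have "1 / (c * \<rho> ^ d) * (1 / \<rho> ^ (d + 2)) * \<rho> = \<rho> / (c * (\<rho> ^ d * \<rho> ^ (d + 2)))" by (simp add: mult.assoc)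
        also have "\<dots> = 1 / (c * \<rho> ^ (2 * d + 1))" unfolding e using \<rho> by simp
        finally show ?thesis .
      qed
      finally have "(lens_weight u x y * jump_kernel (x - y) * (y - x) $ i)\<^sup>2 \<le> (1 / (c * \<rho> ^ (2 * d + 1)))\<^sup>2"
        by (intro power2_le_iff_abs_le[THEN iffD2]) (use c \<rho> in auto)
      also have "\<dots> = 1 / c\<^sup>2 / \<rho> ^ (3 * d + 1) * (1 / \<rho> ^ (d + 1))"
      proof -
        have "(\<rho> ^ (2 * d + 1))\<^sup>2 = \<rho> ^ (3 * d + 1) * \<rho> ^ (d + 1)"
          by (simp add: power_mult[symmetric] power_add[symmetric] del: power_Suc)
        then show ?thesis by (simp add: power_divide power_mult_distrib)
      qed
      also have "\<dots> \<le> 1 / c\<^sup>2 / m ^ (3 * d + 1) * (1 / \<rho> ^ (d + 1))"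
        using m \<rho>m \<rho> by (intro mult_right_mono divide_left_mono power_mono mult_pos_pos) auto
      finally show ?thesis by (simp add: \<rho>_def)
    qed
    have "(\<Sum>x\<in>?I. (lens_weight u x y * jump_kernel (x - y) * (y - x) $ i)\<^sup>2)
        \<le> (\<Sum>x\<in>?I. 1 / c\<^sup>2 / m ^ (3 * d + 1) * (1 / norm (x - y) ^ (d + 1)))"
      by (rule sum_mono) (rule pt)
    also have "\<dots> = 1 / c\<^sup>2 / m ^ (3 * d + 1) * (\<Sum>z\<in>(\<lambda>x. x - y) ` ?I. 1 / norm z ^ (d + 1))"
      by (subst sum.reindex) (auto simp: inj_on_def sum_distrib_left)
    also have "\<dots> \<le> 1 / c\<^sup>2 / m ^ (3 * d + 1) * A4"
    proof (rule mult_left_mono[OF A4(2)])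
      show "(\<lambda>x. x - y) ` ?I \<subseteq> int_lattice - {0}"
        using R y by (auto simp: mid_range_def int_lattice_diff)
    qed (use m in auto)
    finally show "(\<Sum>x\<in>?I. (lens_weight u x y * jump_kernel (x - y) * (y - x) $ i)\<^sup>2)
        \<le> A4 / c\<^sup>2 / max R (norm (u - y) / 2) ^ (3 * CARD('d) + 1)"
      by (simp add: m_def d_def)
  qed
qed

lemma pair_weight_eq:
  assumes "w x y \<omega> = w y x \<omega>"
  shows "pair_weight w {x, y} \<omega> = w x y \<omega>"
  unfolding pair_weight_def by (rule the_equality) (auto simp: doubleton_eq_iff assms)

text \<open>Hoeffding's inequality for a family indexed by unordered pairs: with \<open>y\<close>
  fixed, sending \<open>x\<close> to \<open>{x, y}\<close> is injective, so the sum runs over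
  distinct members of the independent family.\<close>

lemma hoeffding_conductances:
  fixes w :: "real ^ 'd \<Rightarrow> real ^ 'd \<Rightarrow> 'w \<Rightarrow> real"
  assumes H1: "assumption_H1 M w"
    and bd: "\<And>x y \<omega>. x \<in> int_lattice \<Longrightarrow> y \<in> int_lattice \<Longrightarrow> x \<noteq> y \<Longrightarrow> \<omega> \<in> space M \<Longrightarrow> 0 \<le> w x y \<omega> \<and> w x y \<omega> \<le> C2"
    and C2: "C2 \<ge> 0" and I: "finite I" "I \<subseteq> int_lattice - {y}" and y: "y \<in> int_lattice"
    and S: "(\<Sum>x\<in>I. (c x)\<^sup>2) \<le> S" "S > 0" and \<epsilon>: "\<epsilon> > 0"
  shows "{\<omega> \<in> space M. \<bar>\<Sum>x\<in>I. c x * (w x y \<omega> - 1)\<bar> \<ge> \<epsilon>} \<in> sets M"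
    "measure M {\<omega> \<in> space M. \<bar>\<Sum>x\<in>I. c x * (w x y \<omega> - 1)\<bar> \<ge> \<epsilon>} \<le> 2 * exp (- \<epsilon>\<^sup>2 / (2 * (C2 + 1)\<^sup>2 * S))"
proof -
  interpret prob_space M using H1 by (simp add: assumption_H1_def)
  define E where "E = {{x, y} | x y. x \<in> (int_lattice :: (real ^ 'd) set) \<and> y \<in> int_lattice \<and> x \<noteq> y}"
  have ind: "indep_vars (\<lambda>_. borel) (pair_weight w) E"
    using H1 by (simp add: assumption_H1_def E_def)
  have pw: "pair_weight w {x, y} \<omega> = w x y \<omega>" if "x \<in> I" "\<omega> \<in> space M" for x \<omega>
    using H1 that I y by (intro pair_weight_eq) (auto simp: assumption_H1_def)
  define J where "J = (\<lambda>x. {x, y}) ` I"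
  have inj: "inj_on (\<lambda>x. {x, y}) I" by (auto simp: inj_on_def doubleton_eq_iff)
  define f where "f = inv_into I (\<lambda>x. {x, y})"
  have f: "f {x, y} = x" if "x \<in> I" for x unfolding f_def by (rule inv_into_f_f[OF inj that])
  have JE: "J \<subseteq> E" using I y by (auto simp: J_def E_def)
  define X where "X e \<omega> = c (f e) * (pair_weight w e \<omega> - 1)" for e \<omega>
  have indX: "indep_vars (\<lambda>_. borel) X J"
    unfolding X_def by (rule indep_vars_compose2[OF indep_vars_subset[OF ind JE]]) measurable
  have Xeq: "X {x, y} \<omega> = c x * (w x y \<omega> - 1)" if "x \<in> I" "\<omega> \<in> space M" for x \<omega>
    using that by (simp add: X_def f pw)
  have sumX: "(\<Sum>e\<in>J. X e \<omega>) = (\<Sum>x\<in>I. c x * (w x y \<omega> - 1))" if "\<omega> \<in> space M" for \<omega>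
    unfolding J_def by (subst sum.reindex[OF inj]) (simp add: Xeq that)
  define s where "s e = \<bar>c (f e)\<bar> * (C2 + 1)" for e
  have Xs: "\<bar>X e \<omega>\<bar> \<le> s e" if e: "e \<in> J" and \<omega>: "\<omega> \<in> space M" for e \<omega>
  proof -
    obtain x where x: "x \<in> I" "e = {x, y}" using e unfolding J_def by blast
    have "0 \<le> w x y \<omega> \<and> w x y \<omega> \<le> C2" by (rule bd) (use x I y \<omega> in auto)
    then have "\<bar>w x y \<omega> - 1\<bar> \<le> C2 + 1" by (simp add: abs_le_iff)
    then show ?thesis by (simp add: x(2) Xeq[OF x(1) \<omega>] s_def f[OF x(1)] abs_mult mult_left_mono)
  qed
  interpret H: Hoeffding_ineq M J X "\<lambda>e. - s e" s "\<Sum>e\<in>J. expectation (X e)"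
  proof unfold_locales
    show "finite J" using I(1) by (simp add: J_def)
    show "indep_vars (\<lambda>_. borel) X J" by (rule indX)
    show "AE \<omega> in M. X e \<omega> \<in> {- s e..s e}" if "e \<in> J" for e
      using Xs[OF that] by (intro AE_I2) (auto simp: abs_le_iff minus_le_iff)
  qed simp
  have E0: "expectation (X e) = 0" if e: "e \<in> J" for e
  proof -
    obtain x where x: "x \<in> I" "e = {x, y}" using e unfolding J_def by blast
    have "x \<in> int_lattice" "x \<noteq> y" using x(1) I(2) by auto
    moreover have "\<forall>x\<in>int_lattice. \<forall>y\<in>int_lattice. x \<noteq> y \<longrightarrow> integral\<^sup>L M (w x y) = 1"
      using H1 by (simp add: assumption_H1_def)
    ultimately have "integral\<^sup>L M (w x y) = 1" using y by blast
    then have pw1: "integral\<^sup>L M (pair_weight w e) = 1"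
      using Bochner_Integration.integral_cong[of M M "pair_weight w e" "w x y"] pw[OF x(1)] x(2) by simp
    \<comment> \<open>A non-integrable function has Bochner integral 0, so mean 1 already implies
      integrability.\<close>
    then have int: "integrable M (pair_weight w e)"
      using not_integrable_integral_eq by fastforce
    have "expectation (X e) = c (f e) * (integral\<^sup>L M (pair_weight w e) - 1)"
      unfolding X_def using int by (simp add: prob_space)
    then show ?thesis using pw1 by simp
  qed
  have set_eq: "{\<omega> \<in> space M. \<bar>\<Sum>x\<in>I. c x * (w x y \<omega> - 1)\<bar> \<ge> \<epsilon>} = {\<omega> \<in> space M. \<bar>(\<Sum>e\<in>J. X e \<omega>) - 0\<bar> \<ge> \<epsilon>}"
    using sumX by auto
  have [measurable]: "X e \<in> borel_measurable M" if "e \<in> J" for e by (rule H.random_variable[OF that])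
  show "{\<omega> \<in> space M. \<bar>\<Sum>x\<in>I. c x * (w x y \<omega> - 1)\<bar> \<ge> \<epsilon>} \<in> sets M"
    unfolding set_eq by measurable
  have V: "(\<Sum>e\<in>J. (s e - - s e)\<^sup>2) = 4 * (C2 + 1)\<^sup>2 * (\<Sum>x\<in>I. (c x)\<^sup>2)"
    unfolding J_def by (subst sum.reindex[OF inj]) (simp add: s_def f power_mult_distrib sum_distrib_left mult_ac)
  show "measure M {\<omega> \<in> space M. \<bar>\<Sum>x\<in>I. c x * (w x y \<omega> - 1)\<bar> \<ge> \<epsilon>} \<le> 2 * exp (- \<epsilon>\<^sup>2 / (2 * (C2 + 1)\<^sup>2 * S))"
  \<comment> \<open>If all coefficients vanish, the denominator in Hoeffding's bound is 0; the event
    is then empty because \<open>\<epsilon> > 0\<close>.\<close>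
  proof (cases "(\<Sum>x\<in>I. (c x)\<^sup>2) = 0")
    case True
    then have "\<And>x. x \<in> I \<Longrightarrow> c x = 0" using I(1) by (simp add: sum_nonneg_eq_0_iff)
    then have "(\<Sum>x\<in>I. c x * (w x y \<omega> - 1)) = 0" for \<omega> by simp
    then show ?thesis using \<epsilon> by simp
  next
    case False
    then have pos: "(\<Sum>x\<in>I. (c x)\<^sup>2) > 0" by (simp add: sum_nonneg order_less_le)
    have C2p: "(C2 + 1)\<^sup>2 > 0" using C2 by simp
    have "measure M {\<omega> \<in> space M. \<bar>(\<Sum>e\<in>J. X e \<omega>) - 0\<bar> \<ge> \<epsilon>}
        \<le> 2 * exp (- 2 * \<epsilon>\<^sup>2 / (4 * (C2 + 1)\<^sup>2 * (\<Sum>x\<in>I. (c x)\<^sup>2)))"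
      using H.Hoeffding_ineq_abs_ge[of \<epsilon>] \<epsilon> pos C2p unfolding V by (simp add: E0)
    also have "\<dots> \<le> 2 * exp (- \<epsilon>\<^sup>2 / (2 * (C2 + 1)\<^sup>2 * S))"
    proof -
      have "\<epsilon>\<^sup>2 / (2 * (C2 + 1)\<^sup>2 * S) \<le> \<epsilon>\<^sup>2 / (2 * (C2 + 1)\<^sup>2 * (\<Sum>x\<in>I. (c x)\<^sup>2))"
        using S pos C2p by (intro divide_left_mono mult_left_mono mult_pos_pos) auto
      also have "\<dots> = 2 * \<epsilon>\<^sup>2 / (4 * (C2 + 1)\<^sup>2 * (\<Sum>x\<in>I. (c x)\<^sup>2))" by simp
      finally show ?thesis by simp
    qed
    finally show ?thesis unfolding set_eq .
  qed
qed


text \<open>A power of \<open>ln k\<close> is long enough to absorb the logarithm lost in the union bound, and short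
  enough for the jumps below it to contribute only \<open>ln ln k\<close>.\<close>
definition truncation :: "nat \<Rightarrow> real" where
  "truncation k = 1 + ln (real k)"

text \<open>Whatever the support radius \<open>M\<close>, the ball of radius k^2 contains the one of
  radius (M + 3) k once k >= M + 3. Hence the event is free of the test function, at the price of a
  larger power of k in the union bound.\<close>

definition good_conductances :: "real \<Rightarrow> nat \<Rightarrow> (real ^ 'd \<Rightarrow> real ^ 'd \<Rightarrow> real) \<Rightarrow> bool" where
  "good_conductances H k wt \<longleftrightarrow> (\<forall>u\<in>lattice_ball ((real k)\<^sup>2). \<forall>y\<in>lattice_ball ((real k)\<^sup>2). \<forall>i.
     (fluctuation (\<lambda>x y. wt x y - 1) (truncation k) k i u y)\<^sup>2
       \<le> H * truncation k ^ (CARD('d) - 2) / max (truncation k) (norm (u - y) / 2) ^ (3 * CARD('d) + 1))"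

text \<open>Union bound and Borel-Cantelli: the ball of radius k^2 has O(k^(4d)) pairs of points,
  there are d directions, and each event has probability at most 2 k^-(4d+2). So
  \<open>Bad k\<close> has probability O(k^-2).\<close>

lemma good_conductances_prob:
  fixes w :: "real ^ 'd \<Rightarrow> real ^ 'd \<Rightarrow> 'w \<Rightarrow> real"
  assumes H1: "assumption_H1 M w" and d3: "CARD('d) \<ge> 3"
    and bd: "\<And>x y \<omega>. x \<in> int_lattice \<Longrightarrow> y \<in> int_lattice \<Longrightarrow> x \<noteq> y \<Longrightarrow> \<omega> \<in> space M \<Longrightarrow> 0 \<le> w x y \<omega> \<and> w x y \<omega> \<le> C2"
    and C2: "C2 \<ge> 0"
  shows "\<exists>H Bad. H \<ge> 0 \<and> (\<forall>k. Bad k \<in> sets M) \<and>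
    (\<forall>k\<ge>2. \<forall>\<omega>\<in>space M. \<omega> \<notin> Bad k \<longrightarrow> good_conductances H k (\<lambda>x y. w x y \<omega>)) \<and>
    (AE \<omega> in M. finite {k. \<omega> \<in> Bad k})"
proof -
  interpret prob_space M using H1 by (simp add: assumption_H1_def)
  define d where "d = CARD('d)"
  obtain A where A: "A > 0"
    "\<And>R k i u y. 1 \<le> R \<Longrightarrow> y \<in> int_lattice \<Longrightarrow>
      (\<Sum>x\<in>{x \<in> int_lattice. mid_range R k x y}. (lens_weight u x y * jump_kernel (x - y) * (y - x) $ i)\<^sup>2)
        \<le> A / max R (norm (u - (y :: real ^ 'd)) / 2) ^ (3 * d + 1)"
    unfolding d_def using fluctuation_variance_bound by blast
  obtain N where N: "N > 0" "\<And>k::nat. k \<ge> 1 \<Longrightarrow>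
      real (card (lattice_ball (1 * real k) :: (real ^ 'd) set)) \<le> N * real k ^ d"
    using card_lattice_ball_le[where 'd='d and c=1] unfolding d_def by (metis zero_less_one)
  \<comment> \<open>Chosen so that the variance cancels and Hoeffding's exponent becomes
    \<open>(4 * real d + 2) * truncation k ^ (d - 2)\<close>, which is at least
    \<open>(4 * real d + 2) * ln (real k)\<close>.\<close>
  define H where "H = (4 * real d + 2) * (2 * (C2 + 1)\<^sup>2 * A)"
  have H0: "H > 0" unfolding H_def using C2 A(1) by (intro mult_pos_pos) auto
  define F where "F k = (lattice_ball ((real k)\<^sup>2) :: (real ^ 'd) set)" for k :: nat
  have finF: "finite (F k)" for k by (simp add: F_def)
  have FL: "F k \<subseteq> int_lattice" for k by (auto simp: F_def lattice_ball_def)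
  define \<epsilon> where "\<epsilon> k u y = sqrt (H * truncation k ^ (d - 2) / max (truncation k) (norm (u - y) / 2) ^ (3 * d + 1))"
    for k :: nat and u y :: "real ^ 'd"
  define I where "I k y = {x \<in> int_lattice. mid_range (truncation k) k x y}" for k :: nat and y :: "real ^ 'd"
  define cf where "cf i u y x = lens_weight u x y * jump_kernel (x - y) * (y - x) $ i" for i and u y x :: "real ^ 'd"
  define ev where "ev k i u y = {\<omega> \<in> space M. \<bar>\<Sum>x\<in>I k y. cf i u y x * (w x y \<omega> - 1)\<bar> \<ge> \<epsilon> k u y}" for k i u y
  define Bad where "Bad k = (if k \<ge> 2 then (\<Union>u\<in>F k. \<Union>y\<in>F k. \<Union>i\<in>UNIV. ev k i u y) else {})" for k
  have fluct: "fluctuation (\<lambda>x y. w x y \<omega> - 1) (truncation k) k i u y = (\<Sum>x\<in>I k y. cf i u y x * (w x y \<omega> - 1))" for k i u y \<omega>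
    unfolding fluctuation_def I_def cf_def by (rule sum.cong) (auto simp: mult_ac)
  have T: "truncation k \<ge> 1" "ln (real k) \<le> truncation k" if "k \<ge> 2" for k
    using that by (auto simp: truncation_def)
  have ev: "ev k i u y \<in> sets M \<and> measure M (ev k i u y) \<le> 2 * (1 / real k ^ (4 * d + 2))"
    if k: "k \<ge> 2" and y: "y \<in> F k" for k i u y
  proof -
    define m where "m = max (truncation k) (norm (u - y) / 2)"
    have m: "m \<ge> 1" using T(1)[OF k] by (simp add: m_def)
    define S where "S = A / m ^ (3 * d + 1)"
    have S: "S > 0" using A(1) m by (simp add: S_def)
    have yL: "y \<in> int_lattice" using y FL by auto
    have "finite (I k y)" by (simp add: I_def)
    moreover have "I k y \<subseteq> int_lattice - {y}" using T(1)[OF k] by (auto simp: I_def mid_range_def)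
    ultimately have IL: "finite (I k y)" "I k y \<subseteq> int_lattice - {y}" by auto
    have var: "(\<Sum>x\<in>I k y. (cf i u y x)\<^sup>2) \<le> S"
      unfolding I_def cf_def S_def m_def by (rule A(2)[OF T(1)[OF k] yL])
    have \<epsilon>2: "(\<epsilon> k u y)\<^sup>2 = H * truncation k ^ (d - 2) / m ^ (3 * d + 1)"
      unfolding \<epsilon>_def m_def[symmetric] using H0 T(1)[OF k] m by simp
    have \<epsilon>0: "\<epsilon> k u y > 0"
      unfolding \<epsilon>_def m_def[symmetric] using H0 T(1)[OF k] m by simp
    note hoeff = hoeffding_conductances[OF H1 bd C2 IL yL var S \<epsilon>0]
    have "(4 * real d + 2) * ln (real k) \<le> (\<epsilon> k u y)\<^sup>2 / (2 * (C2 + 1)\<^sup>2 * S)"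
    proof -
      have "(\<epsilon> k u y)\<^sup>2 / (2 * (C2 + 1)\<^sup>2 * S) = (4 * real d + 2) * truncation k ^ (d - 2)"
        unfolding \<epsilon>2 S_def H_def using m C2 A(1) by simp
      moreover have "ln (real k) \<le> truncation k ^ (d - 2)"
      proof -
        \<comment> \<open>Here dimension at least 3 enters: the surplus exponent
          \<open>d - 2\<close> is at least 1.\<close>
        have "truncation k ^ 1 \<le> truncation k ^ (d - 2)"
          using T(1)[OF k] d3 by (intro power_increasing) (auto simp: d_def)
        then show ?thesis using T(2)[OF k] by simp
      qed
      ultimately show ?thesis by (simp add: mult_left_mono)
    qed
    then have "exp (- (\<epsilon> k u y)\<^sup>2 / (2 * (C2 + 1)\<^sup>2 * S)) \<le> exp (- ((4 * real d + 2) * ln (real k)))" by simp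
    also have "\<dots> = 1 / real k ^ (4 * d + 2)"
    proof -
      have "(4 * real d + 2) * ln (real k) = ln (real k ^ (4 * d + 2))" by (subst ln_realpow) (use k in auto)
      then show ?thesis using k by (simp add: exp_minus inverse_eq_divide del: power_add_numeral2)
    qed
    finally have "2 * exp (- (\<epsilon> k u y)\<^sup>2 / (2 * (C2 + 1)\<^sup>2 * S)) \<le> 2 * (1 / real k ^ (4 * d + 2))" by simp
    moreover have "ev k i u y \<in> sets M" unfolding ev_def by (rule hoeff(1))
    moreover have "measure M (ev k i u y) \<le> 2 * exp (- (\<epsilon> k u y)\<^sup>2 / (2 * (C2 + 1)\<^sup>2 * S))"
      unfolding ev_def by (rule hoeff(2))
    ultimately show ?thesis by linarith
  qed
  have BadM: "Bad k \<in> sets M" for k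
    unfolding Bad_def using ev finF by (auto intro!: sets.finite_UN)
  have BadP: "measure M (Bad k) \<le> 2 * real d * N\<^sup>2 * (1 / real k ^ 2)" for k
  proof (cases "k \<ge> 2")
    case True
    have "measure M (Bad k) = measure M (\<Union>t\<in>F k \<times> F k \<times> UNIV. case t of (u, y, i) \<Rightarrow> ev k i u y)"
      using True by (intro arg_cong[of _ _ "measure M"]) (auto simp: Bad_def)
    also have "\<dots> \<le> (\<Sum>t\<in>F k \<times> F k \<times> (UNIV :: 'd set). measure M (case t of (u, y, i) \<Rightarrow> ev k i u y))"
      by (rule measure_UNION_le) (use finF ev[OF True] in auto)
    also have "\<dots> \<le> (\<Sum>t\<in>F k \<times> F k \<times> (UNIV :: 'd set). 2 * (1 / real k ^ (4 * d + 2)))"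
      by (rule sum_mono) (use ev[OF True] in auto)
    also have "\<dots> = real d * (real (card (F k)))\<^sup>2 * (2 * (1 / real k ^ (4 * d + 2)))"
      by (simp add: card_cartesian_product d_def power2_eq_square)
    also have "\<dots> \<le> real d * (N * (real k ^ 2) ^ d)\<^sup>2 * (2 * (1 / real k ^ (4 * d + 2)))"
      using N(2)[of "k ^ 2"] True by (intro mult_right_mono mult_left_mono power_mono) (auto simp: F_def)
    also have "\<dots> = 2 * real d * N\<^sup>2 * (1 / real k ^ 2)"
    proof -
      have "((real k ^ 2) ^ d)\<^sup>2 = real k ^ (4 * d)" by (simp add: power_mult[symmetric])
      moreover have "real k ^ (4 * d + 2) = real k ^ (4 * d) * real k ^ 2" by (rule power_add)
      ultimately show ?thesis using True by (simp add: power_mult_distrib)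
    qed
    finally show ?thesis .
  next
    case False
    then show ?thesis using N(1) by (simp add: Bad_def)
  qed
  have "summable (\<lambda>k. measure M (Bad k))"
  proof (rule summable_comparison_test)
    show "\<exists>N0. \<forall>k\<ge>N0. norm (measure M (Bad k)) \<le> 2 * real d * N\<^sup>2 * (1 / real k ^ 2)"
      using BadP by simp
    have "summable (\<lambda>k. inverse (real k ^ 2))" by (rule inverse_power_summable) simp
    then show "summable (\<lambda>k. 2 * real d * N\<^sup>2 * (1 / real k ^ 2))"
      by (intro summable_mult) (simp add: inverse_eq_divide)
  qed
  then have "AE \<omega> in M. eventually (\<lambda>k. \<omega> \<in> space M - Bad k) sequentially"
    by (intro borel_cantelli_AE1 BadM) (auto simp: emeasure_eq_measure)
  then have fin: "AE \<omega> in M. finite {k. \<omega> \<in> Bad k}"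
  proof eventually_elim
    case (elim \<omega>)
    then obtain n where "\<And>k. k \<ge> n \<Longrightarrow> \<omega> \<notin> Bad k" by (auto simp: eventually_sequentially)
    then have "{k. \<omega> \<in> Bad k} \<subseteq> {..<n}" by (auto simp: not_le[symmetric])
    then show ?case by (rule finite_subset) simp
  qed
  have good: "good_conductances H k (\<lambda>x y. w x y \<omega>)" if k: "k \<ge> 2" and \<omega>: "\<omega> \<in> space M" "\<omega> \<notin> Bad k" for k \<omega>
    unfolding good_conductances_def
  proof (intro ballI allI)
    fix u y :: "real ^ 'd" and i
    assume "u \<in> lattice_ball ((real k)\<^sup>2)" "y \<in> lattice_ball ((real k)\<^sup>2)"
    then have "\<omega> \<notin> ev k i u y" using k \<omega> by (auto simp: Bad_def F_def)
    then have lt: "\<bar>fluctuation (\<lambda>x y. w x y \<omega> - 1) (truncation k) k i u y\<bar> < \<epsilon> k u y"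
      using \<omega>(1) by (simp add: ev_def fluct not_le)
    have m: "max (truncation k) (norm (u - y) / 2) > 0" using T(1)[OF k] by simp
    have "(fluctuation (\<lambda>x y. w x y \<omega> - 1) (truncation k) k i u y)\<^sup>2 \<le> (\<epsilon> k u y)\<^sup>2"
      using lt by (intro power2_le_iff_abs_le[THEN iffD2]) auto
    also have "(\<epsilon> k u y)\<^sup>2 = H * truncation k ^ (d - 2) / max (truncation k) (norm (u - y) / 2) ^ (3 * d + 1)"
      unfolding \<epsilon>_def using H0 T(1)[OF k] m by simp
    finally show "(fluctuation (\<lambda>x y. w x y \<omega> - 1) (truncation k) k i u y)\<^sup>2
       \<le> H * truncation k ^ (CARD('d) - 2) / max (truncation k) (norm (u - y) / 2) ^ (3 * CARD('d) + 1)"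
      by (simp add: d_def)
  qed
  show ?thesis by (rule exI[of _ H], rule exI[of _ Bad]) (use H0 BadM good fin in auto)
qed

section \<open>Rescaling and the rate of convergence\<close>

lemma scaled_lattice_bij:
  assumes "k \<ge> 1"
  shows "bij_betw (\<lambda>y. y /\<^sub>R real k) int_lattice (scaled_lattice k)"
  by (rule bij_betw_byWitness[of _ "\<lambda>y. real k *\<^sub>R y"]) (use assms in \<open>auto simp: scaled_lattice_def\<close>)

lemma scaled_lattice_cases:
  assumes "k \<ge> 1" "z \<in> scaled_lattice k"
  obtains x where "x \<in> int_lattice" "z = x /\<^sub>R real k"
  using scaled_lattice_bij[OF assms(1)] assms(2) by (auto simp: bij_betw_def)

lemma scaled_latticeI: "k \<ge> 1 \<Longrightarrow> x \<in> int_lattice \<Longrightarrow> x /\<^sub>R real k \<in> scaled_lattice k"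
  by (simp add: scaled_lattice_def)

text \<open>The measure contributes k^-d and the kernel k^(d+2), hence the prefactor k^2 / ln k. The
  diagonal may be included because its term is 0.\<close>

lemma scaled_generator_unscaled:
  fixes w :: "real ^ 'd \<Rightarrow> real ^ 'd \<Rightarrow> 'w \<Rightarrow> real"
  assumes k: "k \<ge> 2" and x: "x \<in> int_lattice"
  shows "scaled_generator w k \<omega> u (x /\<^sub>R real k)
    = (\<Sum>\<^sub>\<infinity>y\<in>int_lattice. (real k ^ 2 / ln (real k) * (w x y \<omega> * jump_kernel (x - y))) * (u (y /\<^sub>R real k) - u (x /\<^sub>R real k)))"
proof -
  let ?L = "int_lattice :: (real ^ 'd) set"
  have k0: "real k > 0" and k1: "k \<ge> 1" using k by auto
  define c where "c = 1 / (ln (real k) * real k ^ CARD('d))"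
  define x' where "x' = x /\<^sub>R real k"
  have kx: "real k *\<^sub>R (y /\<^sub>R real k) = y" for y :: "real ^ 'd" using k0 by simp
  have bij: "bij_betw (\<lambda>y. y /\<^sub>R real k) (?L - {x}) (scaled_lattice k - {x'})"
    by (rule bij_betw_byWitness[of _ "\<lambda>y. real k *\<^sub>R y"]) (use k0 in \<open>auto simp: scaled_lattice_def x'_def\<close>)
  have "scaled_generator w k \<omega> u x' = c * (\<Sum>\<^sub>\<infinity>y\<in>scaled_lattice k - {x'}. (u y - u x') * (w x (real k *\<^sub>R y) \<omega> / norm (x' - y) ^ (CARD('d) + 2)))"
    unfolding scaled_generator_def c_def x'_def kx ..
  also have "\<dots> = c * (\<Sum>\<^sub>\<infinity>y\<in>?L - {x}. (u (y /\<^sub>R real k) - u x') * (w x y \<omega> / norm (x' - y /\<^sub>R real k) ^ (CARD('d) + 2)))"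
    by (subst infsum_reindex_bij_betw[OF bij, symmetric]) (simp only: kx)
  also have "\<dots> = (\<Sum>\<^sub>\<infinity>y\<in>?L - {x}. c * ((u (y /\<^sub>R real k) - u x') * (w x y \<omega> / norm (x' - y /\<^sub>R real k) ^ (CARD('d) + 2))))"
    by (rule infsum_cmult_right'[symmetric])
  also have "\<dots> = (\<Sum>\<^sub>\<infinity>y\<in>?L. (real k ^ 2 / ln (real k) * (w x y \<omega> * jump_kernel (x - y))) * (u (y /\<^sub>R real k) - u x'))"
  proof (rule infsum_cong_neutral)
    fix y assume "y \<in> (?L - {x}) \<inter> ?L"
    have n: "norm (x' - y /\<^sub>R real k) = norm (x - y) / real k"
    proof -
      have "x' - y /\<^sub>R real k = (x - y) /\<^sub>R real k" by (simp add: x'_def scaleR_diff_right)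
      then show ?thesis by (simp add: divide_inverse_commute)
    qed
    have e: "c * (1 / norm (x' - y /\<^sub>R real k) ^ (CARD('d) + 2)) = real k ^ 2 / ln (real k) * jump_kernel (x - y)"
      unfolding n jump_kernel_def c_def using k0 by (simp add: power_divide power_add power2_eq_square)
    have "c * ((u (y /\<^sub>R real k) - u x') * (w x y \<omega> / norm (x' - y /\<^sub>R real k) ^ (CARD('d) + 2)))
        = (u (y /\<^sub>R real k) - u x') * w x y \<omega> * (c * (1 / norm (x' - y /\<^sub>R real k) ^ (CARD('d) + 2)))" by simp
    then show "c * ((u (y /\<^sub>R real k) - u x') * (w x y \<omega> / norm (x' - y /\<^sub>R real k) ^ (CARD('d) + 2)))
        = (real k ^ 2 / ln (real k) * (w x y \<omega> * jump_kernel (x - y))) * (u (y /\<^sub>R real k) - u x')"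
      unfolding e by (simp add: mult_ac)
  qed auto
  finally show ?thesis by (simp add: x'_def)
qed

lemma integrable_count_space_iff_summable_on:
  fixes f :: "'a \<Rightarrow> real"
  assumes "\<And>x. f x \<ge> 0"
  shows "integrable (count_space A) f \<longleftrightarrow> f summable_on A"
proof -
  have "(\<lambda>x. norm (f x)) summable_on A \<longleftrightarrow> integrable (count_space A) f"
    using abs_summable_equivalent[of f A] unfolding Infinite_Set_Sum.abs_summable_on_def .
  then show ?thesis using assms by simp
qed

lemma lattice_square_integrable_iff:
  fixes u :: "real ^ 'd \<Rightarrow> real"
  assumes k: "k \<ge> 1"
  shows "square_integrable_fun (lattice_measure k) u \<longleftrightarrow> (\<lambda>x. (u (x /\<^sub>R real k))\<^sup>2) summable_on int_lattice"
proof -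
  define c where "c = 1 / real k ^ CARD('d)"
  have c: "c > 0" using k by (simp add: c_def)
  have lm: "(lattice_measure k :: (real ^ 'd) measure) = density (count_space (scaled_lattice k)) (\<lambda>_. ennreal c)"
    by (simp add: lattice_measure_def point_measure_def c_def)
  have "square_integrable_fun (lattice_measure k) u \<longleftrightarrow> integrable (count_space (scaled_lattice k)) (\<lambda>x. c * (u x)\<^sup>2)"
    unfolding square_integrable_fun_def lm using c by (subst integrable_density) auto
  also have "\<dots> \<longleftrightarrow> (\<lambda>x. c * (u x)\<^sup>2) summable_on scaled_lattice k"
    by (rule integrable_count_space_iff_summable_on) (use c in simp)
  also have "\<dots> \<longleftrightarrow> (\<lambda>x. (u x)\<^sup>2) summable_on scaled_lattice k"
    using c by (simp add: summable_on_cmult_right')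
  also have "\<dots> \<longleftrightarrow> (\<lambda>x. (u (x /\<^sub>R real k))\<^sup>2) summable_on int_lattice"
    by (rule summable_on_reindex_bij_betw[OF scaled_lattice_bij[OF k], symmetric])
  finally show ?thesis .
qed

text \<open>Turns the \<open>THE\<close> into a usable equation: existence is the Neumann series,
  uniqueness on the lattice the energy argument, and extensionality carries it to functions on the
  whole space. For test functions summability on the lattice follows from compact support.\<close>

lemma scaled_resolvent_solves:
  fixes w :: "real ^ 'd \<Rightarrow> real ^ 'd \<Rightarrow> 'w \<Rightarrow> real"
  assumes k: "k \<ge> 2" and l: "l > 0" and C2: "C2 \<ge> 0"
    and w: "\<And>x y. x \<in> int_lattice \<Longrightarrow> y \<in> int_lattice \<Longrightarrow> x \<noteq> y \<Longrightarrow> w x y \<omega> = w y x \<omega> \<and> 0 \<le> w x y \<omega> \<and> w x y \<omega> \<le> C2"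
    and f: "(\<lambda>x. f (x /\<^sub>R real k)) summable_on int_lattice"
  defines "U \<equiv> (\<lambda>x. scaled_resolvent w l k \<omega> f (x /\<^sub>R real k))"
  shows "(\<lambda>x. (U x)\<^sup>2) summable_on int_lattice"
    "\<And>x. x \<in> int_lattice \<Longrightarrow> l * U x
      - (\<Sum>\<^sub>\<infinity>y\<in>int_lattice. (real k ^ 2 / ln (real k) * (w x y \<omega> * jump_kernel (x - y))) * (U y - U x)) = f (x /\<^sub>R real k)"
proof -
  let ?L = "int_lattice :: (real ^ 'd) set"
  have k1: "k \<ge> 1" and k0: "real k > 0" and lk: "ln (real k) > 0" using k by auto
  define a where "a x y = real k ^ 2 / ln (real k) * (w x y \<omega> * jump_kernel (x - y))" for x y
  define C where "C = real k ^ 2 / ln (real k) * C2"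
  have C: "C \<ge> 0" using C2 lk by (simp add: C_def)
  have a_bd: "0 \<le> a x y \<and> a x y \<le> C * jump_kernel (x - y)" if "x \<in> ?L" "y \<in> ?L" for x y
  proof (cases "x = y")
    case False
    have "w x y \<omega> * jump_kernel (x - y) \<le> C2 * jump_kernel (x - y)"
      using w[OF that False] by (intro mult_right_mono) auto
    then have "real k ^ 2 / ln (real k) * (w x y \<omega> * jump_kernel (x - y)) \<le> real k ^ 2 / ln (real k) * (C2 * jump_kernel (x - y))"
      using lk by (intro mult_left_mono) auto
    moreover have "0 \<le> a x y" unfolding a_def using w[OF that False] lk by (intro mult_nonneg_nonneg) auto
    ultimately show ?thesis unfolding a_def C_def by (simp only: mult.assoc)
  qed (simp add: a_def)
  have a_sym: "a x y = a y x" if "x \<in> ?L" "y \<in> ?L" for x y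
    using w[OF that] by (cases "x = y") (auto simp: a_def jump_kernel_commute[of x y])
  define P where "P u \<longleftrightarrow> u \<in> extensional (scaled_lattice k) \<and> square_integrable_fun (lattice_measure k) u \<and>
        (\<forall>x\<in>scaled_lattice k. l * u x - scaled_generator w k \<omega> u x = f x)" for u
  have P_iff: "P u \<longleftrightarrow> u \<in> extensional (scaled_lattice k) \<and> (\<lambda>x. (u (x /\<^sub>R real k))\<^sup>2) summable_on ?L \<and>
       (\<forall>x\<in>?L. l * u (x /\<^sub>R real k) - (\<Sum>\<^sub>\<infinity>y\<in>?L. a x y * (u (y /\<^sub>R real k) - u (x /\<^sub>R real k))) = f (x /\<^sub>R real k))" for u
  proof -
    have "scaled_lattice k = (\<lambda>y. y /\<^sub>R real k) ` ?L" using scaled_lattice_bij[OF k1] by (auto simp: bij_betw_def)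
    then have "(\<forall>x\<in>scaled_lattice k. l * u x - scaled_generator w k \<omega> u x = f x)
        \<longleftrightarrow> (\<forall>x\<in>?L. l * u (x /\<^sub>R real k) - scaled_generator w k \<omega> u (x /\<^sub>R real k) = f (x /\<^sub>R real k))" by simp
    then show ?thesis
      unfolding P_def lattice_square_integrable_iff[OF k1] a_def by (simp add: scaled_generator_unscaled[OF k])
  qed
  obtain V where V: "(\<lambda>x. (V x)\<^sup>2) summable_on ?L"
    "\<And>x. x \<in> ?L \<Longrightarrow> l * V x - (\<Sum>\<^sub>\<infinity>y\<in>?L. a x y * (V y - V x)) = f (x /\<^sub>R real k)"
    by (rule resolvent_exists[OF a_bd a_sym C l f]) blast+
  define u0 where "u0 = restrict (\<lambda>z. V (real k *\<^sub>R z)) (scaled_lattice k)"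
  have u0: "u0 (x /\<^sub>R real k) = V x" if "x \<in> ?L" for x
    using scaled_latticeI[OF k1 that] k0 by (simp add: u0_def)
  have "P u0"
    unfolding P_iff
  proof (intro conjI ballI)
    show "u0 \<in> extensional (scaled_lattice k)" by (simp add: u0_def)
    show "(\<lambda>x. (u0 (x /\<^sub>R real k))\<^sup>2) summable_on ?L"
      by (rule summable_on_cong[THEN iffD2, OF _ V(1)]) (simp add: u0)
    fix x assume x: "x \<in> ?L"
    have "(\<Sum>\<^sub>\<infinity>y\<in>?L. a x y * (u0 (y /\<^sub>R real k) - u0 (x /\<^sub>R real k))) = (\<Sum>\<^sub>\<infinity>y\<in>?L. a x y * (V y - V x))"
      by (rule infsum_cong) (simp add: u0 x)
    then show "l * u0 (x /\<^sub>R real k) - (\<Sum>\<^sub>\<infinity>y\<in>?L. a x y * (u0 (y /\<^sub>R real k) - u0 (x /\<^sub>R real k))) = f (x /\<^sub>R real k)"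
      using V(2)[OF x] by (simp add: u0 x)
  qed
  moreover have "u = u0" if "P u" for u
  proof (rule extensionalityI)
    show "u \<in> extensional (scaled_lattice k)" "u0 \<in> extensional (scaled_lattice k)"
      using that \<open>P u0\<close> by (auto simp: P_def)
    fix z :: "real ^ 'd" assume "z \<in> scaled_lattice k"
    then obtain x where x: "x \<in> ?L" "z = x /\<^sub>R real k" by (rule scaled_lattice_cases[OF k1])
    have "(\<lambda>x. u (x /\<^sub>R real k)) x = (\<lambda>x. u0 (x /\<^sub>R real k)) x"
      by (rule resolvent_unique[OF _ _ a_bd a_sym C l _ x(1)])
         (use that \<open>P u0\<close> in \<open>auto simp: P_iff\<close>)
    then show "u z = u0 z" by (simp add: x(2))
  qed
  ultimately have "P (THE u. P u)" by (rule theI)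
  then have "P (scaled_resolvent w l k \<omega> f)" by (simp add: scaled_resolvent_def P_def)
  then show "(\<lambda>x. (U x)\<^sup>2) summable_on int_lattice"
    "\<And>x. x \<in> int_lattice \<Longrightarrow> l * U x
      - (\<Sum>\<^sub>\<infinity>y\<in>int_lattice. (real k ^ 2 / ln (real k) * (w x y \<omega> * jump_kernel (x - y))) * (U y - U x)) = f (x /\<^sub>R real k)"
    unfolding P_iff U_def a_def by auto
qed

section \<open>The piecewise constant extension\<close>

definition lattice_floor :: "nat \<Rightarrow> real ^ 'd \<Rightarrow> real ^ 'd" where
  "lattice_floor k x = (\<chi> i. of_int (\<lceil>real k * x $ i\<rceil> - 1))"

lemma lattice_floor_in: "lattice_floor k x \<in> int_lattice"
  by (simp add: lattice_floor_def int_lattice_def)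

lemma lattice_floor_cell: "real k *\<^sub>R x \<in> lattice_cell (lattice_floor k x)"
  using lattice_cell_exists(2)[of "real k *\<^sub>R x"] by (simp add: lattice_floor_def)

lemma cell_point_eq:
  assumes k: "k \<ge> 1"
  shows "cell_point k x = lattice_floor k x /\<^sub>R real k"
proof -
  have k0: "real k > 0" using k by simp
  have iff: "(\<forall>i. x $ i \<in> {z $ i <.. z $ i + 1 / real k}) \<longleftrightarrow> real k *\<^sub>R x \<in> lattice_cell (real k *\<^sub>R z)" for z
    using k0 by (auto simp: lattice_cell_def field_simps)
  show ?thesis
    unfolding cell_point_def iff
  proof (rule the_equality)
    show "lattice_floor k x /\<^sub>R real k \<in> scaled_lattice k \<and> real k *\<^sub>R x \<in> lattice_cell (real k *\<^sub>R (lattice_floor k x /\<^sub>R real k))"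
      using k0 lattice_floor_cell[of k x] scaled_latticeI[OF k lattice_floor_in] by simp
    fix z assume z: "z \<in> scaled_lattice k \<and> real k *\<^sub>R x \<in> lattice_cell (real k *\<^sub>R z)"
    then have "real k *\<^sub>R z = lattice_floor k x"
      using lattice_cell_unique[OF _ lattice_floor_cell _ lattice_floor_in] by (auto simp: scaled_lattice_def)
    moreover have "z = (real k *\<^sub>R z) /\<^sub>R real k" using k0 by simp
    ultimately show "z = lattice_floor k x /\<^sub>R real k" by simp
  qed
qed

lemma lattice_floor_measurable [measurable]: "lattice_floor k \<in> measurable borel (count_space (int_lattice :: (real ^ 'd) set))"
proof (subst measurable_count_space_eq_countable, simp, intro conjI ballI)
  show "lattice_floor k \<in> space borel \<rightarrow> (int_lattice :: (real ^ 'd) set)" by (simp add: lattice_floor_in)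
  fix z :: "real ^ 'd"
  have "lattice_floor k -` {z} \<inter> space borel = {x. \<forall>i. of_int (\<lceil>real k * x $ i\<rceil> - 1) = z $ i}"
    by (auto simp: lattice_floor_def vec_eq_iff)
  also have "\<dots> \<in> sets borel" by measurable
  finally show "lattice_floor k -` {z} \<inter> space borel \<in> sets borel" .
qed

text \<open>Tonelli over the countably many base points. Each fibre of \<open>lattice_floor\<close>
  lies in a closed cube of side 1/k, which gives the upper bound.\<close>

lemma nn_integral_lattice_floor_le:
  fixes h :: "real ^ 'd \<Rightarrow> ennreal"
  assumes k: "k \<ge> 1"
  shows "(\<integral>\<^sup>+x. h (lattice_floor k x) \<partial>lborel) \<le> ennreal (1 / real k ^ CARD('d)) * (\<integral>\<^sup>+z. h z \<partial>count_space int_lattice)"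
proof -
  have k0: "real k > 0" using k by simp
  have "(\<integral>\<^sup>+x. h (lattice_floor k x) \<partial>lborel)
      = (\<integral>\<^sup>+x. \<integral>\<^sup>+z. h z * indicator {lattice_floor k x} z \<partial>count_space int_lattice \<partial>lborel)"
    by (intro nn_integral_cong, subst nn_integral_indicator_singleton) (simp_all add: lattice_floor_in)
  also have "\<dots> = (\<integral>\<^sup>+z. \<integral>\<^sup>+x. h z * indicator {lattice_floor k x} z \<partial>lborel \<partial>count_space (int_lattice :: (real ^ 'd) set))"
  proof (rule nn_integral_count_space_nn_integral[OF countable_int_lattice])
    fix z :: "real ^ 'd" assume z: "z \<in> int_lattice"
    have eq: "indicator {lattice_floor k x} z = (indicator {z} (lattice_floor k x) :: ennreal)" for x :: "real ^ 'd"
      by (auto simp: indicator_def)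
    have "(\<lambda>x. indicator {z} (lattice_floor k x) :: ennreal) \<in> borel_measurable lborel"
      by (rule measurable_compose[of _ _ "count_space int_lattice"]) auto
    then show "(\<lambda>x. h z * indicator {lattice_floor k x} z) \<in> borel_measurable lborel"
      unfolding eq by measurable
  qed
  also have "\<dots> \<le> (\<integral>\<^sup>+z. ennreal (1 / real k ^ CARD('d)) * h z \<partial>count_space (int_lattice :: (real ^ 'd) set))"
  proof (rule nn_integral_mono)
    fix z :: "real ^ 'd"
    let ?b = "cbox (z /\<^sub>R real k) (z /\<^sub>R real k + (1 / real k) *\<^sub>R 1)"
    have "(\<integral>\<^sup>+x. h z * indicator {lattice_floor k x} z \<partial>lborel) \<le> (\<integral>\<^sup>+x. h z * indicator ?b x \<partial>lborel)"
    proof (intro nn_integral_mono mult_left_mono)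
      fix x :: "real ^ 'd"
      show "indicator {lattice_floor k x} z \<le> (indicator ?b x :: ennreal)"
      proof (cases "z = lattice_floor k x")
        case True
        have "z $ i / real k \<le> x $ i \<and> x $ i \<le> z $ i / real k + 1 / real k" for i
        proof -
          have "z $ i < real k * x $ i" "real k * x $ i \<le> z $ i + 1"
            using lattice_floor_cell[of k x] unfolding True by (auto simp: lattice_cell_def)
          then show ?thesis using k0 by (simp add: add_divide_distrib[symmetric] divide_le_eq le_divide_eq mult.commute)
        qed
        then have "x \<in> ?b" by (auto simp: mem_box_cart divide_inverse_commute)
        then show ?thesis by (simp add: indicator_def)
      qed (simp add: indicator_def)
    qed simp
    also have "\<dots> = h z * emeasure lborel ?b" by (simp add: nn_integral_cmult)
    also have "emeasure lborel ?b = ennreal (1 / real k ^ CARD('d))"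
    proof -
      have Basis_one: "(1 :: real ^ 'd) \<bullet> b = 1" if "b \<in> Basis" for b
        using that by (auto simp: Basis_vec_def inner_axis)
      show ?thesis
        using k0 by (subst emeasure_lborel_cbox) (auto simp: inner_add_left Basis_one power_divide)
    qed
    finally show "(\<integral>\<^sup>+x. h z * indicator {lattice_floor k x} z \<partial>lborel) \<le> ennreal (1 / real k ^ CARD('d)) * h z"
      by (simp add: mult.commute)
  qed
  also have "\<dots> = ennreal (1 / real k ^ CARD('d)) * (\<integral>\<^sup>+z. h z \<partial>count_space int_lattice)"
    by (rule nn_integral_cmult) simp
  finally show ?thesis .
qed

lemma nn_integral_lattice_infsum:
  fixes f :: "'a \<Rightarrow> real"
  assumes f: "f summable_on A" "\<And>x. f x \<ge> 0"
  shows "(\<integral>\<^sup>+x. ennreal (f x) \<partial>count_space A) = ennreal (\<Sum>\<^sub>\<infinity>x\<in>A. f x)"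
proof -
  have i: "integrable (count_space A) f" using f integrable_count_space_iff_summable_on by blast
  have "(\<integral>\<^sup>+x. ennreal (f x) \<partial>count_space A) = ennreal (integral\<^sup>L (count_space A) f)"
    by (rule nn_integral_eq_integral[OF i]) (use f in auto)
  also have "integral\<^sup>L (count_space A) f = infsetsum f A" by (simp add: infsetsum_def)
  also have "\<dots> = infsum f A"
    by (rule infsetsum_infsum) (simp add: Infinite_Set_Sum.abs_summable_on_def i)
  finally show ?thesis .
qed


lemma lattice_extension_measurable: "k \<ge> 1 \<Longrightarrow> lattice_extension k u \<in> borel_measurable (borel :: (real ^ 'd) measure)"
  unfolding lattice_extension_def[abs_def]
  by (simp add: cell_point_eq, rule measurable_compose[OF lattice_floor_measurable]) simp

lemma ennreal_twice_sum: "0 \<le> a \<Longrightarrow> 0 \<le> b \<Longrightarrow> 2 * ennreal a + 2 * ennreal b = ennreal (2 * a + 2 * b)"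
  by (simp add: ennreal_mult)

text \<open>The error splits into the lattice error of \<open>u\<close>, carried over by
  \<open>nn_integral_lattice_floor_le\<close>, and the variation of \<open>g\<close> within one
  cell, which is O(1/k) and confined to a fixed ball.\<close>

lemma lattice_extension_error:
  fixes g :: "real ^ 'd \<Rightarrow> real"
  assumes g: "smooth_compact_support g"
  obtains C where "C > 0"
    "\<And>k u E. k \<ge> 1 \<Longrightarrow> (\<lambda>x. (u (x /\<^sub>R real k) - g (x /\<^sub>R real k))\<^sup>2) summable_on int_lattice \<Longrightarrow>
      (\<Sum>\<^sub>\<infinity>x\<in>int_lattice. (u (x /\<^sub>R real k) - g (x /\<^sub>R real k))\<^sup>2) \<le> real k ^ CARD('d) * E \<Longrightarrow>
      (\<integral>\<^sup>+x. ennreal ((lattice_extension k u x - g x)\<^sup>2) \<partial>lborel) \<le> ennreal (2 * E + C / (real k)\<^sup>2)"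
proof -
  define d where "d = real CARD('d)"
  have d: "d \<ge> 1" by (simp add: d_def Suc_leI)
  obtain B where B: "B > 0" "\<And>js x. length js \<le> 1 \<Longrightarrow> \<bar>iterated_partial js g x\<bar> \<le> B"
    by (rule smooth_compact_support_bounded[OF g]) blast
  obtain M where M: "M > 0" "\<And>js x. norm x > M \<Longrightarrow> iterated_partial js g x = 0"
    by (rule smooth_compact_support_vanish[OF g]) blast
  have gm [measurable]: "g \<in> borel_measurable borel"
    using smooth_compact_support_continuous[OF g, of UNIV "[]"] by (auto intro: borel_measurable_continuous_onI)
  define V where "V = unit_ball_vol (real CARD('d)) * (M + d) ^ CARD('d)"
  have V: "emeasure lborel (cball (0 :: real ^ 'd) (M + d)) = ennreal V" "V > 0"
    using M(1) d by (auto simp: V_def emeasure_cball add_pos_pos intro!: mult_pos_pos)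
  \<comment> \<open>One \<open>d\<close> bounds the distance to the cell point in units of 1/k, the
    other comes from the Lipschitz estimate. \<open>V\<close> is the volume of the support ball
    enlarged by \<open>d\<close>, and the 2 from splitting the square.\<close>
  define C where "C = 2 * (d * (d * B))\<^sup>2 * V"
  show ?thesis
  proof (rule that[of C])
    show "C > 0" unfolding C_def using d B(1) V(2) by (intro mult_pos_pos) auto
    fix k :: nat and u :: "real ^ 'd \<Rightarrow> real" and E :: real
    assume k: "k \<ge> 1" and S: "(\<lambda>x. (u (x /\<^sub>R real k) - g (x /\<^sub>R real k))\<^sup>2) summable_on int_lattice"
      and E: "(\<Sum>\<^sub>\<infinity>x\<in>int_lattice. (u (x /\<^sub>R real k) - g (x /\<^sub>R real k))\<^sup>2) \<le> real k ^ CARD('d) * E"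
    have k0: "real k > 0" using k by simp
    define p where "p x = lattice_extension k u x - g (cell_point k x)" for x
    define q where "q x = g (cell_point k x) - g x" for x
    have em [measurable]: "lattice_extension k u \<in> borel_measurable lborel" "lattice_extension k g \<in> borel_measurable lborel"
      using lattice_extension_measurable[OF k] by auto
    have pm: "p \<in> borel_measurable lborel"
      unfolding p_def using em(2) by (intro borel_measurable_diff em(1)) (simp add: lattice_extension_def[abs_def])
    have qm: "q \<in> borel_measurable lborel"
      unfolding q_def using em(2) gm by (intro borel_measurable_diff) (simp_all add: lattice_extension_def[abs_def])
    have "(\<integral>\<^sup>+x. ennreal ((p x)\<^sup>2) \<partial>lborel)
        = (\<integral>\<^sup>+x. ennreal ((u (lattice_floor k x /\<^sub>R real k) - g (lattice_floor k x /\<^sub>R real k))\<^sup>2) \<partial>lborel)"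
      by (simp add: p_def lattice_extension_def cell_point_eq[OF k])
    also have "\<dots> \<le> ennreal (1 / real k ^ CARD('d)) *
        (\<integral>\<^sup>+z. ennreal ((u (z /\<^sub>R real k) - g (z /\<^sub>R real k))\<^sup>2) \<partial>count_space int_lattice)"
      by (rule nn_integral_lattice_floor_le[OF k, of "\<lambda>z. ennreal ((u (z /\<^sub>R real k) - g (z /\<^sub>R real k))\<^sup>2)"])
    also have "\<dots> = ennreal (1 / real k ^ CARD('d)) * ennreal (\<Sum>\<^sub>\<infinity>x\<in>int_lattice. (u (x /\<^sub>R real k) - g (x /\<^sub>R real k))\<^sup>2)"
      by (subst nn_integral_lattice_infsum[OF S]) simp_all
    also have "\<dots> = ennreal (1 / real k ^ CARD('d) * (\<Sum>\<^sub>\<infinity>x\<in>int_lattice. (u (x /\<^sub>R real k) - g (x /\<^sub>R real k))\<^sup>2))"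
      by (rule ennreal_mult[symmetric]) (auto intro: infsum_nonneg)
    also have "\<dots> \<le> ennreal (1 / real k ^ CARD('d) * (real k ^ CARD('d) * E))"
      by (intro ennreal_leI mult_left_mono E) simp
    also have "\<dots> = ennreal E" using k0 by simp
    finally have p: "(\<integral>\<^sup>+x. ennreal ((p x)\<^sup>2) \<partial>lborel) \<le> ennreal E" .
    have qb: "(q x)\<^sup>2 \<le> (d * (d * B))\<^sup>2 / (real k)\<^sup>2 * indicator (cball 0 (M + d)) x" for x
    proof -
      have "norm (real k *\<^sub>R x - lattice_floor k x) \<le> d"
        unfolding d_def by (rule lattice_cell_norm_diff[OF lattice_floor_cell])
      moreover have "cell_point k x - x = (- 1 / real k) *\<^sub>R (real k *\<^sub>R x - lattice_floor k x)"
        using k0 by (simp add: cell_point_eq[OF k] scaleR_diff_right divide_inverse)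
      ultimately have nd: "norm (cell_point k x - x) \<le> d / real k"
        using k0 by (simp add: divide_right_mono)
      also have "d / real k \<le> d" using k d by (simp add: field_simps)
      finally have nd1: "norm (cell_point k x - x) \<le> d" .
      show ?thesis
      proof (cases "norm x \<le> M + d")
        case True
        have "\<bar>q x\<bar> \<le> d * (norm (cell_point k x - x) * B)"
          unfolding q_def d_def
          by (rule lipschitz_of_partial_bound)
             (use smooth_compact_supportD[OF g, of "[]"] B(2)[of "[_]"] in auto)
        also have "\<dots> \<le> d * (d / real k * B)"
          using nd B(1) d by (intro mult_left_mono mult_right_mono) auto
        finally have "(q x)\<^sup>2 \<le> (d * (d / real k * B))\<^sup>2"
          by (intro power2_le_iff_abs_le[THEN iffD2]) (use d B(1) in auto)
        then show ?thesis using True by (simp add: power_divide power_mult_distrib mult_ac)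
      next
        case False
        \<comment> \<open>The cell point is within \<open>d\<close> of \<open>x\<close>, so beyond
          radius \<open>M + d\<close> both values of \<open>g\<close> vanish.\<close>
        have "norm x \<le> norm (cell_point k x) + norm (cell_point k x - x)"
          by (metis norm_minus_commute norm_triangle_sub)
        then have "norm (cell_point k x) > M" using nd1 False by simp
        then show ?thesis using M(2)[of x "[]"] M(2)[of "cell_point k x" "[]"] False d by (simp add: q_def)
      qed
    qed
    have qe: "ennreal ((q x)\<^sup>2) \<le> ennreal ((d * (d * B))\<^sup>2 / (real k)\<^sup>2) * indicator (cball (0 :: real ^ 'd) (M + d)) x" for x
    proof (cases "x \<in> cball 0 (M + d)")
      case True
      then show ?thesis using ennreal_leI[OF qb[of x]] by simp
    next
      case False
      then show ?thesis using qb[of x] by simp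
    qed
    have "(\<integral>\<^sup>+x. ennreal ((q x)\<^sup>2) \<partial>lborel)
        \<le> (\<integral>\<^sup>+x. ennreal ((d * (d * B))\<^sup>2 / (real k)\<^sup>2) * indicator (cball (0 :: real ^ 'd) (M + d)) x \<partial>lborel)"
      by (rule nn_integral_mono) (rule qe)
    also have "\<dots> = ennreal ((d * (d * B))\<^sup>2 / (real k)\<^sup>2) * ennreal V"
      by (subst nn_integral_cmult_indicator) (auto simp: V)
    also have "\<dots> = ennreal ((d * (d * B))\<^sup>2 / (real k)\<^sup>2 * V)" using V(2) by (intro ennreal_mult[symmetric]) auto
    finally have q: "(\<integral>\<^sup>+x. ennreal ((q x)\<^sup>2) \<partial>lborel) \<le> ennreal ((d * (d * B))\<^sup>2 / (real k)\<^sup>2 * V)" .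
    have "(\<integral>\<^sup>+x. ennreal ((lattice_extension k u x - g x)\<^sup>2) \<partial>lborel) = (\<integral>\<^sup>+x. ennreal ((p x + q x)\<^sup>2) \<partial>lborel)"
      by (simp add: p_def q_def)
    also have "\<dots> \<le> 2 * (\<integral>\<^sup>+x. ennreal ((p x)\<^sup>2) \<partial>lborel) + 2 * (\<integral>\<^sup>+x. ennreal ((q x)\<^sup>2) \<partial>lborel)"
      by (rule nn_integral_square_add_le[OF pm qm])
    also have "\<dots> \<le> 2 * ennreal E + 2 * ennreal ((d * (d * B))\<^sup>2 / (real k)\<^sup>2 * V)"
      by (intro add_mono mult_left_mono p q) auto
    also have "\<dots> = ennreal (2 * E + C / (real k)\<^sup>2)"
    proof -
      have "E \<ge> 0"
      proof -
        have "0 \<le> (\<Sum>\<^sub>\<infinity>x\<in>int_lattice. (u (x /\<^sub>R real k) - g (x /\<^sub>R real k))\<^sup>2)" by (rule infsum_nonneg) simp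
        then have "0 \<le> real k ^ CARD('d) * E" using E by linarith
        moreover have "real k ^ CARD('d) > 0" using k0 by simp
        ultimately show ?thesis by (meson mult_pos_neg not_le)
      qed
      moreover have "(d * (d * B))\<^sup>2 / (real k)\<^sup>2 * V \<ge> 0" using V(2) by simp
      ultimately have "2 * ennreal E + 2 * ennreal ((d * (d * B))\<^sup>2 / (real k)\<^sup>2 * V)
          = ennreal (2 * E + 2 * ((d * (d * B))\<^sup>2 / (real k)\<^sup>2 * V))"
        using ennreal_twice_sum by blast
      then show ?thesis by (simp add: C_def mult.assoc)
    qed
    finally show "(\<integral>\<^sup>+x. ennreal ((lattice_extension k u x - g x)\<^sup>2) \<partial>lborel) \<le> ennreal (2 * E + C / (real k)\<^sup>2)" .
  qed
qed

section \<open>From the energy estimate to the rate\<close>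

lemma L2_norm_le:
  assumes f: "f \<in> borel_measurable M" and le: "(\<integral>\<^sup>+x. ennreal ((f x)\<^sup>2) \<partial>M) \<le> ennreal (c\<^sup>2)" and c: "c \<ge> 0"
  shows "L2_norm M f \<le> ennreal c"
proof -
  have "integrable M (\<lambda>x. (f x)\<^sup>2)"
    by (rule integrableI_nonneg) (use f le in \<open>auto intro: order_le_less_trans\<close>)
  then have s: "square_integrable_fun M f" using f by (simp add: square_integrable_fun_def)
  have "ennreal (LINT x|M. (f x)\<^sup>2) \<le> ennreal (c\<^sup>2)" using le by (simp add: nn_integral_square_eq[OF s])
  then have "(LINT x|M. (f x)\<^sup>2) \<le> c\<^sup>2" by (subst (asm) ennreal_le_iff) auto
  then have "sqrt (LINT x|M. (f x)\<^sup>2) \<le> c" using c by (rule real_le_lsqrt[rotated])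
  then show ?thesis using s by (simp add: L2_norm_def ennreal_leI)
qed

text \<open>The loss ln ln k is absorbed by an arbitrarily small power of ln k, so every exponent
  \<open>\<delta> > 0\<close> is within reach. The first inequality converts constants into such
  powers, as ln k may be below 1.\<close>

lemma ln_ge_powr_bound:
  fixes \<delta> :: real
  assumes "\<delta> > 0" "k \<ge> 2"
  shows "1 \<le> (1 / ln 2) powr \<delta> * ln (real k) powr \<delta>"
    "1 + ln (1 + ln (real k)) \<le> ((1 / ln 2) powr \<delta> + (1 + 1 / ln 2) powr \<delta> / \<delta>) * ln (real k) powr \<delta>"
proof -
  define T where "T = ln (real k)"
  have l2: "ln 2 > (0 :: real)" by simp
  have T: "T \<ge> ln 2" using assms(2) by (simp add: T_def)
  have T0: "T > 0" using T l2 by linarith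
  have "1 \<le> (1 / ln 2 * T) powr \<delta>"
    by (rule ge_one_powr_ge_zero) (use assms T l2 in \<open>auto simp: field_simps\<close>)
  also have "(1 / ln 2 * T) powr \<delta> = (1 / ln 2) powr \<delta> * T powr \<delta>"
    by (rule powr_mult)
  finally show 1: "1 \<le> (1 / ln 2) powr \<delta> * ln (real k) powr \<delta>" by (simp only: T_def)
  have "ln (1 + T) \<le> (1 + T) powr \<delta> / \<delta>"
    by (rule ln_powr_bound) (use T0 assms in auto)
  also have "\<dots> \<le> ((1 + 1 / ln 2) * T) powr \<delta> / \<delta>"
  proof (intro divide_right_mono powr_mono2)
    have "1 \<le> 1 / ln 2 * T" using T l2 by (simp add: field_simps)
    then show "1 + T \<le> (1 + 1 / ln 2) * T" by (simp add: distrib_right)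
  qed (use assms T0 in auto)
  also have "((1 + 1 / ln 2) * T) powr \<delta> = (1 + 1 / ln 2) powr \<delta> * T powr \<delta>"
    by (rule powr_mult)
  finally show "1 + ln (1 + ln (real k)) \<le> ((1 / ln 2) powr \<delta> + (1 + 1 / ln 2) powr \<delta> / \<delta>) * ln (real k) powr \<delta>"
    using 1 by (simp add: T_def distrib_right)
qed


text \<open>\<open>C0\<close> is chosen before the realisation and \<open>k\<close>; beyond the
  uniform bounds, the realisation enters only through \<open>good_conductances\<close>.\<close>

lemma homogenization_rate:
  fixes w :: "real ^ 'd \<Rightarrow> real ^ 'd \<Rightarrow> 'w \<Rightarrow> real"
  assumes d3: "CARD('d) \<ge> 3" and l: "l > 0" and C1: "0 < C1" and C2: "C1 \<le> C2" and H: "H \<ge> 0" and \<delta>: "\<delta> > 0"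
    and w: "\<And>x y \<omega>. x \<in> int_lattice \<Longrightarrow> y \<in> int_lattice \<Longrightarrow> x \<noteq> y \<Longrightarrow> \<omega> \<in> \<Omega> \<Longrightarrow> w x y \<omega> = w y x \<omega> \<and> C1 \<le> w x y \<omega> \<and> w x y \<omega> \<le> C2"
    and f: "f \<in> test_class l"
  shows "\<exists>C0>0. \<forall>\<omega>\<in>\<Omega>. \<forall>k\<ge>2. good_conductances H k (\<lambda>x y. w x y \<omega>) \<longrightarrow>
       L2_norm lborel (\<lambda>x. lattice_extension k (scaled_resolvent w l k \<omega> f) x - limit_resolvent l f x)
        \<le> ennreal (C0 * ln (real k) powr (- 1 / 2 + \<delta> / 2))"
proof -
  let ?L = "int_lattice :: (real ^ 'd) set"
  obtain g where g: "smooth_compact_support g" and f_eq: "f = (\<lambda>x. l * g x - limit_generator g x)"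
    using f by (auto simp: test_class_def)
  have a0: "a0 TYPE('d) \<ge> 0" using a0_asymp[where 'd='d] by metis
  have d2: "CARD('d) \<ge> 2" using d3 by simp
  obtain Ce where Ce: "Ce > 0"
    "\<And>k u E. k \<ge> 1 \<Longrightarrow> (\<lambda>x. (u (x /\<^sub>R real k) - g (x /\<^sub>R real k))\<^sup>2) summable_on ?L \<Longrightarrow>
      (\<Sum>\<^sub>\<infinity>x\<in>?L. (u (x /\<^sub>R real k) - g (x /\<^sub>R real k))\<^sup>2) \<le> real k ^ CARD('d) * E \<Longrightarrow>
      (\<integral>\<^sup>+x. ennreal ((lattice_extension k u x - g x)\<^sup>2) \<partial>lborel) \<le> ennreal (2 * E + Ce / (real k)\<^sup>2)"
    by (rule lattice_extension_error[OF g]) blast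
  obtain M' where M': "\<And>js x. norm x > M' \<Longrightarrow> iterated_partial js g x = 0"
    by (rule smooth_compact_support_vanish[OF g]) blast
  show ?thesis
  proof (rule deterministic_estimate[OF g d2 l C1 C2 H])
    fix C M :: real
    assume C: "C > 0" and M: "M > 0" and det:
      "\<And>k R wt U. k \<ge> 2 \<Longrightarrow> 1 \<le> R \<Longrightarrow> R \<le> real k \<Longrightarrow>
         (\<And>x y. x \<in> ?L \<Longrightarrow> y \<in> ?L \<Longrightarrow> x \<noteq> y \<Longrightarrow> wt x y = wt y x \<and> C1 \<le> wt x y \<and> wt x y \<le> C2) \<Longrightarrow>
         (\<And>i u y. u \<in> lattice_ball ((M + 3) * real k) \<Longrightarrow> y \<in> lattice_ball ((M + 3) * real k) \<Longrightarrow>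
           (fluctuation (\<lambda>x y. wt x y - 1) R k i u y)\<^sup>2
            \<le> H * R ^ (CARD('d) - 2) / max R (norm (u - y) / 2) ^ (3 * CARD('d) + 1)) \<Longrightarrow>
         (\<lambda>x. (U x)\<^sup>2) summable_on ?L \<Longrightarrow>
         (\<And>x. x \<in> ?L \<Longrightarrow> l * U x
            - (\<Sum>\<^sub>\<infinity>y\<in>?L. (real k ^ 2 / ln (real k) * (wt x y * jump_kernel (x - y))) * (U y - U x))
            = l * g (x /\<^sub>R real k) - limit_generator g (x /\<^sub>R real k)) \<Longrightarrow>
         (\<lambda>x. (U x - g (x /\<^sub>R real k))\<^sup>2) summable_on ?L \<and>
         (\<Sum>\<^sub>\<infinity>x\<in>?L. (U x - g (x /\<^sub>R real k))\<^sup>2) \<le> C * real k ^ CARD('d) * (1 + ln R) / ln (real k)"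
    define c\<delta> where "c\<delta> = (1 / ln 2) powr \<delta> + (1 + 1 / ln 2) powr \<delta> / \<delta>"
    define D1 where "D1 = (1 / ln 2) powr \<delta>"
    have D1: "D1 > 0" by (simp add: D1_def)
    \<comment> \<open>\<open>c\<delta>\<close> serves the regular choice of \<open>R\<close>. The
      second term serves the finitely many k < M + 3, where \<open>R\<close> is taken as k and its
      logarithm is bounded; \<open>D1\<close> turns that bound into a power of ln k.\<close>
    define D where "D = c\<delta> + (1 + ln (M + 3)) * D1"
    have lM: "ln (M + 3) \<ge> 0" using M by simp
    have D0: "D \<ge> 0" "c\<delta> \<ge> 0" using D1 lM \<delta> by (auto simp: D_def c\<delta>_def)
    define K where "K = 2 * C * D + Ce * D1"
    have K: "K > 0" unfolding K_def using C D0 Ce D1 by (intro add_nonneg_pos mult_nonneg_nonneg mult_pos_pos) auto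
    show ?thesis
    proof (intro exI[of _ "sqrt K"] conjI ballI allI impI)
      show "sqrt K > 0" using K by simp
      fix \<omega> k assume \<omega>: "\<omega> \<in> \<Omega>" and k: "k \<ge> 2" and good: "good_conductances H k (\<lambda>x y. w x y \<omega>)"
      have k1: "k \<ge> 1" and k0: "real k > 0" and lk: "ln (real k) > 0" using k by auto
      define T where "T = ln (real k)"
      define u where "u = scaled_resolvent w l k \<omega> f"
      have fS: "(\<lambda>x. f (x /\<^sub>R real k)) summable_on ?L"
      proof (rule has_sum_imp_summable, rule infsum_finite_support)
        show "finite (lattice_ball (M' * real k) :: (real ^ 'd) set)" by simp
        show "lattice_ball (M' * real k) \<subseteq> ?L" by (auto simp: lattice_ball_def)
        fix x :: "real ^ 'd" assume "x \<in> ?L" "x \<notin> lattice_ball (M' * real k)"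
        then have "M' < norm x / real k" using k0 by (simp add: lattice_ball_def pos_less_divide_eq)
        also have "norm x / real k = norm (x /\<^sub>R real k)" by (simp add: divide_inverse_commute)
        finally have z: "iterated_partial js g (x /\<^sub>R real k) = 0" for js by (rule M')
        show "f (x /\<^sub>R real k) = 0"
          unfolding f_eq limit_generator_iterated using z[of "[]"] z by (simp del: iterated_partial_simps(2))
      qed
      have wsol: "w x y \<omega> = w y x \<omega> \<and> 0 \<le> w x y \<omega> \<and> w x y \<omega> \<le> C2" if "x \<in> ?L" "y \<in> ?L" "x \<noteq> y" for x y
        using w[OF that \<omega>] C1 by linarith
      have C2_0: "C2 \<ge> 0" using C1 C2 by simp
      have sol: "(\<lambda>x. (u (x /\<^sub>R real k))\<^sup>2) summable_on ?L"
        unfolding u_def by (rule scaled_resolvent_solves(1)[OF k l C2_0 _ fS]) (rule wsol)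
      have sol': "l * u (x /\<^sub>R real k)
            - (\<Sum>\<^sub>\<infinity>y\<in>?L. (real k ^ 2 / ln (real k) * (w x y \<omega> * jump_kernel (x - y))) * (u (y /\<^sub>R real k) - u (x /\<^sub>R real k)))
            = f (x /\<^sub>R real k)" if "x \<in> ?L" for x
        unfolding u_def by (rule scaled_resolvent_solves(2)[OF k l C2_0 _ fS that]) (rule wsol)
      have "\<exists>R. 1 \<le> R \<and> R \<le> real k \<and> 1 + ln R \<le> D * T powr \<delta> \<and>
         (\<forall>i. \<forall>u\<in>lattice_ball ((M + 3) * real k). \<forall>y\<in>lattice_ball ((M + 3) * real k).
           (fluctuation (\<lambda>x y. w x y \<omega> - 1) R k i u y)\<^sup>2
            \<le> H * R ^ (CARD('d) - 2) / max R (norm (u - y) / 2) ^ (3 * CARD('d) + 1))"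
      proof (cases "M + 3 \<le> real k")
        case True
        then have "(M + 3) * real k \<le> (real k)\<^sup>2" using k0 by (simp add: power2_eq_square)
        then have sub: "lattice_ball ((M + 3) * real k) \<subseteq> (lattice_ball ((real k)\<^sup>2) :: (real ^ 'd) set)"
          by (auto simp: lattice_ball_def)
        have "1 + ln (truncation k) \<le> c\<delta> * T powr \<delta>"
          using ln_ge_powr_bound(2)[OF \<delta> k] by (simp add: truncation_def c\<delta>_def T_def)
        also have "\<dots> \<le> D * T powr \<delta>"
          unfolding D_def using lM D1 by (intro mult_right_mono) auto
        finally have "1 + ln (truncation k) \<le> D * T powr \<delta>" .
        moreover have "1 \<le> truncation k" "truncation k \<le> real k"
          using lk ln_le_minus_one[of "real k"] k0 by (auto simp: truncation_def)
        ultimately show ?thesis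
          using good sub unfolding good_conductances_def by (intro exI[of _ "truncation k"]) blast
      next
        case False
        \<comment> \<open>For these finitely many \<open>k\<close> the conductances are only known to be good on a ball that is too
        small; with \<open>R = k\<close> no jump is of intermediate length.\<close>
      have no_mid: "{x \<in> ?L. mid_range (real k) k x y} = {}" for y by (auto simp: mid_range_def)
        have "1 + ln (real k) \<le> (1 + ln (M + 3)) * 1" using False k0 by simp
        also have "\<dots> \<le> (1 + ln (M + 3)) * (D1 * T powr \<delta>)"
          using ln_ge_powr_bound(1)[OF \<delta> k] lM by (intro mult_left_mono) (auto simp: D1_def T_def)
        also have "\<dots> = (1 + ln (M + 3)) * D1 * T powr \<delta>" by simp
        also have "\<dots> \<le> D * T powr \<delta>" unfolding D_def using D0 by (intro mult_right_mono) auto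
        finally show ?thesis
          using H k1 by (intro exI[of _ "real k"]) (simp add: fluctuation_def no_mid le_max_iff_disj)
      qed
      then obtain R where R: "1 \<le> R" "R \<le> real k" "1 + ln R \<le> D * T powr \<delta>"
        "\<And>i u y. u \<in> lattice_ball ((M + 3) * real k) \<Longrightarrow> y \<in> lattice_ball ((M + 3) * real k) \<Longrightarrow>
           (fluctuation (\<lambda>x y. w x y \<omega> - 1) R k i u y)\<^sup>2
            \<le> H * R ^ (CARD('d) - 2) / max R (norm (u - y) / 2) ^ (3 * CARD('d) + 1)" by blast
      have est: "(\<lambda>x. (u (x /\<^sub>R real k) - g (x /\<^sub>R real k))\<^sup>2) summable_on ?L \<and>
         (\<Sum>\<^sub>\<infinity>x\<in>?L. (u (x /\<^sub>R real k) - g (x /\<^sub>R real k))\<^sup>2) \<le> C * real k ^ CARD('d) * (1 + ln R) / ln (real k)"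
      proof (rule det[OF k R(1,2), of "\<lambda>x y. w x y \<omega>"])
        show "w x y \<omega> = w y x \<omega> \<and> C1 \<le> w x y \<omega> \<and> w x y \<omega> \<le> C2" if "x \<in> ?L" "y \<in> ?L" "x \<noteq> y" for x y
          using w[OF that \<omega>] .
        show "(\<lambda>x. (u (x /\<^sub>R real k))\<^sup>2) summable_on ?L" by (rule sol)
        show "l * u (x /\<^sub>R real k)
            - (\<Sum>\<^sub>\<infinity>y\<in>?L. (real k ^ 2 / ln (real k) * (w x y \<omega> * jump_kernel (x - y))) * (u (y /\<^sub>R real k) - u (x /\<^sub>R real k)))
            = l * g (x /\<^sub>R real k) - limit_generator g (x /\<^sub>R real k)" if "x \<in> ?L" for x
          using sol'[OF that] by (simp add: f_eq)
      qed (rule R(4))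
      define E where "E = C * (1 + ln R) / T"
      have est': "(\<Sum>\<^sub>\<infinity>x\<in>?L. (u (x /\<^sub>R real k) - g (x /\<^sub>R real k))\<^sup>2) \<le> real k ^ CARD('d) * E"
        using est by (simp add: E_def T_def mult_ac)
      have T: "T > 0" using lk by (simp add: T_def)
      have Tpow: "(T powr (- 1 / 2 + \<delta> / 2))\<^sup>2 = T powr \<delta> / T"
      proof -
        have "(T powr (- 1 / 2 + \<delta> / 2))\<^sup>2 = T powr (\<delta> - 1)"
          using T by (simp add: power2_eq_square powr_add[symmetric])
        then show ?thesis using T by (simp add: powr_diff)
      qed
      have "2 * E + Ce / (real k)\<^sup>2 \<le> (sqrt K * T powr (- 1 / 2 + \<delta> / 2))\<^sup>2"
      proof -
        have "E \<le> C * (D * T powr \<delta>) / T"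
          unfolding E_def using R(3) C T by (intro divide_right_mono mult_left_mono) auto
        \<comment> \<open>The discretisation error 1/k^2 lies below 1/ln k and is absorbed into the
          rate.\<close>
        moreover have "Ce / (real k)\<^sup>2 \<le> Ce * (D1 * T powr \<delta>) / T"
        proof -
          have "ln (real k) \<le> real k * 1" using ln_le_minus_one[of "real k"] k0 by simp
          also have "\<dots> \<le> (real k)\<^sup>2" unfolding power2_eq_square using k1 by (intro mult_left_mono) auto
          finally have "T \<le> (real k)\<^sup>2" by (simp add: T_def)
          then have "Ce / (real k)\<^sup>2 \<le> Ce / T" using T Ce(1) k0 by (intro divide_left_mono) auto
          also have "\<dots> = Ce * 1 / T" by simp
          also have "\<dots> \<le> Ce * (D1 * T powr \<delta>) / T"
            using ln_ge_powr_bound(1)[OF \<delta> k] T Ce(1)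
            by (intro divide_right_mono mult_left_mono) (auto simp: D1_def T_def)
          finally show ?thesis .
        qed
        ultimately have "2 * E + Ce / (real k)\<^sup>2 \<le> 2 * (C * (D * T powr \<delta>) / T) + Ce * (D1 * T powr \<delta>) / T"
          by (intro add_mono mult_left_mono) auto
        also have "\<dots> = K * (T powr \<delta> / T)"
          by (simp add: K_def distrib_right add_divide_distrib mult.assoc)
        also have "\<dots> = (sqrt K * T powr (- 1 / 2 + \<delta> / 2))\<^sup>2"
          unfolding power_mult_distrib Tpow using K by simp
        finally show ?thesis .
      qed
      then have int: "(\<integral>\<^sup>+x. ennreal ((lattice_extension k u x - g x)\<^sup>2) \<partial>lborel) \<le> ennreal ((sqrt K * T powr (- 1 / 2 + \<delta> / 2))\<^sup>2)"
        using Ce(2)[OF k1 conjunct1[OF est] est'] ennreal_leI order_trans by blast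
      note lim = limit_resolvent_eq[OF g l a0 f_eq]
      have "L2_norm lborel (\<lambda>x. lattice_extension k u x - limit_resolvent l f x) \<le> ennreal (sqrt K * T powr (- 1 / 2 + \<delta> / 2))"
      proof (rule L2_norm_le)
        show "(\<lambda>x. lattice_extension k u x - limit_resolvent l f x) \<in> borel_measurable lborel"
          using lim(1) lattice_extension_measurable[OF k1, of u] by (intro borel_measurable_diff) (auto simp: square_integrable_fun_def)
        have "(\<integral>\<^sup>+x. ennreal ((lattice_extension k u x - limit_resolvent l f x)\<^sup>2) \<partial>lborel)
            = (\<integral>\<^sup>+x. ennreal ((lattice_extension k u x - g x)\<^sup>2) \<partial>lborel)"
          by (rule nn_integral_cong_AE) (use lim(2) in \<open>eventually_elim, simp\<close>)
        then show "(\<integral>\<^sup>+x. ennreal ((lattice_extension k u x - limit_resolvent l f x)\<^sup>2) \<partial>lborel)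
            \<le> ennreal ((sqrt K * T powr (- 1 / 2 + \<delta> / 2))\<^sup>2)" using int by simp
      qed (use K in simp)
      then show "L2_norm lborel (\<lambda>x. lattice_extension k (scaled_resolvent w l k \<omega> f) x - limit_resolvent l f x)
          \<le> ennreal (sqrt K * ln (real k) powr (- 1 / 2 + \<delta> / 2))" by (simp add: u_def T_def)
    qed
  qed
qed

text \<open>\<open>Bad k\<close> contributes k + 1 rather than k, so that k >= \<open>k0\<close>
  excludes k itself. A countable supremum in \<open>ereal\<close> is measurable, and it is finite
  wherever only finitely many \<open>Bad k\<close> occur.\<close>

lemma last_exceptional_index:
  assumes Bad: "\<And>k::nat. Bad k \<in> sets M" and fin: "AE \<omega> in M. finite {k. \<omega> \<in> Bad k}"
  shows "\<exists>k0 :: 'w \<Rightarrow> ereal. k0 \<in> borel_measurable M \<and> (\<forall>\<omega>. k0 \<omega> \<ge> 1) \<and> (AE \<omega> in M. k0 \<omega> < \<infinity>) \<and>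
    (\<forall>\<omega> k. ereal (real k) \<ge> k0 \<omega> \<longrightarrow> \<omega> \<notin> Bad k)"
proof -
  define t where "t k \<omega> = (if \<omega> \<in> Bad k then ereal (real k + 1) else 0)" for k \<omega>
  define k0 where "k0 \<omega> = max 1 (SUP k. t k \<omega>)" for \<omega>
  have [measurable]: "t k \<in> borel_measurable M" for k
    unfolding t_def using Bad by (intro measurable_If_set) auto
  have m: "k0 \<in> borel_measurable M"
    unfolding k0_def by measurable
  have f: "AE \<omega> in M. k0 \<omega> < \<infinity>"
    using fin
  proof eventually_elim
    case (elim \<omega>)
    have "t k \<omega> \<le> ereal (\<Sum>j\<in>{k. \<omega> \<in> Bad k}. real j + 1)" for k
    proof (cases "\<omega> \<in> Bad k")
      case True
      have "real k + 1 \<le> (\<Sum>j\<in>{k. \<omega> \<in> Bad k}. real j + 1)"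
        by (rule member_le_sum[of k]) (use elim True in auto)
      then show ?thesis using True by (simp add: t_def)
    qed (simp add: t_def sum_nonneg)
    then have "(SUP k. t k \<omega>) \<le> ereal (\<Sum>j\<in>{k. \<omega> \<in> Bad k}. real j + 1)" by (rule SUP_least)
    then have "(SUP k. t k \<omega>) < \<infinity>" by (rule le_less_trans) simp
    then show ?case by (simp only: k0_def max_less_iff_conj) simp
  qed
  have b: "\<omega> \<notin> Bad k" if "ereal (real k) \<ge> k0 \<omega>" for \<omega> k
  proof
    assume "\<omega> \<in> Bad k"
    then have "ereal (real k + 1) = t k \<omega>" by (simp add: t_def)
    also have "\<dots> \<le> (SUP k. t k \<omega>)" by (rule SUP_upper) simp
    also have "\<dots> \<le> k0 \<omega>" by (simp add: k0_def)
    also have "\<dots> \<le> ereal (real k)" by (rule that)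
    finally show False by simp
  qed
  show ?thesis using m f b by (intro exI[of _ k0]) (simp add: k0_def)
qed

theorem theorem1p1:
  fixes M :: "'w measure" and w :: "real ^ 'd \<Rightarrow> real ^ 'd \<Rightarrow> 'w \<Rightarrow> real"
  assumes "CARD('d) > 3" and "assumption_H1 M w"
  shows "\<forall>l>0. \<forall>\<gamma>>0. \<exists>k0 :: 'w \<Rightarrow> ereal.
    k0 \<in> borel_measurable M \<and> (\<forall>\<omega>\<in>space M. k0 \<omega> \<ge> 1) \<and> (AE \<omega> in M. k0 \<omega> < \<infinity>) \<and>
    (\<forall>f\<in>test_class l. \<exists>C0>0. \<forall>\<omega>\<in>space M. k0 \<omega> < \<infinity> \<longrightarrow>
      (\<forall>k\<ge>2. ereal (real k) \<ge> k0 \<omega> \<longrightarrow>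
        L2_norm lborel
          (\<lambda>x. lattice_extension k (scaled_resolvent w l k \<omega> f) x - limit_resolvent l f x)
        \<le> ennreal (C0 * ln (real k) powr (- 1 / 2 + (1 + \<gamma>) / (2 * (real CARD('d) - 2))))))"
proof (intro allI impI)
  fix l \<gamma> :: real assume l: "l > 0" and \<gamma>: "\<gamma> > 0"
  have d3: "CARD('d) \<ge> 3" using assms(1) by simp
  \<comment> \<open>\<open>\<delta> / 2\<close> is the loss in the exponent that the statement
    allows.\<close>
  define \<delta> where "\<delta> = (1 + \<gamma>) / (real CARD('d) - 2)"
  have \<delta>: "\<delta> > 0" using \<gamma> assms(1) by (simp add: \<delta>_def)
  have \<delta>2: "\<delta> / 2 = (1 + \<gamma>) / (2 * (real CARD('d) - 2))" by (simp add: \<delta>_def)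
  have "\<exists>C1 C2. 0 < C1 \<and> C1 \<le> C2 \<and> (\<forall>x\<in>int_lattice. \<forall>y\<in>int_lattice. x \<noteq> y \<longrightarrow>
      (\<forall>\<omega>\<in>space M. C1 \<le> w x y \<omega> \<and> w x y \<omega> \<le> C2))"
    using assms(2) by (simp add: assumption_H1_def)
  then obtain C1 C2 where C: "0 < C1" "C1 \<le> C2" and bounds: "\<forall>x\<in>int_lattice. \<forall>y\<in>int_lattice. x \<noteq> y \<longrightarrow>
      (\<forall>\<omega>\<in>space M. C1 \<le> w x y \<omega> \<and> w x y \<omega> \<le> C2)" by blast
  have sym: "\<forall>x\<in>int_lattice. \<forall>y\<in>int_lattice. x \<noteq> y \<longrightarrow> (\<forall>\<omega>\<in>space M. w x y \<omega> = w y x \<omega>)"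
    using assms(2) by (simp add: assumption_H1_def)
  have w: "w x y \<omega> = w y x \<omega> \<and> C1 \<le> w x y \<omega> \<and> w x y \<omega> \<le> C2"
    if "x \<in> int_lattice" "y \<in> int_lattice" "x \<noteq> y" "\<omega> \<in> space M" for x y \<omega>
    using bounds sym that by blast
  have bd: "0 \<le> w x y \<omega> \<and> w x y \<omega> \<le> C2" if "x \<in> int_lattice" "y \<in> int_lattice" "x \<noteq> y" "\<omega> \<in> space M" for x y \<omega>
    using w[OF that] C(1) by linarith
  have C2: "C2 \<ge> 0" using C by simp
  \<comment> \<open>\<open>H\<close>, \<open>Bad\<close> and then \<open>k0\<close> are obtained
    before a test function is fixed, which makes \<open>k0\<close> independent of
    \<open>f\<close>.\<close>
  have "\<exists>H Bad. H \<ge> 0 \<and> (\<forall>k. Bad k \<in> sets M) \<and>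
    (\<forall>k\<ge>2. \<forall>\<omega>\<in>space M. \<omega> \<notin> Bad k \<longrightarrow> good_conductances H k (\<lambda>x y. w x y \<omega>)) \<and>
    (AE \<omega> in M. finite {k. \<omega> \<in> Bad k})"
    by (rule good_conductances_prob[OF assms(2) d3 _ C2]) (rule bd)
  then obtain H Bad where H: "H \<ge> 0" and Bad: "\<forall>k. Bad k \<in> sets M"
    and good: "\<forall>k\<ge>2. \<forall>\<omega>\<in>space M. \<omega> \<notin> Bad k \<longrightarrow> good_conductances H k (\<lambda>x y. w x y \<omega>)"
    and fin: "AE \<omega> in M. finite {k. \<omega> \<in> Bad k}"
    by (elim exE conjE)
  obtain k0 :: "'w \<Rightarrow> ereal" where k0: "k0 \<in> borel_measurable M" "\<forall>\<omega>. k0 \<omega> \<ge> 1" "AE \<omega> in M. k0 \<omega> < \<infinity>"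
    and k0_good: "\<forall>\<omega> k. ereal (real k) \<ge> k0 \<omega> \<longrightarrow> \<omega> \<notin> Bad k"
    using last_exceptional_index[OF Bad[rule_format] fin] by (elim exE conjE)
  have "\<exists>C0>0. \<forall>\<omega>\<in>space M. k0 \<omega> < \<infinity> \<longrightarrow> (\<forall>k\<ge>2. ereal (real k) \<ge> k0 \<omega> \<longrightarrow>
        L2_norm lborel (\<lambda>x. lattice_extension k (scaled_resolvent w l k \<omega> f) x - limit_resolvent l f x)
        \<le> ennreal (C0 * ln (real k) powr (- 1 / 2 + (1 + \<gamma>) / (2 * (real CARD('d) - 2)))))"
    if f: "f \<in> test_class l" for f
  proof -
    have "\<exists>C0>0. \<forall>\<omega>\<in>space M. \<forall>k\<ge>2. good_conductances H k (\<lambda>x y. w x y \<omega>) \<longrightarrow>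
       L2_norm lborel (\<lambda>x. lattice_extension k (scaled_resolvent w l k \<omega> f) x - limit_resolvent l f x)
        \<le> ennreal (C0 * ln (real k) powr (- 1 / 2 + \<delta> / 2))"
      by (rule homogenization_rate[OF d3 l C H \<delta> _ f]) (rule w)
    then show ?thesis
      using good k0_good unfolding \<delta>2 by meson
  qed
  then show "\<exists>k0 :: 'w \<Rightarrow> ereal.
    k0 \<in> borel_measurable M \<and> (\<forall>\<omega>\<in>space M. k0 \<omega> \<ge> 1) \<and> (AE \<omega> in M. k0 \<omega> < \<infinity>) \<and>
    (\<forall>f\<in>test_class l. \<exists>C0>0. \<forall>\<omega>\<in>space M. k0 \<omega> < \<infinity> \<longrightarrow>
      (\<forall>k\<ge>2. ereal (real k) \<ge> k0 \<omega> \<longrightarrow>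
        L2_norm lborel
          (\<lambda>x. lattice_extension k (scaled_resolvent w l k \<omega> f) x - limit_resolvent l f x)
        \<le> ennreal (C0 * ln (real k) powr (- 1 / 2 + (1 + \<gamma>) / (2 * (real CARD('d) - 2))))))"
    using k0 by (intro exI[of _ k0] conjI ballI) simp_all
qed

end
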